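(* Assume $\det R_1\neq 0$ and $\det R_2=0$. Let $k\ge0$ be an integer, and let $A_1:W^1(-N,2N+1)\to L_2(0,N+1)$ be a bounded linear operator which also acts as a bounded operator $A_1:W^{k+1}(-N,2N+1)\to W^k(0,N+1)$. Put $$\mathcal W^k(-N,2N+1)=W^k(0,N+1)\times W^{k+2}(-N,0)\times W^{k+2}(N+1,2N+1).$$ Then the bounded linear operator $\mathcal L_B:W^{k+2}(-N,2N+1)\to\mathcal W^k(-N,2N+1)$ defined by $$\mathcal L_By=\bigl(-(P_QRy)''+A_1y,\ y|_{(-N,0)},\ y|_{(N+1,2N+1)}\bigr)$$ is Fredholm and $\operatorname{ind}\mathcal L_B=-2(k+1)$.
   Context: $N\ge1$ is a natural number and $b_j$ ($-N\le j\le N$) are real numbers. $W^k(a,b)$ is the $L_2$-based Sobolev space of order $k$ ($W^0=L_2$). For a function $y$ on $(-N,2N+1)$, $P_QRy$ is the function on $(0,N+1)$ given by $(P_QRy)(t)=\sum_{j=-N}^N b_j y(t+j)$, $t\in(0,N+1)$. $R_1$ is the $(N+1)\times(N+1)$ matrix with entries $r_{ik}=b_{k-i}$ ($i,k=1,\dots,N+1$), and $R_2$ is the $N\times N$ matrix obtained from $R_1$ by deleting the last row and the last column. A bounded operator $T$ between Banach spaces is Fredholm if $\dim\ker T<\infty$ and its range is closed and of finite codimension; $\operatorname{ind}T=\dim\ker T-\operatorname{codim}\operatorname{Im}T$. *)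

theory Defs
  imports "HOL-Analysis.Analysis" "Jordan_Normal_Form.Determinant"
begin

section \<open>Functions on the line modulo equality almost everywhere\<close>

text \<open>A function on an interval \<open>(a, b)\<close> is represented by its extension by zero, so that the
  function spaces over different intervals are subsets of one type. The scalars are an arbitrary
  type in \<open>{real_normed_field, euclidean_space}\<close>; both \<^typ>\<open>real\<close> and \<^typ>\<open>complex\<close> are instances.\<close>

quotient_type 'a aefun = "real \<Rightarrow> 'a" / "\<lambda>f g. AE x in lebesgue. f x = g x"
proof (rule equivpI)
  show "reflp (\<lambda>(f :: real \<Rightarrow> 'a) g. AE x in lebesgue. f x = g x)"
    by (simp add: reflp_def)
  show "symp (\<lambda>(f :: real \<Rightarrow> 'a) g. AE x in lebesgue. f x = g x)"
    by (simp add: symp_def eq_commute)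
  show "transp (\<lambda>(f :: real \<Rightarrow> 'a) g. AE x in lebesgue. f x = g x)"
    unfolding transp_def
  proof (intro allI impI)
    fix f g h :: "real \<Rightarrow> 'a"
    assume "AE x in lebesgue. f x = g x" "AE x in lebesgue. g x = h x"
    then show "AE x in lebesgue. f x = h x"
      by eventually_elim simp
  qed
qed

instantiation aefun :: (ab_group_add) ab_group_add
begin

lift_definition zero_aefun :: "'a aefun" is "\<lambda>_. 0" .

lift_definition plus_aefun :: "'a aefun \<Rightarrow> 'a aefun \<Rightarrow> 'a aefun" is "\<lambda>f g x. f x + g x"
  by (erule (1) eventually_elim2) simp

lift_definition minus_aefun :: "'a aefun \<Rightarrow> 'a aefun \<Rightarrow> 'a aefun" is "\<lambda>f g x. f x - g x"
  by (erule (1) eventually_elim2) simp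

lift_definition uminus_aefun :: "'a aefun \<Rightarrow> 'a aefun" is "\<lambda>f x. - f x"
  by (erule eventually_mono) simp

instance
  by standard (transfer; simp add: algebra_simps)+

end

lift_definition scale_aefun :: "'a::field \<Rightarrow> 'a aefun \<Rightarrow> 'a aefun" is "\<lambda>c f x. c * f x"
  by (erule eventually_mono) simp

lemma vector_space_scale_aefun: "vector_space scale_aefun"
  by standard (transfer; simp add: algebra_simps)+

lemma AE_lebesgue_shift:
  fixes P :: "real \<Rightarrow> bool"
  assumes "AE x in lebesgue. P x"
  shows "AE x in lebesgue. P (x + h)"
proof -
  from assms have "AE x in lborel. P x"
    by (simp add: AE_completion_iff)
  then obtain N where N: "\<And>x. x \<in> space lborel - N \<Longrightarrow> P x" "N \<in> null_sets lborel"
    by (rule AE_E3) (rule that)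
  have "{x. x - (- h) \<in> N} \<in> null_sets lborel"
    using N(2) by (rule null_sets_translation)
  moreover have "{x \<in> space lborel. \<not> P (x + h)} \<subseteq> {x. x - (- h) \<in> N}"
    using N(1)[of "x + h" for x] by auto
  ultimately have "AE x in lborel. P (x + h)"
    by (rule AE_I')
  then show ?thesis
    by (simp add: AE_completion_iff)
qed

lemma integral_lebesgue_cong_AE:
  fixes f g :: "real \<Rightarrow> 'b::euclidean_space"
  assumes "AE x in lebesgue. f x = g x"
  shows "integrable lebesgue f \<longleftrightarrow> integrable lebesgue g"
    and "integral\<^sup>L lebesgue f = integral\<^sup>L lebesgue g"
proof -
  have sym: "AE x in lebesgue. g x = f x"
    using assms by eventually_elim simp
  have fg: "f \<in> borel_measurable lebesgue \<longleftrightarrow> g \<in> borel_measurable lebesgue"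
    using borel_measurable_AE[OF _ assms] borel_measurable_AE[OF _ sym] by (rule iffI)
  show *: "integrable lebesgue f \<longleftrightarrow> integrable lebesgue g"
  proof (cases "f \<in> borel_measurable lebesgue")
    case True
    then show ?thesis
      using fg assms by (intro integrable_cong_AE) auto
  next
    case False
    then show ?thesis
      using fg borel_measurable_integrable by blast
  qed
  show "integral\<^sup>L lebesgue f = integral\<^sup>L lebesgue g"
  proof (cases "integrable lebesgue f")
    case True
    then show ?thesis
      using * assms by (intro integral_cong_AE) auto
  next
    case False
    then show ?thesis
      using * by (simp add: not_integrable_integral_eq)
  qed
qed

lift_definition shift_aefun :: "real \<Rightarrow> 'a aefun \<Rightarrow> 'a aefun" is "\<lambda>h f x. f (x + h)"
  by (rule AE_lebesgue_shift)

lift_definition restrict_aefun :: "real \<Rightarrow> real \<Rightarrow> 'a::zero aefun \<Rightarrow> 'a aefun"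
  is "\<lambda>a b f x. if a < x \<and> x < b then f x else 0"
  by (erule eventually_mono) simp


section \<open>Sobolev spaces on an interval\<close>

lift_definition in_L2 :: "real \<Rightarrow> real \<Rightarrow> 'a::euclidean_space aefun \<Rightarrow> bool"
  is "\<lambda>a b f. (AE x in lebesgue. x \<notin> {a<..<b} \<longrightarrow> f x = 0) \<and>
        f \<in> borel_measurable lebesgue \<and> integrable lebesgue (\<lambda>x. (norm (f x))\<^sup>2)"
proof -
  have imp: "(AE x in lebesgue. x \<notin> {a<..<b} \<longrightarrow> g x = 0) \<and>
        g \<in> borel_measurable lebesgue \<and> integrable lebesgue (\<lambda>x. (norm (g x))\<^sup>2)"
    if eq: "AE x in lebesgue. f x = g x"
      and f: "(AE x in lebesgue. x \<notin> {a<..<b} \<longrightarrow> f x = 0) \<and>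
        f \<in> borel_measurable lebesgue \<and> integrable lebesgue (\<lambda>x. (norm (f x))\<^sup>2)"
    for a b :: real and f g :: "real \<Rightarrow> 'a"
  proof (intro conjI)
    show "AE x in lebesgue. x \<notin> {a<..<b} \<longrightarrow> g x = 0"
      using eq conjunct1[OF f] by eventually_elim auto
    show "g \<in> borel_measurable lebesgue"
      by (rule borel_measurable_AE[OF _ eq]) (use f in simp)
    have "AE x in lebesgue. (norm (f x))\<^sup>2 = (norm (g x))\<^sup>2"
      using eq by eventually_elim auto
    then show "integrable lebesgue (\<lambda>x. (norm (g x))\<^sup>2)"
      using f integral_lebesgue_cong_AE(1)[of "\<lambda>x. (norm (f x))\<^sup>2" "\<lambda>x. (norm (g x))\<^sup>2"]
      by simp
  qed
  fix a b :: real and f g :: "real \<Rightarrow> 'a"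
  assume eq: "AE x in lebesgue. f x = g x"
  then have eq': "AE x in lebesgue. g x = f x"
    by eventually_elim simp
  show "((AE x in lebesgue. x \<notin> {a<..<b} \<longrightarrow> f x = 0) \<and>
        f \<in> borel_measurable lebesgue \<and> integrable lebesgue (\<lambda>x. (norm (f x))\<^sup>2)) =
      ((AE x in lebesgue. x \<notin> {a<..<b} \<longrightarrow> g x = 0) \<and>
        g \<in> borel_measurable lebesgue \<and> integrable lebesgue (\<lambda>x. (norm (g x))\<^sup>2))"
    by (rule iffI; rule imp[OF eq] imp[OF eq']; assumption)
qed

lift_definition norm_L2 :: "'a::euclidean_space aefun \<Rightarrow> real"
  is "\<lambda>f. sqrt (integral\<^sup>L lebesgue (\<lambda>x. (norm (f x))\<^sup>2))"
proof -
  fix f g :: "real \<Rightarrow> 'a"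
  assume "AE x in lebesgue. f x = g x"
  then have "AE x in lebesgue. (norm (f x))\<^sup>2 = (norm (g x))\<^sup>2"
    by eventually_elim auto
  then show "sqrt (integral\<^sup>L lebesgue (\<lambda>x. (norm (f x))\<^sup>2)) =
      sqrt (integral\<^sup>L lebesgue (\<lambda>x. (norm (g x))\<^sup>2))"
    using integral_lebesgue_cong_AE(2) by (intro arg_cong[of _ _ sqrt])
qed

definition test_function :: "real \<Rightarrow> real \<Rightarrow> (real \<Rightarrow> real) \<Rightarrow> bool" where
  "test_function a b \<phi> \<longleftrightarrow>
     (\<forall>n x. ((deriv ^^ n) \<phi>) differentiable (at x)) \<and> closure {x. \<phi> x \<noteq> 0} \<subseteq> {a<..<b}"

text \<open>Test functions vanish outside \<open>(a, b)\<close>, so the integrals below are integrals over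
  \<open>(a, b)\<close>.\<close>

lift_definition weak_deriv ::
    "real \<Rightarrow> real \<Rightarrow> nat \<Rightarrow> 'a::euclidean_space aefun \<Rightarrow> 'a aefun \<Rightarrow> bool"
  is "\<lambda>a b m f g. \<forall>\<phi>. test_function a b \<phi> \<longrightarrow>
        (LINT x|lebesgue. (deriv ^^ m) \<phi> x *\<^sub>R f x) = (-1) ^ m *\<^sub>R (LINT x|lebesgue. \<phi> x *\<^sub>R g x)"
proof -
  have *: "(LINT x|lebesgue. \<phi> x *\<^sub>R f x) = (LINT x|lebesgue. \<phi> x *\<^sub>R g x)"
    if "AE x in lebesgue. f x = g x" for \<phi> :: "real \<Rightarrow> real" and f g :: "real \<Rightarrow> 'a"
    by (rule integral_lebesgue_cong_AE(2), rule eventually_mono[OF that]) simp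
  fix a b :: real and m :: nat and f f' g g' :: "real \<Rightarrow> 'a"
  assume f: "AE x in lebesgue. f x = f' x" and g: "AE x in lebesgue. g x = g' x"
  show "(\<forall>\<phi>. test_function a b \<phi> \<longrightarrow> (LINT x|lebesgue. (deriv ^^ m) \<phi> x *\<^sub>R f x) =
          (-1) ^ m *\<^sub>R (LINT x|lebesgue. \<phi> x *\<^sub>R g x)) =
      (\<forall>\<phi>. test_function a b \<phi> \<longrightarrow> (LINT x|lebesgue. (deriv ^^ m) \<phi> x *\<^sub>R f' x) =
          (-1) ^ m *\<^sub>R (LINT x|lebesgue. \<phi> x *\<^sub>R g' x))"
    unfolding *[OF f] *[OF g] ..
qed

definition wderiv :: "real \<Rightarrow> real \<Rightarrow> nat \<Rightarrow> 'a::euclidean_space aefun \<Rightarrow> 'a aefun" where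
  "wderiv a b m f = (THE g. in_L2 a b g \<and> weak_deriv a b m f g)"

text \<open>The record carries no axioms: that the Sobolev spaces and their products are Banach spaces
  is a property of the data below, not a requirement.\<close>

record ('s, 'v) normed_space =
  carr :: "'v set"
  scal :: "'s \<Rightarrow> 'v \<Rightarrow> 'v"
  nrm :: "'v \<Rightarrow> real"

definition sobolev ::
    "nat \<Rightarrow> real \<Rightarrow> real \<Rightarrow> ('a::{real_normed_field,euclidean_space}, 'a aefun) normed_space" where
  "sobolev k a b =
     \<lparr>carr = {f. in_L2 a b f \<and> (\<forall>m\<le>k. \<exists>g. in_L2 a b g \<and> weak_deriv a b m f g)},
      scal = scale_aefun,
      nrm = (\<lambda>f. sqrt (\<Sum>m\<le>k. (norm_L2 (wderiv a b m f))\<^sup>2))\<rparr>"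

definition prod_space ::
    "('s, 'v) normed_space \<Rightarrow> ('s, 'w) normed_space \<Rightarrow> ('s, 'v \<times> 'w) normed_space" where
  "prod_space X Y =
     \<lparr>carr = carr X \<times> carr Y,
      scal = (\<lambda>c (x, y). (scal X c x, scal Y c y)),
      nrm = (\<lambda>(x, y). sqrt ((nrm X x)\<^sup>2 + (nrm Y y)\<^sup>2))\<rparr>"


section \<open>Bounded and Fredholm operators\<close>

text \<open>An operator between two such spaces is a function on the ambient types; only its values on
  the carrier of the domain matter.\<close>

definition bounded_operator ::
    "('s, 'v::ab_group_add) normed_space \<Rightarrow> ('s, 'w::ab_group_add) normed_space \<Rightarrow>
      ('v \<Rightarrow> 'w) \<Rightarrow> bool" where
  "bounded_operator X Y T \<longleftrightarrow>
     (\<forall>x\<in>carr X. T x \<in> carr Y) \<and>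
     (\<forall>x\<in>carr X. \<forall>y\<in>carr X. T (x + y) = T x + T y) \<and>
     (\<forall>c. \<forall>x\<in>carr X. T (scal X c x) = scal Y c (T x)) \<and>
     (\<exists>C. \<forall>x\<in>carr X. nrm Y (T x) \<le> C * nrm X x)"

definition kernel ::
    "('s, 'v) normed_space \<Rightarrow> ('v \<Rightarrow> 'w::zero) \<Rightarrow> 'v set" where
  "kernel X T = {x \<in> carr X. T x = 0}"

definition closed_in_space :: "('s, 'v::ab_group_add) normed_space \<Rightarrow> 'v set \<Rightarrow> bool" where
  "closed_in_space Y R \<longleftrightarrow>
     closedin (Metric_space.mtopology (carr Y) (\<lambda>u v. nrm Y (u - v))) R"

definition finite_dim :: "('s::field, 'v::ab_group_add) normed_space \<Rightarrow> 'v set \<Rightarrow> bool" where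
  "finite_dim X V \<longleftrightarrow> (\<exists>B. finite B \<and> B \<subseteq> V \<and> V \<subseteq> module.span (scal X) B)"

text \<open>The cosets of the elements of \<open>B\<close> span the quotient of \<open>Y\<close> by a subspace \<open>R\<close> iff
  \<open>R \<union> B\<close> spans \<open>Y\<close>; the dimension of the quotient is the least size of such a \<open>B\<close>.\<close>

definition spans_modulo ::
    "('s::field, 'v::ab_group_add) normed_space \<Rightarrow> 'v set \<Rightarrow> 'v set \<Rightarrow> bool" where
  "spans_modulo Y R B \<longleftrightarrow> finite B \<and> B \<subseteq> carr Y \<and> carr Y \<subseteq> module.span (scal Y) (R \<union> B)"

definition finite_codim :: "('s::field, 'v::ab_group_add) normed_space \<Rightarrow> 'v set \<Rightarrow> bool" where
  "finite_codim Y R \<longleftrightarrow> (\<exists>B. spans_modulo Y R B)"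

definition codim :: "('s::field, 'v::ab_group_add) normed_space \<Rightarrow> 'v set \<Rightarrow> nat" where
  "codim Y R = (LEAST n. \<exists>B. spans_modulo Y R B \<and> card B = n)"

definition fredholm ::
    "('s::field, 'v::ab_group_add) normed_space \<Rightarrow> ('s, 'w::ab_group_add) normed_space \<Rightarrow>
      ('v \<Rightarrow> 'w) \<Rightarrow> bool" where
  "fredholm X Y T \<longleftrightarrow>
     bounded_operator X Y T \<and>
     finite_dim X (kernel X T) \<and>
     closed_in_space Y (T ` carr X) \<and>
     finite_codim Y (T ` carr X)"

definition fredholm_index ::
    "('s::field, 'v::ab_group_add) normed_space \<Rightarrow> ('s, 'w::ab_group_add) normed_space \<Rightarrow>
      ('v \<Rightarrow> 'w) \<Rightarrow> int" where
  "fredholm_index X Y T =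
     int (vector_space.dim (scal X) (kernel X T)) - int (codim Y (T ` carr X))"


section \<open>The differential-difference operator\<close>

text \<open>The matrices are indexed from 0, which leaves the differences of indices unchanged.\<close>

definition R1 :: "nat \<Rightarrow> (int \<Rightarrow> real) \<Rightarrow> real mat" where
  "R1 N b = Matrix.mat (N + 1) (N + 1) (\<lambda>(i, k). b (int k - int i))"

definition R2 :: "nat \<Rightarrow> (int \<Rightarrow> real) \<Rightarrow> real mat" where
  "R2 N b = mat_delete (R1 N b) N N"

definition P_QR ::
    "nat \<Rightarrow> (int \<Rightarrow> real) \<Rightarrow> 'a::{real_normed_field,euclidean_space} aefun \<Rightarrow> 'a aefun" where
  "P_QR N b y = restrict_aefun 0 (real N + 1)
     (\<Sum>j = - int N..int N. scale_aefun (of_real (b j)) (shift_aefun (of_int j) y))"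

definition L_B ::
    "nat \<Rightarrow> (int \<Rightarrow> real) \<Rightarrow> ('a aefun \<Rightarrow> 'a aefun) \<Rightarrow>
      'a::{real_normed_field,euclidean_space} aefun \<Rightarrow> 'a aefun \<times> 'a aefun \<times> 'a aefun" where
  "L_B N b A y =
     (- wderiv 0 (real N + 1) 2 (P_QR N b y) + A y,
      restrict_aefun (- real N) 0 y,
      restrict_aefun (real N + 1) (2 * real N + 1) y)"

definition W_target ::
    "nat \<Rightarrow> nat \<Rightarrow>
      ('a::{real_normed_field,euclidean_space}, 'a aefun \<times> 'a aefun \<times> 'a aefun) normed_space" where
  "W_target N k =
     prod_space (sobolev k 0 (real N + 1))
       (prod_space (sobolev (k + 2) (- real N) 0)
         (sobolev (k + 2) (real N + 1) (2 * real N + 1)))"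

end

theory Submission
  imports Defs
begin

text \<open>Differentiation \<open>m = k + 2\<close> times identifies \<open>W\<^sup>m\<close> with \<open>L\<^sub>2\<close> up to \<open>m\<close> coordinates, and the
  target space with \<open>L\<^sub>2(0, N+1) \<times> L\<^sub>2(-N, 0) \<times> L\<^sub>2(N+1, 2N+1)\<close> up to \<open>k + 2m\<close> coordinates. In the
  top derivative \<open>g\<close>, the leading part of the operator is \<open>g \<mapsto> (- P\<^sub>Q R g, g, g)\<close>, restricted to the
  three intervals; it is an isomorphism as soon as \<open>R\<^sub>1\<close> is invertible, because \<open>P\<^sub>Q R\<close> acts
  as the matrix \<open>R\<^sub>1\<close> on the vector of the pieces of a function over the unit intervals. Hence the index is
  \<open>m - (k + 2m) = - 2(k + 1)\<close>, up to the perturbation by \<open>A\<^sub>1\<close>. The latter loses one derivative: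
  composed with the right inverse of differentiation it becomes small on the functions whose means over
  a fine partition vanish, a subspace of finite codimension, and the Neumann series applies there.\<close>

section \<open>Linear algebra of the index\<close>

text \<open>Finite-dimensional kernel, closed range and codimension all come from one algebraic
  fact: if \<open>T\<close> maps the common kernel of finitely many bounded functionals bijectively
  onto another such kernel, then its kernel and cokernel are those of a matrix, and its range is cut
  out by finitely many bounded functionals, hence closed. The lower-order term may destroy this
  bijectivity; enlarging both systems by equally many coordinates restores it without changing the
  difference of their sizes. Means over the cells of a partition serve because a function with
  vanishing cell means has a primitive that vanishes at all nodes, hence is small everywhere.
  Splitting the primitive of order k + 2 into one of order k + 1 and one of order 1 leaves exactly
  one factor to be made small, as \<open>A1\<close> is bounded on W^(k+1). The leading part is
  inverted in triangular form: the two outer pieces of g are read off, and the inner piece solves an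
  equation on (0, N+1) whose right-hand side contains the outer ones.\<close>

text \<open>Biorthogonal systems play the role of the quotients \<open>X / Z\<close> and \<open>Y / T Z\<close>, where
  \<open>Z\<close> is the common kernel of the \<open>p i\<close>: on the coordinates, \<open>T\<close> acts as the matrix
  \<open>q j (T (e i))\<close>, and the index is read off from rank and nullity of that matrix.\<close>

context vector_space_pair
begin

text \<open>\<open>p i\<close> applied to a linear combination of the \<open>e j\<close> returns the
  coefficient of \<open>e i\<close>. Everything follows from this, including that the coordinates
  reproduce each element of the span.\<close>

lemma biorthogonal_independent:
  assumes "finite I" and lin: "\<And>i. i \<in> I \<Longrightarrow> Vector_Spaces.linear s1 (*) (p i)"
    and pe: "\<And>i j. i \<in> I \<Longrightarrow> j \<in> I \<Longrightarrow> p i (e j) = (if i = j then 1 else 0)"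
  shows "inj_on e I" "vs1.independent (e ` I)"
    "x \<in> vs1.span (e ` I) \<Longrightarrow> (\<Sum>i\<in>I. s1 (p i x) (e i)) = x"
proof -
  show inj: "inj_on e I"
  proof (rule inj_onI)
    fix i j assume "i \<in> I" "j \<in> I" "e i = e j"
    then show "i = j" using pe[of i i] pe[of i j] by (auto split: if_splits)
  qed
  show "vs1.independent (e ` I)"
  proof (rule vs1.independent_if_scalars_zero)
    show "finite (e ` I)" using assms(1) by simp
    fix u v assume s: "(\<Sum>v\<in>e ` I. s1 (u v) v) = 0" and v: "v \<in> e ` I"
    from v obtain i where i: "i \<in> I" "v = e i" by auto
    interpret pi: Vector_Spaces.linear s1 "(*)" "p i" using lin[OF i(1)] .
    have "0 = p i (\<Sum>j\<in>I. s1 (u (e j)) (e j))"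
      using s pi.zero by (simp add: sum.reindex[OF inj])
    also have "\<dots> = (\<Sum>j\<in>I. if i = j then u (e j) else 0)"
      by (auto simp: pi.sum pi.scale pe i intro!: sum.cong)
    also have "\<dots> = u v" using i assms(1) by simp
    finally show "u v = 0" by simp
  qed
  assume "x \<in> vs1.span (e ` I)"
  then show "(\<Sum>i\<in>I. s1 (p i x) (e i)) = x"
  proof (induction rule: vs1.span_induct_alt)
    case base
    have "p i 0 = 0" if "i \<in> I" for i
    proof -
      interpret pi: Vector_Spaces.linear s1 "(*)" "p i" using lin[OF that] .
      show ?thesis by (rule pi.zero)
    qed
    then show ?case by simp
  next
    case (step c x y)
    then obtain k where k: "k \<in> I" "x = e k" by auto
    have "p i (s1 c x + y) = c * (if i = k then 1 else 0) + p i y" if "i \<in> I" for i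
    proof -
      interpret pi: Vector_Spaces.linear s1 "(*)" "p i" using lin[OF that] .
      show ?thesis using that k by (simp add: pi.add pi.scale pe)
    qed
    then have "(\<Sum>i\<in>I. s1 (p i (s1 c x + y)) (e i))
        = (\<Sum>i\<in>I. (if i = k then s1 c (e i) else 0) + s1 (p i y) (e i))"
      by (intro sum.cong) (auto simp: vs1.scale_left_distrib)
    also have "\<dots> = s1 c (e k) + y"
      using assms(1) k step.IH by (simp add: sum.distrib)
    finally show ?case by (simp add: k)
  qed
qed

end

text \<open>Rank and nullity below need a projection along a complementary basis that is linear on
  the whole type; \<open>construct\<close> supplies the extension beyond \<open>span B\<close>,
  where only linearity is claimed.\<close>

lemma (in vector_space) basis_extension_projection:
  assumes B: "independent B" and C: "C \<subseteq> B"
  obtains \<pi> where "Vector_Spaces.linear scale scale \<pi>" "\<And>x. x \<in> span C \<Longrightarrow> \<pi> x = x"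
    "\<And>x. x \<in> span (B - C) \<Longrightarrow> \<pi> x = 0" "\<And>x. x \<in> span B \<Longrightarrow> \<pi> x \<in> span C"
    "\<And>x. x \<in> span B \<Longrightarrow> \<pi> x = 0 \<Longrightarrow> x \<in> span (B - C)"
proof -
  interpret vector_space_pair scale scale by unfold_locales
  define \<pi> where "\<pi> = construct B (\<lambda>b. if b \<in> C then b else 0)"
  have lin: "Vector_Spaces.linear scale scale \<pi>" unfolding \<pi>_def by (rule linear_construct[OF B])
  then interpret p: Vector_Spaces.linear scale scale \<pi> .
  have b: "\<pi> x = (if x \<in> C then x else 0)" if "x \<in> B" for x
    using that unfolding \<pi>_def by (simp add: construct_basis[OF B])
  have 1: "\<pi> x = x" if "x \<in> span C" for x
    using that
  proof (induction rule: span_induct_alt)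
    case base then show ?case by (rule p.zero)
  next
    case (step c x y) then show ?case using C b by (auto simp: p.add p.scale)
  qed
  have 2: "\<pi> x = 0" if "x \<in> span (B - C)" for x
    using that
  proof (induction rule: span_induct_alt)
    case base then show ?case by (rule p.zero)
  next
    case (step c x y) then show ?case using C b by (auto simp: p.add p.scale)
  qed
  have 3: "\<exists>y z. x = y + z \<and> y \<in> span C \<and> z \<in> span (B - C)" if "x \<in> span B" for x
  proof -
    have "x \<in> span (C \<union> (B - C))" using that C by (simp add: Un_absorb1)
    then show ?thesis unfolding span_Un by auto
  qed
  have 4: "\<pi> x \<in> span C \<and> (\<pi> x = 0 \<longrightarrow> x \<in> span (B - C))" if x: "x \<in> span B" for x
  proof -
    obtain y z where xyz: "x = y + z" and y: "y \<in> span C" and z: "z \<in> span (B - C)"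
      using 3[OF x] by blast
    have "\<pi> x = y" using 1[OF y] 2[OF z] by (simp add: xyz p.add)
    then show ?thesis using xyz y z by auto
  qed
  show thesis by (rule that[OF lin 1 2]) (use 4 in auto)
qed

context vector_space_pair
begin

text \<open>With Z the common kernel of the \<open>p i\<close> in \<open>X\<close>, the last three
  hypotheses say that \<open>T\<close> is a bijection from Z onto the common kernel of the
  \<open>q j\<close> in \<open>Y\<close>. Hence kernel and cokernel of \<open>T\<close> agree with
  those of the induced map between the spans of the \<open>e i\<close> and the \<open>f j\<close>,
  and rank-nullity for it is the equation between the cardinalities. The last claim describes the
  range through the \<open>q j\<close> alone, which is what closedness needs.\<close>

lemma index_of_biorthogonal_systems:
  assumes fin: "finite I" "finite J"
    and X: "vs1.subspace X" and Y: "vs2.subspace Y"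
    and T: "Vector_Spaces.linear s1 s2 T" and TX: "T ` X \<subseteq> Y"
    and p: "\<And>i. i \<in> I \<Longrightarrow> Vector_Spaces.linear s1 (*) (p i)" and e: "\<And>i. i \<in> I \<Longrightarrow> e i \<in> X"
    and pe: "\<And>i j. i \<in> I \<Longrightarrow> j \<in> I \<Longrightarrow> p i (e j) = (if i = j then 1 else 0)"
    and q: "\<And>i. i \<in> J \<Longrightarrow> Vector_Spaces.linear s2 (*) (q i)" and f: "\<And>i. i \<in> J \<Longrightarrow> f i \<in> Y"
    and qf: "\<And>i j. i \<in> J \<Longrightarrow> j \<in> J \<Longrightarrow> q i (f j) = (if i = j then 1 else 0)"
    and TZ: "\<And>x j. x \<in> X \<Longrightarrow> (\<And>i. i \<in> I \<Longrightarrow> p i x = 0) \<Longrightarrow> j \<in> J \<Longrightarrow> q j (T x) = 0"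
    and inj: "\<And>x. x \<in> X \<Longrightarrow> (\<And>i. i \<in> I \<Longrightarrow> p i x = 0) \<Longrightarrow> T x = 0 \<Longrightarrow> x = 0"
    and surj: "\<And>y. y \<in> Y \<Longrightarrow> (\<And>j. j \<in> J \<Longrightarrow> q j y = 0) \<Longrightarrow>
      \<exists>x\<in>X. (\<forall>i\<in>I. p i x = 0) \<and> T x = y"
  obtains K D c where
    "finite K" "K \<subseteq> {x \<in> X. T x = 0}" "vs1.independent K" "{x \<in> X. T x = 0} \<subseteq> vs1.span K"
    "finite D" "D \<subseteq> Y" "Y \<subseteq> vs2.span (T ` X \<union> D)"
    "\<And>B. finite B \<Longrightarrow> Y \<subseteq> vs2.span (T ` X \<union> B) \<Longrightarrow> card D \<le> card B"
    "card K + card J = card D + card I"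
    "T ` X = {y \<in> Y. \<forall>d\<in>D. (\<Sum>j\<in>J. c d j * q j y) = 0}"
proof -
  interpret T: Vector_Spaces.linear s1 s2 T by (rule T)
  interpret p21: vector_space_pair s2 s1 by unfold_locales
  note bi1 = biorthogonal_independent[OF fin(1) p pe]
  note bi2 = p21.biorthogonal_independent[OF fin(2) q qf]
  \<comment> \<open>\<open>P\<close> and \<open>R\<close> project onto the spans of the two systems;
    \<open>x - P x\<close> and \<open>y - R y\<close> have vanishing coordinates.\<close>
  define P where "P x = (\<Sum>i\<in>I. s1 (p i x) (e i))" for x
  define R where "R y = (\<Sum>j\<in>J. s2 (q j y) (f j))" for y
  have padd: "p i (x + y) = p i x + p i y" "p i (s1 a x) = a * p i x" "p i 0 = 0"
    "p i (x - y) = p i x - p i y" if "i \<in> I" for i x y a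
  proof -
    interpret pi: Vector_Spaces.linear s1 "(*)" "p i" using p[OF that] .
    show "p i (x + y) = p i x + p i y" "p i (s1 a x) = a * p i x" "p i 0 = 0"
      "p i (x - y) = p i x - p i y"
      by (simp_all add: pi.add pi.scale pi.zero pi.diff)
  qed
  have qadd: "q i (x + y) = q i x + q i y" "q i (s2 a x) = a * q i x" "q i 0 = 0"
    "q i (x - y) = q i x - q i y" if "i \<in> J" for i x y a
  proof -
    interpret pi: Vector_Spaces.linear s2 "(*)" "q i" using q[OF that] .
    show "q i (x + y) = q i x + q i y" "q i (s2 a x) = a * q i x" "q i 0 = 0"
      "q i (x - y) = q i x - q i y"
      by (simp_all add: pi.add pi.scale pi.zero pi.diff)
  qed
  have P: "Vector_Spaces.linear s1 s1 P"
    unfolding P_def Vector_Spaces.linear_iff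
    by (auto simp: padd vs1.scale_left_distrib sum.distrib vs1.scale_sum_right
        intro!: sum.cong vs1.vector_space_axioms)
  have R: "Vector_Spaces.linear s2 s2 R"
    unfolding R_def Vector_Spaces.linear_iff
    by (auto simp: qadd vs2.scale_left_distrib sum.distrib vs2.scale_sum_right
        intro!: sum.cong vs2.vector_space_axioms)
  interpret P: Vector_Spaces.linear s1 s1 P by (rule P)
  interpret R: Vector_Spaces.linear s2 s2 R by (rule R)
  define E1 where "E1 = vs1.span (e ` I)"
  define E2 where "E2 = vs2.span (f ` J)"
  have E1X: "E1 \<subseteq> X" unfolding E1_def by (rule vs1.span_minimal) (use e X in auto)
  have E2Y: "E2 \<subseteq> Y" unfolding E2_def by (rule vs2.span_minimal) (use f Y in auto)
  have PE: "P x \<in> E1" for x unfolding P_def E1_def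
    by (intro vs1.span_sum vs1.span_scale vs1.span_base) auto
  have RE: "R x \<in> E2" for x unfolding R_def E2_def
    by (intro vs2.span_sum vs2.span_scale vs2.span_base) auto
  have PP: "P x = x" if "x \<in> E1" for x
    using bi1(3)[of x] that unfolding P_def E1_def by simp
  have RR: "R x = x" if "x \<in> E2" for x
    using bi2(3)[of x] that unfolding R_def E2_def by simp
  have pP: "p i (P x) = p i x" if "i \<in> I" for i x
  proof -
    interpret pi: Vector_Spaces.linear s1 "(*)" "p i" using p[OF that] .
    have "p i (P x) = (\<Sum>j\<in>I. if i = j then p j x else 0)"
      unfolding P_def by (auto simp: pi.sum pi.scale pe that intro!: sum.cong)
    then show ?thesis using fin(1) that by simp
  qed
  have qR: "q i (R x) = q i x" if "i \<in> J" for i x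
  proof -
    interpret pi: Vector_Spaces.linear s2 "(*)" "q i" using q[OF that] .
    have "q i (R x) = (\<Sum>j\<in>J. if i = j then q j x else 0)"
      unfolding R_def by (auto simp: pi.sum pi.scale qf that intro!: sum.cong)
    then show ?thesis using fin(2) that by simp
  qed
  \<comment> \<open>On \<open>E1\<close> this is the matrix \<open>q j (T (e i))\<close>. Its kernel
    is spanned by \<open>BK\<close>, it is injective on the complement spanned by \<open>C\<close>,
    and \<open>D\<close> will complete the image of \<open>C\<close> to a basis of
    \<open>E2\<close>.\<close>
  define \<tau> where "\<tau> = R \<circ> T"
  have \<tau>: "Vector_Spaces.linear s1 s2 \<tau>" unfolding \<tau>_def by (rule Vector_Spaces.linear_compose[OF T R])
  interpret \<tau>: Vector_Spaces.linear s1 s2 \<tau> by (rule \<tau>)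
  define K1 where "K1 = {x \<in> E1. \<tau> x = 0}"
  have subK1: "vs1.subspace K1"
    unfolding K1_def vs1.subspace_def
    using vs1.subspace_span[of "e ` I"] unfolding E1_def[symmetric]
    by (auto simp: \<tau>.add \<tau>.scale \<tau>.zero vs1.subspace_def)
  obtain BK where BK: "BK \<subseteq> K1" "vs1.independent BK" "K1 \<subseteq> vs1.span BK"
    using vs1.maximal_independent_subset[of K1] by blast
  have "BK \<subseteq> E1" using BK unfolding K1_def by auto
  then obtain B where B: "BK \<subseteq> B" "B \<subseteq> E1" "vs1.independent B" "E1 \<subseteq> vs1.span B"
    using vs1.maximal_independent_subset_extend[OF _ BK(2)] by metis
  define C where "C = B - BK"
  have finB: "finite B"
    using vs1.independent_span_bound[of "e ` I" B] fin(1) B unfolding E1_def by auto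
  have cardB: "card B = card I"
  proof -
    have "card B = vs1.dim E1" using vs1.basis_card_eq_dim[OF B(2,4,3)] .
    also have "\<dots> = card (e ` I)"
      unfolding E1_def using vs1.dim_span_eq_card_independent[OF bi1(2)] by simp
    also have "\<dots> = card I" using card_image[OF bi1(1)] by simp
    finally show ?thesis .
  qed
  have BC: "B - C = BK" "C \<subseteq> B" unfolding C_def using B(1) by auto
  obtain \<pi>1 where pi1: "\<And>x. x \<in> vs1.span C \<Longrightarrow> \<pi>1 x = x" "\<And>x. x \<in> vs1.span (B - C) \<Longrightarrow> \<pi>1 x = 0"
    by (rule vs1.basis_extension_projection[OF B(3) BC(2)]) (rule that)
  have spanC: "vs1.span C \<subseteq> E1"
    using B(2) C_def vs1.span_minimal[of C E1] vs1.subspace_span[of "e ` I"] unfolding E1_def by auto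
  have inj\<tau>: "inj_on \<tau> (vs1.span C)"
  proof (rule \<tau>.inj_on_iff_eq_0[THEN iffD2, OF vs1.subspace_span], intro ballI impI)
    fix x assume x: "x \<in> vs1.span C" "\<tau> x = 0"
    then have "x \<in> K1" using spanC unfolding K1_def by auto
    then have "x \<in> vs1.span (B - C)" using BK(3) BC by auto
    then show "x = 0" using pi1(1)[OF x(1)] pi1(2) by simp
  qed
  have indC: "vs1.independent C"
    using B(3) C_def by (meson Diff_subset vs1.independent_mono)
  have ind\<tau>: "vs2.independent (\<tau> ` C)"
    by (rule \<tau>.independent_injective_image[OF indC inj\<tau>])
  have "\<tau> ` C \<subseteq> E2" unfolding \<tau>_def using RE by auto
  then obtain B2 where B2: "\<tau> ` C \<subseteq> B2" "B2 \<subseteq> E2" "vs2.independent B2" "E2 \<subseteq> vs2.span B2"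
    using vs2.maximal_independent_subset_extend[OF _ ind\<tau>] by metis
  have finB2: "finite B2"
    using vs2.independent_span_bound[of "f ` J" B2] fin(2) B2 unfolding E2_def by auto
  have cardB2: "card B2 = card J"
  proof -
    have "card B2 = vs2.dim E2" using vs2.basis_card_eq_dim[OF B2(2,4,3)] .
    also have "\<dots> = card (f ` J)"
      unfolding E2_def using vs2.dim_span_eq_card_independent[OF bi2(2)] by simp
    also have "\<dots> = card J" using card_image[OF bi2(1)] by simp
    finally show ?thesis .
  qed
  define D where "D = B2 - \<tau> ` C"
  have DB: "D \<subseteq> B2" "B2 - D = \<tau> ` C" unfolding D_def using B2(1) by auto
  obtain \<pi>2 where pi2: "Vector_Spaces.linear s2 s2 \<pi>2" "\<And>x. x \<in> vs2.span D \<Longrightarrow> \<pi>2 x = x"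
    "\<And>x. x \<in> vs2.span (B2 - D) \<Longrightarrow> \<pi>2 x = 0" "\<And>x. x \<in> vs2.span B2 \<Longrightarrow> \<pi>2 x \<in> vs2.span D"
    "\<And>x. x \<in> vs2.span B2 \<Longrightarrow> \<pi>2 x = 0 \<Longrightarrow> x \<in> vs2.span (B2 - D)"
    by (rule vs2.basis_extension_projection[OF B2(3) DB(1)]) (rule that)
  interpret pi2: Vector_Spaces.linear s2 s2 \<pi>2 by (rule pi2)
  \<comment> \<open>On \<open>Y\<close>, the kernel of \<open>\<delta>\<close> is exactly the range
    of \<open>T\<close>, so \<open>span D\<close> is a complement of the range.\<close>
  define \<delta> where "\<delta> = \<pi>2 \<circ> R"
  have \<delta>: "Vector_Spaces.linear s2 s2 \<delta>" unfolding \<delta>_def by (rule Vector_Spaces.linear_compose[OF R pi2(1)])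
  interpret \<delta>: Vector_Spaces.linear s2 s2 \<delta> by (rule \<delta>)
  have subTX: "vs2.subspace (T ` X)" using T.subspace_image[OF X] .
  have W: "y \<in> T ` X" if "y \<in> Y" "R y = 0" for y
  proof -
    have "q j y = 0" if "j \<in> J" for j using qR[OF that, of y] \<open>R y = 0\<close> qadd(3)[OF that] by simp
    then show ?thesis using surj[OF that(1)] by blast
  qed
  \<comment> \<open>\<open>x - P x\<close> has vanishing coordinates, so \<open>TZ\<close> lets
    \<open>R (T x)\<close> depend on \<open>P x\<close> only.\<close>
  have RT: "R (T x) = \<tau> (P x)" if "x \<in> X" for x
  proof -
    have "P x \<in> X" using PE E1X by auto
    then have "x - P x \<in> X" using X that by (simp add: vs1.subspace_diff)
    then have "q j (T (x - P x)) = 0" if "j \<in> J" for j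
      by (rule TZ) (use that in \<open>auto simp: padd pP\<close>)
    then have "R (T (x - P x)) = 0" unfolding R_def by simp
    then show ?thesis unfolding \<tau>_def by (simp add: T.diff R.diff)
  qed
  \<comment> \<open>\<open>R (T c)\<close> and \<open>T c\<close> differ by an element of
    \<open>Y\<close> with all \<open>q j\<close> zero, which lies in the range by
    \<open>surj\<close>.\<close>
  have \<tau>C: "\<tau> ` C \<subseteq> T ` X"
  proof
    fix y assume "y \<in> \<tau> ` C"
    then obtain c where c: "c \<in> C" "y = R (T c)" unfolding \<tau>_def by auto
    have cX: "c \<in> X" using c(1) B(2) E1X C_def by auto
    have y: "y \<in> Y" using c RE E2Y by auto
    have "T c \<in> Y" using cX TX by auto
    then have "y - T c \<in> Y" using y Y by (simp add: vs2.subspace_diff)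
    moreover have "R (y - T c) = 0" using RR[OF RE[of "T c"]] c by (simp add: R.diff)
    ultimately have "y - T c \<in> T ` X" by (rule W)
    then have "(y - T c) + T c \<in> T ` X" using subTX cX by (intro vs2.subspace_add) auto
    then show "y \<in> T ` X" by simp
  qed
  have \<tau>E: "\<tau> x \<in> vs2.span (\<tau> ` C)" if "x \<in> E1" for x
  proof -
    have "x \<in> vs1.span (C \<union> BK)" using that B BC by (auto simp: C_def Un_absorb2)
    then obtain y z where "x = y + z" "y \<in> vs1.span C" "z \<in> vs1.span BK"
      unfolding vs1.span_Un by auto
    moreover have "\<tau> z = 0"
      using vs1.span_minimal[OF BK(1) subK1] \<open>z \<in> _\<close> unfolding K1_def by auto
    ultimately show ?thesis by (auto simp: \<tau>.add \<tau>.span_image)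
  qed
  have \<delta>TX: "\<delta> y = 0" if "y \<in> T ` X" for y
    using that pi2(3) \<tau>E[OF PE] DB(2) unfolding \<delta>_def by (auto simp: RT)
  have TX\<delta>: "y \<in> T ` X" if "y \<in> Y" "\<delta> y = 0" for y
  proof -
    have "R y \<in> vs2.span B2" using RE B2(4) by auto
    then have "R y \<in> vs2.span (\<tau> ` C)" using pi2(5)[of "R y"] that(2) DB(2) unfolding \<delta>_def by auto
    then have 1: "R y \<in> T ` X" using vs2.span_minimal[OF \<tau>C subTX] by auto
    have "y - R y \<in> T ` X"
      using W[of "y - R y"] RE[of y] E2Y that(1) Y RR[OF RE] by (auto simp: R.diff vs2.subspace_diff)
    then have "(y - R y) + R y \<in> T ` X" using vs2.subspace_add[OF subTX _ 1] by blast
    then show ?thesis by simp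
  qed
  have indD: "vs2.independent D" using B2(3) DB(1) vs2.independent_mono by blast
  have \<delta>D: "\<delta> x = x" if "x \<in> vs2.span D" for x
  proof -
    have "x \<in> E2" using that DB B2(2) vs2.span_minimal[of D E2] vs2.subspace_span[of "f ` J"]
      unfolding E2_def by blast
    then show ?thesis unfolding \<delta>_def using RR pi2(2)[OF that] by simp
  qed
  obtain K where K: "K \<subseteq> {x \<in> X. T x = 0}" "vs1.independent K" "{x \<in> X. T x = 0} \<subseteq> vs1.span K"
    using vs1.maximal_independent_subset[of "{x \<in> X. T x = 0}"] by blast
  have subker: "vs1.subspace {x \<in> X. T x = 0}"
    using X by (auto simp: vs1.subspace_def T.add T.scale T.zero)
  have spanK: "vs1.span K = {x \<in> X. T x = 0}"
    using vs1.span_minimal[OF K(1) subker] K(3) by blast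
  \<comment> \<open>\<open>P\<close> carries the kernel of \<open>T\<close> bijectively onto
    \<open>K1\<close>: injectivity is \<open>inj\<close>, and a given \<open>b\<close> in
    \<open>K1\<close> is corrected by some z with vanishing coordinates and
    \<open>T z = T b\<close>.\<close>
  have injP: "inj_on P (vs1.span K)"
  proof (rule P.inj_on_iff_eq_0[THEN iffD2, OF vs1.subspace_span], intro ballI impI)
    fix x assume x: "x \<in> vs1.span K" "P x = 0"
    have "p i x = 0" if "i \<in> I" for i using pP[OF that, of x] x padd(3)[OF that] by simp
    then show "x = 0" using inj[of x] x spanK by auto
  qed
  have PK: "vs1.independent (P ` K)" by (rule P.independent_injective_image[OF K(2) injP])
  have "P ` K \<subseteq> K1"
  proof
    fix y assume "y \<in> P ` K"
    then obtain x where x: "x \<in> X" "T x = 0" "y = P x" using K(1) by auto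
    then have "\<tau> y = 0" using RT[OF x(1)] R.zero by simp
    then show "y \<in> K1" using x PE unfolding K1_def by simp
  qed
  then have "P ` K \<subseteq> vs1.span BK" using BK(3) by auto
  then have fPK: "finite (P ` K) \<and> card (P ` K) \<le> card BK"
    using vs1.independent_span_bound PK finB B(1) finite_subset by metis
  have injPK: "inj_on P K" using injP inj_on_subset vs1.span_superset by blast
  have finK: "finite K" using fPK injPK finite_image_iff by blast
  have "BK \<subseteq> vs1.span (P ` K)"
  proof
    fix b assume b: "b \<in> BK"
    then have b1: "b \<in> E1" "\<tau> b = 0" using BK(1) unfolding K1_def by auto
    have "T b \<in> Y" using b1 E1X TX by auto
    have "q j (T b) = 0" if "j \<in> J" for j
      using qR[OF that, of "T b"] b1(2) qadd(3)[OF that] unfolding \<tau>_def by simp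
    then obtain z where z: "z \<in> X" "\<And>i. i \<in> I \<Longrightarrow> p i z = 0" "T z = T b"
      using surj[OF \<open>T b \<in> Y\<close>] by blast
    have "b - z \<in> vs1.span K" unfolding spanK using z b1 E1X X
      by (auto simp: T.diff vs1.subspace_diff)
    moreover have "P z = 0" unfolding P_def using z(2) by simp
    then have "P (b - z) = b" using PP[OF b1(1)] by (simp add: P.diff)
    ultimately show "b \<in> vs1.span (P ` K)" by (metis P.span_image imageI)
  qed
  then have "card BK \<le> card (P ` K)"
    using vs1.independent_span_bound BK(2) fPK by blast
  then have cardK: "card K = card BK" using fPK card_image[OF injPK] by simp
  have "card C = card B - card BK" unfolding C_def using B(1) finB by (simp add: card_Diff_subset finite_subset)
  moreover have "card BK \<le> card B" using B(1) finB card_mono by blast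
  moreover have "card (\<tau> ` C) = card C"
    using inj\<tau> by (meson card_image inj_on_subset vs1.span_superset)
  moreover have "card D = card B2 - card (\<tau> ` C)" unfolding D_def using B2(1) finB2
    by (simp add: card_Diff_subset finite_subset)
  moreover have "card (\<tau> ` C) \<le> card B2" using B2(1) finB2 card_mono by blast
  ultimately have cards: "card K + card J = card D + card I"
    using cardB cardB2 cardK by linarith
  have DY: "D \<subseteq> Y" using DB B2(2) E2Y by auto
  \<comment> \<open>\<open>\<delta>\<close> kills the range, so any \<open>B'\<close> spanning
    modulo the range is mapped to a set whose span contains the independent set
    \<open>D\<close>.\<close>
  have minD: "card D \<le> card B'" if B': "finite B'" "Y \<subseteq> vs2.span (T ` X \<union> B')" for B'
  proof -
    have "d \<in> vs2.span (\<delta> ` B')" if d: "d \<in> D" for d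
    proof -
      have "d \<in> vs2.span (T ` X \<union> B')" using d DY B' by auto
      then obtain u v where uv: "d = u + v" "u \<in> vs2.span (T ` X)" "v \<in> vs2.span B'"
        unfolding vs2.span_Un by auto
      have "u \<in> T ` X" using uv(2) subTX vs2.span_eq_iff by blast
      then have "\<delta> d = \<delta> v" using uv(1) \<delta>TX by (simp add: \<delta>.add)
      moreover have "\<delta> d = d" using d by (intro \<delta>D vs2.span_base)
      ultimately show ?thesis using uv(3) by (metis \<delta>.span_image imageI)
    qed
    then have "card D \<le> card (\<delta> ` B')"
      using vs2.independent_span_bound[of "\<delta> ` B'" D] B'(1) indD by auto
    also have "\<dots> \<le> card B'" using B'(1) by (rule card_image_le)
    finally show ?thesis .
  qed
  have spanD: "Y \<subseteq> vs2.span (T ` X \<union> D)"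
  proof
    fix y assume y: "y \<in> Y"
    have d: "\<delta> y \<in> vs2.span D" unfolding \<delta>_def using pi2(4) RE B2(4) by auto
    then have "\<delta> y \<in> Y" using vs2.span_minimal[OF DY Y] by auto
    then have "y - \<delta> y \<in> T ` X" using TX\<delta>[of "y - \<delta> y"] y Y \<delta>D[OF d]
      by (auto simp: \<delta>.diff vs2.subspace_diff)
    then have "(y - \<delta> y) + \<delta> y \<in> vs2.span (T ` X \<union> D)"
      using d by (intro vs2.span_add) (auto intro: vs2.span_base vs2.span_mono[THEN subsetD])
    then show "y \<in> vs2.span (T ` X \<union> D)" by simp
  qed
  \<comment> \<open>On \<open>Y\<close>, \<open>\<delta> y\<close> depends on \<open>y\<close> only
    through the \<open>q j y\<close>, so its coordinates in the basis \<open>D\<close> are fixed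
    linear combinations of them.\<close>
  define c where "c d j = vs2.representation D (\<delta> (f j)) d" for d j
  have \<delta>sum: "\<delta> y = (\<Sum>j\<in>J. s2 (q j y) (\<delta> (f j)))" if "y \<in> Y" for y
  proof -
    have "\<delta> y = \<delta> (R y)" unfolding \<delta>_def using RR[OF RE] by simp
    also have "\<dots> = (\<Sum>j\<in>J. s2 (q j y) (\<delta> (f j)))" unfolding R_def by (simp add: \<delta>.sum \<delta>.scale)
    finally show ?thesis .
  qed
  have \<delta>span: "\<delta> y \<in> vs2.span D" for y
    unfolding \<delta>_def using pi2(4) RE B2(4) by auto
  have repsum: "vs2.representation D (\<delta> y) d = (\<Sum>j\<in>J. c d j * q j y)" if "y \<in> Y" for y d
    unfolding \<delta>sum[OF that] c_def
    by (subst vs2.representation_sum[OF indD])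
      (auto intro!: vs2.span_scale \<delta>span sum.cong simp: vs2.representation_scale[OF indD \<delta>span] mult.commute)
  have TXc: "T ` X = {y \<in> Y. \<forall>d\<in>D. (\<Sum>j\<in>J. c d j * q j y) = 0}"
  proof (intro subset_antisym subsetI)
    fix y assume "y \<in> T ` X"
    then show "y \<in> {y \<in> Y. \<forall>d\<in>D. (\<Sum>j\<in>J. c d j * q j y) = 0}"
      using TX \<delta>TX[of y] repsum[of y] by (auto simp: vs2.representation_zero)
  next
    fix y assume y: "y \<in> {y \<in> Y. \<forall>d\<in>D. (\<Sum>j\<in>J. c d j * q j y) = 0}"
    then have "vs2.representation D (\<delta> y) d = 0" if "d \<in> D" for d using repsum[of y] that by auto
    then have "\<delta> y = 0"
      using vs2.sum_representation_eq[OF indD \<delta>span _ order_refl, of y] finB2 DB(1)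
      by (metis (no_types, lifting) finite_subset sum.neutral vs2.scale_zero_left)
    then show "y \<in> T ` X" using TX\<delta> y by auto
  qed
  show thesis
    by (rule that[of K D c]) (use finK K DY finB2 DB(1) finite_subset spanD minD cards TXc in \<open>auto\<close>)
qed

end

section \<open>Bounded operators\<close>

text \<open>Nonnegativity and symmetry of the norm are required outside the carrier as well, because
  \<^locale>\<open>Metric_space\<close> demands them of a metric on the whole type.\<close>

locale normed_carrier = vector_space "scal X"
  for X :: "('s::real_normed_field, 'v::ab_group_add) normed_space" +
  assumes subspace_carr: "subspace (carr X)"
    and nrm_ge_0: "0 \<le> nrm X x"
    and nrm_uminus: "nrm X (- x) = nrm X x"
    and nrm_eq_0_imp: "x \<in> carr X \<Longrightarrow> nrm X x = 0 \<Longrightarrow> x = 0"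
    and nrm_triangle: "x \<in> carr X \<Longrightarrow> y \<in> carr X \<Longrightarrow> nrm X (x + y) \<le> nrm X x + nrm X y"
    and nrm_scal: "x \<in> carr X \<Longrightarrow> nrm X (scal X c x) = norm c * nrm X x"
begin

lemma carr_zero: "0 \<in> carr X" using subspace_carr by (rule subspace_0)
lemma carr_add: "x \<in> carr X \<Longrightarrow> y \<in> carr X \<Longrightarrow> x + y \<in> carr X"
  using subspace_carr by (rule subspace_add)
lemma carr_diff: "x \<in> carr X \<Longrightarrow> y \<in> carr X \<Longrightarrow> x - y \<in> carr X"
  using subspace_carr by (rule subspace_diff)
lemma carr_scal: "x \<in> carr X \<Longrightarrow> scal X c x \<in> carr X"
  using subspace_carr by (rule subspace_scale)
lemma carr_uminus: "x \<in> carr X \<Longrightarrow> - x \<in> carr X"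
  using subspace_carr by (rule subspace_neg)
lemma carr_sum: "(\<And>i. i \<in> I \<Longrightarrow> f i \<in> carr X) \<Longrightarrow> (\<Sum>i\<in>I. f i) \<in> carr X"
  using subspace_carr by (rule subspace_sum)

lemma nrm_zero: "nrm X 0 = 0"
  using nrm_scal[of 0 0] carr_zero by simp

lemma nrm_diff_triangle:
  "x \<in> carr X \<Longrightarrow> y \<in> carr X \<Longrightarrow> z \<in> carr X \<Longrightarrow> nrm X (x - z) \<le> nrm X (x - y) + nrm X (y - z)"
  using nrm_triangle[of "x - y" "y - z"] carr_diff by simp

lemma nrm_minus_commute: "nrm X (x - y) = nrm X (y - x)"
  using nrm_uminus[of "x - y"] by simp

lemma Metric_space_carr: "Metric_space (carr X) (\<lambda>u v. nrm X (u - v))"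
proof
  show "0 \<le> nrm X (x - y)" for x y by (rule nrm_ge_0)
  show "nrm X (x - y) = nrm X (y - x)" for x y by (rule nrm_minus_commute)
  show "nrm X (x - y) = 0 \<longleftrightarrow> x = y" if "x \<in> carr X" "y \<in> carr X" for x y
    using nrm_eq_0_imp[of "x - y"] carr_diff[OF that] nrm_zero by auto
  show "nrm X (x - z) \<le> nrm X (x - y) + nrm X (y - z)"
    if "x \<in> carr X" "y \<in> carr X" "z \<in> carr X" for x y z
    using that by (rule nrm_diff_triangle)
qed

end

text \<open>Functionals become bounded operators into this space and so share the calculus of
  operators with all other maps.\<close>

definition scalars :: "('s::real_normed_field, 's) normed_space" where
  "scalars = \<lparr>carr = UNIV, scal = (*), nrm = norm\<rparr>"

lemma scalars_simps [simp]:
  "carr scalars = UNIV" "scal scalars = (*)" "nrm scalars = norm"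
  by (simp_all add: scalars_def)

lemma normed_carrier_scalars: "normed_carrier (scalars :: ('s::real_normed_field, 's) normed_space)"
proof -
  interpret vector_space "(*) :: 's \<Rightarrow> _" by standard (auto simp: algebra_simps)
  show ?thesis
    by (unfold_locales) (auto simp: algebra_simps norm_mult norm_triangle_ineq subspace_def)
qed

lemma prod_space_simps [simp]:
  "carr (prod_space X Y) = carr X \<times> carr Y"
  "scal (prod_space X Y) c (x, y) = (scal X c x, scal Y c y)"
  "nrm (prod_space X Y) (x, y) = sqrt ((nrm X x)\<^sup>2 + (nrm Y y)\<^sup>2)"
  by (simp_all add: prod_space_def)

lemma normed_carrier_prod_space:
  assumes "normed_carrier X" "normed_carrier Y"
  shows "normed_carrier (prod_space X Y)"
proof -
  interpret X: normed_carrier X by fact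
  interpret Y: normed_carrier Y by fact
  interpret vector_space "scal (prod_space X Y)"
    by standard (auto simp: algebra_simps X.scale_right_distrib Y.scale_right_distrib
        X.scale_left_distrib Y.scale_left_distrib)
  show ?thesis
  proof unfold_locales
    show "subspace (carr (prod_space X Y))"
      by (auto simp: subspace_def zero_prod_def X.carr_zero Y.carr_zero X.carr_add Y.carr_add
          X.carr_scal Y.carr_scal)
    fix x
    show "0 \<le> nrm (prod_space X Y) x" by (cases x) simp
    show "nrm (prod_space X Y) (- x) = nrm (prod_space X Y) x"
      by (cases x) (simp add: X.nrm_uminus Y.nrm_uminus)
    assume x: "x \<in> carr (prod_space X Y)"
    show "x = 0" if "nrm (prod_space X Y) x = 0"
      using that x by (cases x)
        (auto simp: zero_prod_def sum_power2_eq_zero_iff intro: X.nrm_eq_0_imp Y.nrm_eq_0_imp)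
    show "nrm (prod_space X Y) (scal (prod_space X Y) c x) = norm c * nrm (prod_space X Y) x" for c
      using x by (cases x)
        (auto simp: X.nrm_scal Y.nrm_scal power_mult_distrib distrib_left[symmetric] real_sqrt_mult)
    fix y assume y: "y \<in> carr (prod_space X Y)"
    obtain x1 x2 y1 y2 where xy: "x = (x1, x2)" "y = (y1, y2)" by (cases x, cases y)
    have "sqrt ((nrm X (x1 + y1))\<^sup>2 + (nrm Y (x2 + y2))\<^sup>2)
        \<le> sqrt ((nrm X x1 + nrm X y1)\<^sup>2 + (nrm Y x2 + nrm Y y2)\<^sup>2)"
      using x y xy by (intro real_sqrt_le_mono add_mono power_mono X.nrm_triangle Y.nrm_triangle
          X.nrm_ge_0 Y.nrm_ge_0) auto
    also have "\<dots> \<le> sqrt ((nrm X x1)\<^sup>2 + (nrm Y x2)\<^sup>2) + sqrt ((nrm X y1)\<^sup>2 + (nrm Y y2)\<^sup>2)"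
      by (rule real_sqrt_sum_squares_triangle_ineq)
    finally show "nrm (prod_space X Y) (x + y) \<le> nrm (prod_space X Y) x + nrm (prod_space X Y) y"
      by (simp add: xy)
  qed
qed

section \<open>Calculus of bounded operators\<close>

lemma bounded_operatorI:
  assumes "\<And>x. x \<in> carr X \<Longrightarrow> T x \<in> carr Y"
    and "\<And>x y. x \<in> carr X \<Longrightarrow> y \<in> carr X \<Longrightarrow> T (x + y) = T x + T y"
    and "\<And>c x. x \<in> carr X \<Longrightarrow> T (scal X c x) = scal Y c (T x)"
    and "\<And>x. x \<in> carr X \<Longrightarrow> nrm Y (T x) \<le> C * nrm X x"
  shows "bounded_operator X Y T"
  using assms unfolding bounded_operator_def by blast

lemma bounded_operatorD:
  assumes "bounded_operator X Y T"
  shows "x \<in> carr X \<Longrightarrow> T x \<in> carr Y"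
    and "x \<in> carr X \<Longrightarrow> y \<in> carr X \<Longrightarrow> T (x + y) = T x + T y"
    and "x \<in> carr X \<Longrightarrow> T (scal X c x) = scal Y c (T x)"
  using assms unfolding bounded_operator_def by blast+

lemma bounded_operator_bound:
  assumes "bounded_operator X Y T" "normed_carrier X"
  obtains C where "0 \<le> C" "\<And>x. x \<in> carr X \<Longrightarrow> nrm Y (T x) \<le> C * nrm X x"
proof -
  interpret X: normed_carrier X by fact
  obtain C where C: "\<And>x. x \<in> carr X \<Longrightarrow> nrm Y (T x) \<le> C * nrm X x"
    using assms(1) unfolding bounded_operator_def by blast
  have "nrm Y (T x) \<le> \<bar>C\<bar> * nrm X x" if "x \<in> carr X" for x
    using C[OF that] X.nrm_ge_0[of x] by (meson abs_ge_self mult_right_mono order_trans)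
  then show thesis using that[of "\<bar>C\<bar>"] by auto
qed

lemma bounded_operator_linear:
  assumes T: "bounded_operator X Y T" and X: "normed_carrier X" and Y: "normed_carrier Y"
  shows "T 0 = 0"
    and "x \<in> carr X \<Longrightarrow> T (- x) = - T x"
    and "x \<in> carr X \<Longrightarrow> y \<in> carr X \<Longrightarrow> T (x - y) = T x - T y"
    and "(\<And>i. i \<in> I \<Longrightarrow> f i \<in> carr X) \<Longrightarrow> T (\<Sum>i\<in>I. f i) = (\<Sum>i\<in>I. T (f i))"
proof -
  interpret X: normed_carrier X by fact
  interpret Y: normed_carrier Y by fact
  note D = bounded_operatorD[OF T]
  show 0: "T 0 = 0" using D(2)[OF X.carr_zero X.carr_zero] by simp
  show m: "T (- x) = - T x" if "x \<in> carr X" for x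
    using D(2)[OF that X.carr_uminus[OF that]] 0 by (simp add: eq_neg_iff_add_eq_0 add.commute)
  show "T (x - y) = T x - T y" if "x \<in> carr X" "y \<in> carr X" for x y
    using D(2)[OF that(1) X.carr_uminus[OF that(2)]] m[OF that(2)] by simp
  show "T (\<Sum>i\<in>I. f i) = (\<Sum>i\<in>I. T (f i))" if "\<And>i. i \<in> I \<Longrightarrow> f i \<in> carr X"
    using that
  proof (induction I rule: infinite_finite_induct)
    case (insert i I)
    then show ?case using D(2)[of "f i" "\<Sum>i\<in>I. f i"] X.carr_sum[of I f] by simp
  qed (simp_all add: 0)
qed

lemma bounded_operator_compose:
  assumes T: "bounded_operator X Y T" and S: "bounded_operator Y Z S" and Y: "normed_carrier Y"
  shows "bounded_operator X Z (\<lambda>x. S (T x))"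
proof -
  obtain C where C: "0 \<le> C" "\<And>x. x \<in> carr Y \<Longrightarrow> nrm Z (S x) \<le> C * nrm Y x"
    using bounded_operator_bound[OF S Y] by blast
  obtain D where D: "\<And>x. x \<in> carr X \<Longrightarrow> nrm Y (T x) \<le> D * nrm X x"
    using T unfolding bounded_operator_def by blast
  have "nrm Z (S (T x)) \<le> (C * D) * nrm X x" if "x \<in> carr X" for x
    using C(2)[of "T x"] mult_left_mono[OF D[OF that] C(1)] bounded_operatorD(1)[OF T that]
    by (simp add: mult.assoc)
  then show ?thesis
    by (intro bounded_operatorI[where C = "C * D"])
      (auto simp: bounded_operatorD[OF T] bounded_operatorD[OF S])
qed

lemma bounded_operator_add:
  assumes T: "bounded_operator X Y T" and S: "bounded_operator X Y S" and Y: "normed_carrier Y"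
  shows "bounded_operator X Y (\<lambda>x. T x + S x)"
proof -
  interpret Y: normed_carrier Y by fact
  obtain C where C: "\<And>x. x \<in> carr X \<Longrightarrow> nrm Y (S x) \<le> C * nrm X x"
    using S unfolding bounded_operator_def by blast
  obtain D where D: "\<And>x. x \<in> carr X \<Longrightarrow> nrm Y (T x) \<le> D * nrm X x"
    using T unfolding bounded_operator_def by blast
  have "nrm Y (T x + S x) \<le> (D + C) * nrm X x" if "x \<in> carr X" for x
    using Y.nrm_triangle[of "T x" "S x"] C[OF that] D[OF that] bounded_operatorD(1)[OF T that]
      bounded_operatorD(1)[OF S that]
    by (simp add: distrib_right)
  then show ?thesis
    by (intro bounded_operatorI[where C = "D + C"])
      (auto simp: bounded_operatorD[OF T] bounded_operatorD[OF S] Y.carr_add Y.scale_right_distrib)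
qed

lemma bounded_operator_zero:
  assumes Y: "normed_carrier Y"
  shows "bounded_operator X Y (\<lambda>x. 0)"
proof -
  interpret Y: normed_carrier Y by fact
  show ?thesis
    by (rule bounded_operatorI[where C = 0]) (auto simp: Y.carr_zero Y.nrm_zero)
qed

lemma bounded_operator_scale:
  assumes T: "bounded_operator X Y T" and Y: "normed_carrier Y"
  shows "bounded_operator X Y (\<lambda>x. scal Y c (T x))"
proof -
  interpret Y: normed_carrier Y by fact
  obtain D where D: "\<And>x. x \<in> carr X \<Longrightarrow> nrm Y (T x) \<le> D * nrm X x"
    using T unfolding bounded_operator_def by blast
  have "nrm Y (scal Y c (T x)) \<le> (norm c * D) * nrm X x" if "x \<in> carr X" for x
    using mult_left_mono[OF D[OF that] norm_ge_zero[of c]] bounded_operatorD(1)[OF T that]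
    by (simp add: Y.nrm_scal)
  then show ?thesis
    by (intro bounded_operatorI[where C = "norm c * D"])
      (auto simp: bounded_operatorD[OF T] Y.carr_scal Y.scale_right_distrib mult.commute)
qed

lemma bounded_operator_uminus:
  assumes T: "bounded_operator X Y T" and Y: "normed_carrier Y"
  shows "bounded_operator X Y (\<lambda>x. - T x)"
proof -
  interpret Y: normed_carrier Y by fact
  show ?thesis using bounded_operator_scale[OF T Y, of "- 1"] by (simp add: Y.scale_minus_left)
qed

lemma bounded_operator_diff:
  assumes T: "bounded_operator X Y T" and S: "bounded_operator X Y S" and Y: "normed_carrier Y"
  shows "bounded_operator X Y (\<lambda>x. T x - S x)"
  using bounded_operator_add[OF T bounded_operator_uminus[OF S Y] Y] by simp

lemma bounded_operator_sum:
  assumes T: "\<And>i. i \<in> I \<Longrightarrow> bounded_operator X Y (T i)" and Y: "normed_carrier Y"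
  shows "bounded_operator X Y (\<lambda>x. \<Sum>i\<in>I. T i x)"
  using T
proof (induction I rule: infinite_finite_induct)
  case (insert i I)
  then show ?case using bounded_operator_add[OF _ _ Y, of X "T i"] by simp
qed (simp_all add: bounded_operator_zero[OF Y])

lemma bounded_operator_id:
  assumes "carr X \<subseteq> carr Y" "\<And>c x. x \<in> carr X \<Longrightarrow> scal Y c x = scal X c x"
    "\<And>x. x \<in> carr X \<Longrightarrow> nrm Y x \<le> C * nrm X x"
  shows "bounded_operator X Y (\<lambda>x. x)"
  using assms by (intro bounded_operatorI[where C = C]) auto

lemma bounded_operator_scale_vector:
  assumes p: "bounded_operator X scalars p" and Y: "normed_carrier Y" and v: "v \<in> carr Y"
  shows "bounded_operator X Y (\<lambda>x. scal Y (p x) v)"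
proof -
  interpret Y: normed_carrier Y by fact
  obtain D where D: "\<And>x. x \<in> carr X \<Longrightarrow> norm (p x) \<le> D * nrm X x"
    using p unfolding bounded_operator_def scalars_simps by blast
  have "nrm Y (scal Y (p x) v) \<le> (nrm Y v * D) * nrm X x" if "x \<in> carr X" for x
    using mult_left_mono[OF D[OF that] Y.nrm_ge_0[of v]] v
    by (simp add: Y.nrm_scal mult.commute mult.left_commute)
  then show ?thesis
    using bounded_operatorD[OF p] v
    by (intro bounded_operatorI[where C = "nrm Y v * D"])
      (auto simp: Y.carr_scal Y.scale_left_distrib)
qed

lemma bounded_operator_Pair:
  assumes T: "bounded_operator X Y T" and S: "bounded_operator X Z S"
    and X: "normed_carrier X" and Y: "normed_carrier Y" and Z: "normed_carrier Z"
  shows "bounded_operator X (prod_space Y Z) (\<lambda>x. (T x, S x))"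
proof -
  interpret Y: normed_carrier Y by fact
  interpret Z: normed_carrier Z by fact
  obtain C where C: "\<And>x. x \<in> carr X \<Longrightarrow> nrm Z (S x) \<le> C * nrm X x"
    using S unfolding bounded_operator_def by blast
  obtain D where D: "\<And>x. x \<in> carr X \<Longrightarrow> nrm Y (T x) \<le> D * nrm X x"
    using T unfolding bounded_operator_def by blast
  have "nrm (prod_space Y Z) (T x, S x) \<le> (D + C) * nrm X x" if "x \<in> carr X" for x
  proof -
    have "nrm (prod_space Y Z) (T x, S x) \<le> nrm Y (T x) + nrm Z (S x)"
      using Y.nrm_ge_0 Z.nrm_ge_0 by (simp add: sqrt_sum_squares_le_sum)
    then show ?thesis using C[OF that] D[OF that] by (simp add: distrib_right)
  qed
  then show ?thesis
    by (intro bounded_operatorI[where C = "D + C"])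
      (auto simp: bounded_operatorD[OF T] bounded_operatorD[OF S])
qed

lemma bounded_operator_fst: "bounded_operator (prod_space Y Z) Y fst"
  by (rule bounded_operatorI[where C = 1]) (auto intro: real_le_rsqrt)

lemma bounded_operator_snd: "bounded_operator (prod_space Y Z) Z snd"
  by (rule bounded_operatorI[where C = 1]) (auto intro: real_le_rsqrt)

text \<open>A bounded operator is linear on the carrier only, while the linear algebra above speaks
  of maps linear on the whole type. Prescribing the values on a basis of the carrier bridges the
  two.\<close>

lemma bounded_operator_extend_linear:
  assumes T: "bounded_operator X Y T" and X: "normed_carrier X" and Y: "normed_carrier Y"
  obtains g where "Vector_Spaces.linear (scal X) (scal Y) g" "\<And>x. x \<in> carr X \<Longrightarrow> g x = T x"
proof -
  interpret X: normed_carrier X by fact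
  interpret Y: normed_carrier Y by fact
  interpret vector_space_pair "scal X" "scal Y" by unfold_locales
  obtain B where B: "B \<subseteq> carr X" "X.independent B" "carr X \<subseteq> X.span B"
    using X.maximal_independent_subset[of "carr X"] by blast
  obtain g where g: "Vector_Spaces.linear (scal X) (scal Y) g" "\<And>x. x \<in> B \<Longrightarrow> g x = T x"
    using linear_independent_extend[OF B(2)] by blast
  interpret g: Vector_Spaces.linear "scal X" "scal Y" g by (rule g)
  have "X.subspace {x \<in> carr X. g x = T x}"
    unfolding X.subspace_def
    by (auto simp: X.carr_zero X.carr_add X.carr_scal g.zero g.add g.scale
        bounded_operatorD[OF T] bounded_operator_linear(1)[OF T X Y])
  then have "X.span B \<subseteq> {x \<in> carr X. g x = T x}"
    using B(1) g(2) by (intro X.span_minimal) auto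
  then show thesis using that[OF g(1)] B(3) by blast
qed

text \<open>If \<open>f d y\<close> is nonzero, continuity of \<open>f d\<close> keeps it nonzero on
  a ball around \<open>y\<close>. The radius divides by \<open>C + 1\<close>, which is positive even
  for \<open>C = 0\<close>.\<close>

lemma closed_in_space_kernels:
  assumes Y: "normed_carrier Y"
    and f: "\<And>d. d \<in> D \<Longrightarrow> bounded_operator Y scalars (f d)"
  shows "closed_in_space Y {y \<in> carr Y. \<forall>d\<in>D. f d y = 0}"
proof -
  interpret Y: normed_carrier Y by fact
  interpret M: Metric_space "carr Y" "\<lambda>u v. nrm Y (u - v)" by (rule Y.Metric_space_carr)
  have "\<exists>r>0. disjnt {y \<in> carr Y. \<forall>d\<in>D. f d y = 0} (M.mball y r)"
    if y: "y \<in> carr Y" "d \<in> D" "f d y \<noteq> 0" for y d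
  proof -
    obtain C where C: "0 \<le> C" "\<And>x. x \<in> carr Y \<Longrightarrow> norm (f d x) \<le> C * nrm Y x"
      using bounded_operator_bound[OF f[OF y(2)] Y] by auto
    have "z \<notin> M.mball y (norm (f d y) / (C + 1))" if z: "z \<in> carr Y" "f d z = 0" for z
    proof
      assume "z \<in> M.mball y (norm (f d y) / (C + 1))"
      then have lt: "nrm Y (y - z) < norm (f d y) / (C + 1)" by simp
      have "norm (f d y) = norm (f d (y - z))"
        using bounded_operator_linear(3)[OF f[OF y(2)] Y normed_carrier_scalars y(1) z(1)] z by simp
      also have "\<dots> \<le> C * nrm Y (y - z)" using C(2) Y.carr_diff y z by blast
      also have "\<dots> \<le> (C + 1) * nrm Y (y - z)" using Y.nrm_ge_0 by (simp add: distrib_right)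
      also have "\<dots> < norm (f d y)" using lt C(1) by (simp add: field_simps)
      finally show False by simp
    qed
    then show ?thesis using y C(1)
      by (intro exI[of _ "norm (f d y) / (C + 1)"]) (auto simp: disjnt_def)
  qed
  then show ?thesis
    unfolding closed_in_space_def M.closedin_metric by auto
qed

text \<open>The range is the common kernel of finitely many linear combinations of the bounded
  \<open>q j\<close>; this adds closedness to the algebraic count.\<close>

theorem fredholm_of_biorthogonal_systems:
  assumes X: "normed_carrier X" and Y: "normed_carrier Y" and T: "bounded_operator X Y T"
    and fin: "finite I" "finite J"
    and p: "\<And>i. i \<in> I \<Longrightarrow> bounded_operator X scalars (p i)" and e: "\<And>i. i \<in> I \<Longrightarrow> e i \<in> carr X"
    and pe: "\<And>i j. i \<in> I \<Longrightarrow> j \<in> I \<Longrightarrow> p i (e j) = (if i = j then 1 else 0)"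
    and q: "\<And>i. i \<in> J \<Longrightarrow> bounded_operator Y scalars (q i)" and f: "\<And>i. i \<in> J \<Longrightarrow> f i \<in> carr Y"
    and qf: "\<And>i j. i \<in> J \<Longrightarrow> j \<in> J \<Longrightarrow> q i (f j) = (if i = j then 1 else 0)"
    and TZ: "\<And>x j. x \<in> carr X \<Longrightarrow> (\<And>i. i \<in> I \<Longrightarrow> p i x = 0) \<Longrightarrow> j \<in> J \<Longrightarrow> q j (T x) = 0"
    and inj: "\<And>x. x \<in> carr X \<Longrightarrow> (\<And>i. i \<in> I \<Longrightarrow> p i x = 0) \<Longrightarrow> T x = 0 \<Longrightarrow> x = 0"
    and surj: "\<And>y. y \<in> carr Y \<Longrightarrow> (\<And>j. j \<in> J \<Longrightarrow> q j y = 0) \<Longrightarrow>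
      \<exists>x\<in>carr X. (\<forall>i\<in>I. p i x = 0) \<and> T x = y"
  shows "fredholm X Y T" "fredholm_index X Y T = int (card I) - int (card J)"
proof -
  interpret X: normed_carrier X by fact
  interpret Y: normed_carrier Y by fact
  interpret vector_space_pair "scal X" "scal Y" by unfold_locales
  note TD = bounded_operatorD[OF T]
  \<comment> \<open>\<open>T'\<close>, \<open>p'\<close> and \<open>q'\<close> are total linear
    extensions; on the carriers, where all claims live, they agree with the given maps.\<close>
  obtain T' where T': "Vector_Spaces.linear (scal X) (scal Y) T'" "\<And>x. x \<in> carr X \<Longrightarrow> T' x = T x"
    using bounded_operator_extend_linear[OF T X Y] by metis
  have "\<exists>g. Vector_Spaces.linear (scal X) (*) g \<and> (\<forall>x\<in>carr X. g x = p i x)" if "i \<in> I" for i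
    by (rule bounded_operator_extend_linear[OF p[OF that] X normed_carrier_scalars])
      (auto simp only: scalars_simps)
  then obtain p' where p': "\<And>i. i \<in> I \<Longrightarrow> Vector_Spaces.linear (scal X) (*) (p' i)"
    "\<And>i x. i \<in> I \<Longrightarrow> x \<in> carr X \<Longrightarrow> p' i x = p i x" by metis
  have "\<exists>g. Vector_Spaces.linear (scal Y) (*) g \<and> (\<forall>x\<in>carr Y. g x = q i x)" if "i \<in> J" for i
    by (rule bounded_operator_extend_linear[OF q[OF that] Y normed_carrier_scalars])
      (auto simp only: scalars_simps)
  then obtain q' where q': "\<And>i. i \<in> J \<Longrightarrow> Vector_Spaces.linear (scal Y) (*) (q' i)"
    "\<And>i x. i \<in> J \<Longrightarrow> x \<in> carr Y \<Longrightarrow> q' i x = q i x" by metis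
  have im: "T' ` carr X = T ` carr X" using T'(2) by (auto simp: image_iff)
  have ker: "{x \<in> carr X. T' x = 0} = kernel X T" using T'(2) unfolding kernel_def by auto
  have TXY: "T' ` carr X \<subseteq> carr Y" using im TD(1) by auto
  have pe': "p' i (e j) = (if i = j then 1 else 0)" if "i \<in> I" "j \<in> I" for i j
    using pe e p'(2) that by simp
  have qf': "q' i (f j) = (if i = j then 1 else 0)" if "i \<in> J" "j \<in> J" for i j
    using qf f q'(2) that by simp
  have TZ': "q' j (T' x) = 0" if "x \<in> carr X" "\<And>i. i \<in> I \<Longrightarrow> p' i x = 0" "j \<in> J" for x j
    using TZ[of x j] p'(2) q'(2) T'(2) TD(1) that by simp
  have inj': "x = 0" if "x \<in> carr X" "\<And>i. i \<in> I \<Longrightarrow> p' i x = 0" "T' x = 0" for x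
    using inj[of x] p'(2) T'(2) that by simp
  have surj': "\<exists>x\<in>carr X. (\<forall>i\<in>I. p' i x = 0) \<and> T' x = y"
    if y: "y \<in> carr Y" "\<And>j. j \<in> J \<Longrightarrow> q' j y = 0" for y
  proof -
    have "q j y = 0" if "j \<in> J" for j using y that q'(2) by simp
    then obtain x where "x \<in> carr X" "\<forall>i\<in>I. p i x = 0" "T x = y" using surj[OF y(1)] by blast
    then show ?thesis using p'(2) T'(2) by auto
  qed
  obtain K D c where K: "finite K" "K \<subseteq> kernel X T" "X.independent K" "kernel X T \<subseteq> X.span K"
    and D: "finite D" "D \<subseteq> carr Y" "carr Y \<subseteq> Y.span (T ` carr X \<union> D)"
      "\<And>B. finite B \<Longrightarrow> carr Y \<subseteq> Y.span (T ` carr X \<union> B) \<Longrightarrow> card D \<le> card B"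
    and cards: "card K + card J = card D + card I"
    and im2: "T ` carr X = {y \<in> carr Y. \<forall>d\<in>D. (\<Sum>j\<in>J. c d j * q' j y) = 0}"
    by (rule index_of_biorthogonal_systems[OF fin X.subspace_carr Y.subspace_carr T'(1) TXY
          p'(1) e pe' q'(1) f qf' TZ' inj' surj', unfolded im ker]) (assumption | rule that)+
  have cod: "codim Y (T ` carr X) = card D"
    unfolding codim_def
  proof (rule Least_equality)
    show "\<exists>B. spans_modulo Y (T ` carr X) B \<and> card B = card D"
      using D unfolding spans_modulo_def by blast
    show "card D \<le> n" if "\<exists>B. spans_modulo Y (T ` carr X) B \<and> card B = n" for n
      using that D(4) unfolding spans_modulo_def by blast
  qed
  have "closed_in_space Y {y \<in> carr Y. \<forall>d\<in>D. (\<Sum>j\<in>J. scal scalars (c d j) (q j y)) = 0}"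
    by (intro closed_in_space_kernels[OF Y] bounded_operator_sum bounded_operator_scale
        normed_carrier_scalars q)
  moreover have "{y \<in> carr Y. \<forall>d\<in>D. (\<Sum>j\<in>J. scal scalars (c d j) (q j y)) = 0} = T ` carr X"
    unfolding im2 using q'(2) by auto
  ultimately have closed: "closed_in_space Y (T ` carr X)" by simp
  show "fredholm X Y T"
    unfolding fredholm_def finite_dim_def finite_codim_def spans_modulo_def
    using T K D closed by blast
  show "fredholm_index X Y T = int (card I) - int (card J)"
    unfolding fredholm_index_def cod X.basis_card_eq_dim[OF K(2,4,3), symmetric] using cards by simp
qed

section \<open>Perturbation of the index\<close>

text \<open>Only sequences with geometrically decaying increments are tested. Every Cauchy sequence
  has a subsequence of this kind, so in a normed carrier this is ordinary completeness; it is also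
  the form in which Neumann iterations arrive.\<close>

definition complete_carrier :: "('s, 'v::ab_group_add) normed_space \<Rightarrow> bool" where
  "complete_carrier H \<longleftrightarrow>
     (\<forall>u C. (\<forall>n::nat. u n \<in> carr H) \<and> (\<forall>n. nrm H (u (Suc n) - u n) \<le> C / 2 ^ n) \<longrightarrow>
        (\<exists>x\<in>carr H. (\<lambda>n. nrm H (u n - x)) \<longlonglongrightarrow> 0))"

text \<open>The fixed point iteration for g = h - B g contracts by 1/2. The same factor gives
  \<open>nrm H g \<le> 2 * nrm H (g + B g)\<close>, hence uniqueness and the bound 2 for the
  inverse.\<close>

lemma neumann_inverse:
  assumes H: "normed_carrier H" "complete_carrier H" and B: "bounded_operator H H B"
    and small: "\<And>g. g \<in> carr H \<Longrightarrow> nrm H (B g) \<le> nrm H g / 2"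
  obtains U where "bounded_operator H H U" "\<And>g. g \<in> carr H \<Longrightarrow> U (g + B g) = g"
    "\<And>g. g \<in> carr H \<Longrightarrow> U g + B (U g) = g"
proof -
  interpret H: normed_carrier H by fact
  note BD = bounded_operatorD[OF B] and BL = bounded_operator_linear[OF B H(1) H(1)]
  have lower: "nrm H g \<le> 2 * nrm H (g + B g)" if g: "g \<in> carr H" for g
  proof -
    have "nrm H g \<le> nrm H (g + B g) + nrm H (- B g)"
      using H.nrm_triangle[of "g + B g" "- B g"] g BD(1) H.carr_add H.carr_uminus by simp
    then show ?thesis using small[OF g] by (simp add: H.nrm_uminus)
  qed
  have uniq: "g = g'" if "g \<in> carr H" "g' \<in> carr H" "g + B g = g' + B g'" for g g'
  proof -
    have "(g - g') + B (g - g') = (g + B g) - (g' + B g')" using that(1,2) by (simp add: BL(3))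
    then have "(g - g') + B (g - g') = 0" using that(3) by simp
    then have "nrm H (g - g') \<le> 0" using lower[of "g - g'"] H.carr_diff that H.nrm_zero by simp
    then show ?thesis
      using H.nrm_eq_0_imp[of "g - g'"] H.nrm_ge_0[of "g - g'"] H.carr_diff that by simp
  qed
  have ex: "\<exists>g\<in>carr H. g + B g = h" if h: "h \<in> carr H" for h
  proof -
    define u where "u n = ((\<lambda>g. h - B g) ^^ n) 0" for n
    have u_Suc: "u (Suc n) = h - B (u n)" for n by (simp add: u_def)
    have u: "u n \<in> carr H" for n
      by (induction n) (auto simp: u_Suc H.carr_zero H.carr_diff h BD(1), simp add: u_def H.carr_zero)
    have "nrm H (u (Suc n) - u n) \<le> nrm H h / 2 ^ n" for n
    proof (induction n)
      case 0 show ?case using BL(1) by (simp add: u_def)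
    next
      case (Suc n)
      have "u (Suc (Suc n)) - u (Suc n) = B (u n - u (Suc n))"
        using BL(3)[OF u[of n] u[of "Suc n"]] by (simp add: u_Suc[of n] u_Suc[of "Suc n"])
      then have "nrm H (u (Suc (Suc n)) - u (Suc n)) \<le> nrm H (u n - u (Suc n)) / 2"
        using small[OF H.carr_diff[OF u u]] by simp
      then show ?case using Suc by (simp add: H.nrm_minus_commute[of "u n"])
    qed
    then obtain x where x: "x \<in> carr H" "(\<lambda>n. nrm H (u n - x)) \<longlonglongrightarrow> 0"
      using H(2) u unfolding complete_carrier_def by blast
    \<comment> \<open>The residual of the limit is rewritten with
      \<open>h = u (Suc n) + B (u n)\<close>, so both error terms tend to 0.\<close>
    have le: "nrm H (x + B x - h) \<le> nrm H (u (Suc n) - x) + nrm H (u n - x) / 2" for n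
    proof -
      have eq: "x + B x - h = (x - u (Suc n)) + B (x - u n)"
        using BL(3)[OF x(1) u] by (simp add: u_Suc)
      have "nrm H (x + B x - h) \<le> nrm H (x - u (Suc n)) + nrm H (B (x - u n))"
        unfolding eq using H.nrm_triangle[of "x - u (Suc n)" "B (x - u n)"] x u H.carr_diff BD(1) by simp
      then show ?thesis
        using small[OF H.carr_diff[OF x(1) u, of n]]
        by (simp add: H.nrm_minus_commute[of x])
    qed
    have "(\<lambda>n. nrm H (u (Suc n) - x) + nrm H (u n - x) / 2) \<longlonglongrightarrow> 0 + 0 / 2"
      by (rule tendsto_add[OF LIMSEQ_Suc[OF x(2)] tendsto_divide[OF x(2) tendsto_const]]) simp
    then have "nrm H (x + B x - h) \<le> 0 + 0 / 2" by (rule LIMSEQ_le_const) (use le in auto)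
    then have "x + B x - h = 0"
      using H.nrm_eq_0_imp[of "x + B x - h"] H.nrm_ge_0[of "x + B x - h"] x(1) h BD(1) H.carr_add H.carr_diff
      by simp
    then show ?thesis using x(1) by auto
  qed
  define U where "U h = (THE g. g \<in> carr H \<and> g + B g = h)" for h
  have U: "U h \<in> carr H \<and> U h + B (U h) = h" if "h \<in> carr H" for h
    unfolding U_def by (rule theI') (use ex[OF that] uniq in blast)
  have UB: "U (g + B g) = g" if "g \<in> carr H" for g
    using U[of "g + B g"] uniq that BD(1) H.carr_add by blast
  have "bounded_operator H H U"
  proof (rule bounded_operatorI[where C = 2])
    fix x y assume xy: "x \<in> carr H" "y \<in> carr H"
    show "U x \<in> carr H" using U xy by blast
    show "U (x + y) = U x + U y"
    proof -
      have "U x + U y + B (U x + U y) = (U x + B (U x)) + (U y + B (U y))"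
        using U[OF xy(1)] U[OF xy(2)] BD(2)[of "U x" "U y"] by (simp only: ac_simps)
      also have "\<dots> = x + y" using U[OF xy(1)] U[OF xy(2)] by simp
      finally show ?thesis using UB[of "U x + U y"] U[OF xy(1)] U[OF xy(2)] H.carr_add by metis
    qed
    show "U (scal H c x) = scal H c (U x)" for c
      using U[OF xy(1)] UB[of "scal H c (U x)"] BD(3)[of "U x" c] H.carr_scal[of "U x" c]
      by (simp add: H.scale_right_distrib[symmetric])
    show "nrm H (U x) \<le> 2 * nrm H x" using U[OF xy(1)] lower[of "U x"] by simp
  qed
  then show thesis using that U UB by blast
qed

text \<open>\<open>X\<close> is \<open>H\<close> up to the finitely many coordinates \<open>p\<close>, and \<open>Y\<close> is \<open>H\<close> up to the finitely
  many coordinates \<open>q\<close>; in these terms \<open>T\<close> is the identity of \<open>H\<close> plus an operator \<open>K V\<close> which is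
  small after removal of finitely many further coordinates \<open>\<mu>\<close>. The latter are removed on both
  sides and cancel in the index.\<close>

theorem fredholm_identity_plus_compact:
  assumes X: "normed_carrier X" and Y: "normed_carrier Y"
    and H: "normed_carrier H" "complete_carrier H"
    and T: "bounded_operator X Y T"
    and D: "bounded_operator X H D" and V: "bounded_operator H X V"
    and E: "bounded_operator Y H E" and W: "bounded_operator H Y W"
    and K: "bounded_operator X H K"
    and fin: "finite I" "finite J" "finite R"
    and p: "\<And>i. i \<in> I \<Longrightarrow> bounded_operator X scalars (p i)" and e: "\<And>i. i \<in> I \<Longrightarrow> e i \<in> carr X"
    and pe: "\<And>i j. i \<in> I \<Longrightarrow> j \<in> I \<Longrightarrow> p i (e j) = (if i = j then 1 else 0)"
    and DV: "\<And>g. g \<in> carr H \<Longrightarrow> D (V g) = g"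
    and pV: "\<And>i g. i \<in> I \<Longrightarrow> g \<in> carr H \<Longrightarrow> p i (V g) = 0"
    and De: "\<And>i. i \<in> I \<Longrightarrow> D (e i) = 0"
    and Dp: "\<And>x. x \<in> carr X \<Longrightarrow> D x = 0 \<Longrightarrow> (\<And>i. i \<in> I \<Longrightarrow> p i x = 0) \<Longrightarrow> x = 0"
    and q: "\<And>i. i \<in> J \<Longrightarrow> bounded_operator Y scalars (q i)" and f: "\<And>i. i \<in> J \<Longrightarrow> f i \<in> carr Y"
    and qf: "\<And>i j. i \<in> J \<Longrightarrow> j \<in> J \<Longrightarrow> q i (f j) = (if i = j then 1 else 0)"
    and EW: "\<And>g. g \<in> carr H \<Longrightarrow> E (W g) = g"
    and qW: "\<And>i g. i \<in> J \<Longrightarrow> g \<in> carr H \<Longrightarrow> q i (W g) = 0"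
    and Ef: "\<And>i. i \<in> J \<Longrightarrow> E (f i) = 0"
    and Eq: "\<And>y. y \<in> carr Y \<Longrightarrow> E y = 0 \<Longrightarrow> (\<And>i. i \<in> J \<Longrightarrow> q i y = 0) \<Longrightarrow> y = 0"
    and ET: "\<And>x. x \<in> carr X \<Longrightarrow> E (T x) = D x + K x"
    and \<mu>: "\<And>i. i \<in> R \<Longrightarrow> bounded_operator H scalars (\<mu> i)" and \<xi>: "\<And>i. i \<in> R \<Longrightarrow> \<xi> i \<in> carr H"
    and \<mu>\<xi>: "\<And>i j. i \<in> R \<Longrightarrow> j \<in> R \<Longrightarrow> \<mu> i (\<xi> j) = (if i = j then 1 else 0)"
    and small: "\<And>g. g \<in> carr H \<Longrightarrow>
      nrm H (K (V (g - (\<Sum>i\<in>R. scal H (\<mu> i g) (\<xi> i))))) \<le> nrm H g / 2"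
  shows "fredholm X Y T" "fredholm_index X Y T = int (card I) - int (card J)"
proof -
  interpret X: normed_carrier X by fact
  interpret Y: normed_carrier Y by fact
  interpret H: normed_carrier H by fact
  note S = normed_carrier_scalars
  \<comment> \<open>This projects \<open>H\<close> onto the common kernel of the
    \<open>\<mu>\<close> along the \<open>\<xi>\<close>. Smallness concerns
    \<open>K V \<pi>\<close>, and \<open>U\<close> below inverts the identity plus this operator on
    all of \<open>H\<close>.\<close>
  define \<pi> where "\<pi> g = g - (\<Sum>i\<in>R. scal H (\<mu> i g) (\<xi> i))" for g
  have id: "bounded_operator H H (\<lambda>g. g)" by (rule bounded_operator_id[where C = 1]) auto
  have \<pi>: "bounded_operator H H \<pi>"
    unfolding \<pi>_def
    by (intro bounded_operator_diff bounded_operator_sum bounded_operator_scale_vector id \<mu> \<xi> H)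
  have \<pi>\<xi>: "\<pi> (\<xi> r) = 0" if "r \<in> R" for r
  proof -
    have "(\<Sum>i\<in>R. scal H (\<mu> i (\<xi> r)) (\<xi> i)) = (\<Sum>i\<in>R. if i = r then \<xi> i else 0)"
      using that by (intro sum.cong) (auto simp: \<mu>\<xi>)
    then show ?thesis using that fin(3) by (simp add: \<pi>_def)
  qed
  have \<pi>_id: "\<pi> g = g" if "\<And>r. r \<in> R \<Longrightarrow> \<mu> r g = 0" for g
    using that by (simp add: \<pi>_def)
  have KV\<pi>: "bounded_operator H H (\<lambda>g. K (V (\<pi> g)))"
    by (intro bounded_operator_compose[OF bounded_operator_compose[OF \<pi> V] K] H X)
  obtain U where U: "bounded_operator H H U"
    and UK: "\<And>g. g \<in> carr H \<Longrightarrow> U (g + K (V (\<pi> g))) = g"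
    and KU: "\<And>g. g \<in> carr H \<Longrightarrow> U g + K (V (\<pi> (U g))) = g"
    using neumann_inverse[OF H KV\<pi>] small unfolding \<pi>_def by blast
  have UE: "bounded_operator Y H (\<lambda>y. U (E y))" by (rule bounded_operator_compose[OF E U H(1)])
  have UEc: "U (E y) \<in> carr H" if "y \<in> carr Y" for y using bounded_operatorD(1)[OF UE that] .
  \<comment> \<open>Both systems are enlarged by the coordinates \<open>\<mu>\<close>, taken of
    \<open>D x\<close> on the side of \<open>X\<close> and of \<open>U (E y)\<close> on the side of
    \<open>Y\<close>. The functionals \<open>q j\<close> are corrected by
    \<open>T (V (\<pi> (U (E y))))\<close>, so that they vanish on the images of all elements with
    vanishing coordinates; \<open>f'\<close> is built so that
    \<open>U (E (f' (Inr r))) = \<xi> r\<close>.\<close>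
  define P where "P = case_sum p (\<lambda>r x. \<mu> r (D x))"
  define e' where "e' = case_sum e (\<lambda>r. V (\<xi> r))"
  define Q where "Q = case_sum (\<lambda>j y. q j (y - T (V (\<pi> (U (E y)))))) (\<lambda>r y. \<mu> r (U (E y)))"
  define f' where "f' = case_sum f (\<lambda>r. W (\<xi> r + K (V (\<pi> (\<xi> r)))))"
  have P: "bounded_operator X scalars (P i)" if "i \<in> I <+> R" for i
    using that by (auto simp: P_def p intro: bounded_operator_compose[OF D \<mu> H(1)])
  have e': "e' i \<in> carr X" if "i \<in> I <+> R" for i
    using that by (auto simp: e'_def e \<xi> bounded_operatorD(1)[OF V])
  have pe': "P i (e' j) = (if i = j then 1 else 0)" if "i \<in> I <+> R" "j \<in> I <+> R" for i j
    using that bounded_operator_linear(1)[OF \<mu> H(1) S]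
    by (auto simp: P_def e'_def pe pV \<xi> De DV \<mu>\<xi> split: if_splits)
  have TV\<pi>UE: "bounded_operator Y Y (\<lambda>y. T (V (\<pi> (U (E y)))))"
    by (intro bounded_operator_compose[OF bounded_operator_compose[OF bounded_operator_compose[OF UE \<pi>] V] T] H X)
  have idY: "bounded_operator Y Y (\<lambda>g. g)" by (rule bounded_operator_id[where C = 1]) auto
  have Q: "bounded_operator Y scalars (Q i)" if "i \<in> J <+> R" for i
    using that
    by (auto simp: Q_def intro: bounded_operator_compose[OF UE \<mu> H(1)]
        bounded_operator_compose[OF bounded_operator_diff[OF idY TV\<pi>UE Y] q Y])
  have KV\<pi>c: "g + K (V (\<pi> g)) \<in> carr H" if "g \<in> carr H" for g
    using that bounded_operatorD(1)[OF KV\<pi>] H.carr_add by blast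
  have f': "f' i \<in> carr Y" if "i \<in> J <+> R" for i
    using that KV\<pi>c by (auto simp: f'_def f \<xi> bounded_operatorD(1)[OF W])
  have zeros: "\<pi> 0 = 0" "V 0 = 0" "T 0 = 0" "U 0 = 0" "K 0 = 0" "E 0 = 0" "D 0 = 0"
    using bounded_operator_linear(1) \<pi> V T U K E D H(1) X Y by metis+
  have \<mu>0: "\<mu> r 0 = 0" if "r \<in> R" for r using bounded_operator_linear(1)[OF \<mu>[OF that] H(1) S] .
  have U\<xi>: "U (\<xi> r) = \<xi> r" if "r \<in> R" for r
    using UK[OF \<xi>[OF that]] \<pi>\<xi>[OF that] zeros by simp
  have qf': "Q i (f' j) = (if i = j then 1 else 0)" if "i \<in> J <+> R" "j \<in> J <+> R" for i j
    using that KV\<pi>c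
    by (auto simp: Q_def f'_def qf qW \<xi> Ef EW U\<xi> \<pi>\<xi> \<mu>\<xi> zeros \<mu>0 split: if_splits)
  \<comment> \<open>\<open>x - V (D x)\<close> is killed by \<open>D\<close> and by all
    \<open>p i\<close>, hence zero by \<open>Dp\<close>.\<close>
  have kerP: "\<exists>g\<in>carr H. x = V g \<and> (\<forall>r\<in>R. \<mu> r g = 0)"
    if x: "x \<in> carr X" "\<And>i. i \<in> I <+> R \<Longrightarrow> P i x = 0" for x
  proof -
    have p0: "p i x = 0" if "i \<in> I" for i using x(2)[of "Inl i"] that by (auto simp: P_def)
    have \<mu>D: "\<mu> r (D x) = 0" if "r \<in> R" for r using x(2)[of "Inr r"] that by (auto simp: P_def)
    have Dx: "D x \<in> carr H" "V (D x) \<in> carr X"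
      using x(1) bounded_operatorD(1)[OF D] bounded_operatorD(1)[OF V] by auto
    have "x - V (D x) = 0"
    proof (rule Dp)
      show "x - V (D x) \<in> carr X" using x(1) Dx X.carr_diff by simp
      show "D (x - V (D x)) = 0"
        using bounded_operator_linear(3)[OF D X H(1) x(1) Dx(2)] DV Dx by simp
      show "p i (x - V (D x)) = 0" if "i \<in> I" for i
        using bounded_operator_linear(3)[OF p[OF that] X S x(1) Dx(2)] pV that Dx p0 by simp
    qed
    then show ?thesis using Dx(1) \<mu>D by auto
  qed
  have PV: "P i (V g) = 0" if "g \<in> carr H" "\<And>r. r \<in> R \<Longrightarrow> \<mu> r g = 0" "i \<in> I <+> R" for g i
    using that by (auto simp: P_def pV DV)
  have ETV: "E (T (V g)) = g + K (V (\<pi> g))" if "g \<in> carr H" "\<And>r. r \<in> R \<Longrightarrow> \<mu> r g = 0" for g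
    using that ET bounded_operatorD(1)[OF V] DV \<pi>_id by simp
  have fin': "finite (I <+> R)" "finite (J <+> R)" using fin by auto
  note main = fredholm_of_biorthogonal_systems[OF X Y T fin', of P e' Q f']
  have 1: "Q j (T x) = 0" if x: "x \<in> carr X" "\<And>i. i \<in> I <+> R \<Longrightarrow> P i x = 0" and "j \<in> J <+> R" for x j
  proof -
    obtain g where g: "g \<in> carr H" "x = V g" "\<And>r. r \<in> R \<Longrightarrow> \<mu> r g = 0"
      using kerP[OF x] by blast
    have "U (E (T x)) = g" using g ETV UK by simp
    then show ?thesis
      using that(3) g \<pi>_id bounded_operator_linear(1)[OF q Y S] by (auto simp: Q_def)
  qed
  have 2: "x = 0" if x: "x \<in> carr X" "\<And>i. i \<in> I <+> R \<Longrightarrow> P i x = 0" and "T x = 0" for x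
  proof -
    obtain g where g: "g \<in> carr H" "x = V g" "\<And>r. r \<in> R \<Longrightarrow> \<mu> r g = 0"
      using kerP[OF x] by blast
    have "U (E (T x)) = g" using g ETV UK by simp
    then have "g = 0" using that(3) zeros by simp
    then show ?thesis using g zeros by simp
  qed
  \<comment> \<open>The candidate is \<open>V (U (E y))\<close>. Its image agrees with
    \<open>y\<close> under \<open>E\<close> by the inverse property of \<open>U\<close> and under
    the \<open>q j\<close> by the corrected functionals, so \<open>Eq\<close> identifies the
    two.\<close>
  have 3: "\<exists>x\<in>carr X. (\<forall>i\<in>I <+> R. P i x = 0) \<and> T x = y"
    if y: "y \<in> carr Y" "\<And>j. j \<in> J <+> R \<Longrightarrow> Q j y = 0" for y
  proof -
    define g where "g = U (E y)"
    have g: "g \<in> carr H" unfolding g_def using UEc y(1) .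
    have \<mu>g: "\<mu> r g = 0" if "r \<in> R" for r using y(2)[of "Inr r"] that by (auto simp: Q_def g_def)
    have Ey: "E y = E (T (V g))"
      using KU[OF bounded_operatorD(1)[OF E y(1)]] ETV[OF g \<mu>g] unfolding g_def by simp
    have TVg: "T (V g) \<in> carr Y" using g bounded_operatorD(1) T V by metis
    have "y - T (V g) = 0"
    proof (rule Eq)
      show "y - T (V g) \<in> carr Y" using y(1) TVg Y.carr_diff by simp
      show "E (y - T (V g)) = 0" using bounded_operator_linear(3)[OF E Y H(1) y(1) TVg] Ey by simp
      show "q j (y - T (V g)) = 0" if "j \<in> J" for j
        using y(2)[of "Inl j"] that \<pi>_id[OF \<mu>g] by (auto simp: Q_def g_def)
    qed
    then show ?thesis using PV[OF g \<mu>g] bounded_operatorD(1)[OF V g] by auto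
  qed
  show "fredholm X Y T" by (rule main(1)[OF P e' pe' Q f' qf' 1 2 3])
  have "fredholm_index X Y T = int (card (I <+> R)) - int (card (J <+> R))"
    by (rule main(2)[OF P e' pe' Q f' qf' 1 2 3])
  then show "fredholm_index X Y T = int (card I) - int (card J)"
    using fin by (simp add: card_Plus)
qed

section \<open>Test functions\<close>

text \<open>The differentiability half of \<open>test_function\<close>, separated from the support
  condition.\<close>

definition smooth :: "(real \<Rightarrow> real) \<Rightarrow> bool" where
  "smooth \<phi> \<longleftrightarrow> (\<forall>n x. ((deriv ^^ n) \<phi>) differentiable (at x))"

lemma smooth_DERIV: "smooth \<phi> \<Longrightarrow> ((deriv ^^ n) \<phi> has_real_derivative (deriv ^^ Suc n) \<phi> x) (at x)"
  unfolding smooth_def by (simp add: DERIV_deriv_iff_real_differentiable)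

lemma smooth_funpow_deriv: "smooth \<phi> \<Longrightarrow> smooth ((deriv ^^ n) \<phi>)"
  unfolding smooth_def by (simp add: funpow_add[symmetric, THEN fun_cong, unfolded comp_def])

lemma smooth_deriv: "smooth \<phi> \<Longrightarrow> smooth (deriv \<phi>)"
  using smooth_funpow_deriv[of \<phi> 1] by simp

text \<open>The iterated derivatives of \<open>f\<close> never leave \<open>S\<close>. Smoothness of
  concrete functions is proved through such classes, without formulas for higher
  derivatives.\<close>

lemma smooth_closed_class:
  assumes S: "\<And>f. f \<in> S \<Longrightarrow> \<exists>f'\<in>S. \<forall>x. (f has_real_derivative f' x) (at x)" and f: "f \<in> S"
  shows "smooth f"
proof -
  have step: "deriv g \<in> S \<and> (\<forall>x. g differentiable (at x))" if g: "g \<in> S" for g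
  proof -
    obtain g' where g': "g' \<in> S" "\<And>x. (g has_real_derivative g' x) (at x)" using S[OF g] by blast
    have "deriv g = g'" using g'(2) by (auto intro: DERIV_imp_deriv)
    then show ?thesis using g' real_differentiable_def by blast
  qed
  have "(deriv ^^ n) f \<in> S" for n
    by (induction n) (auto simp: f step)
  then show ?thesis unfolding smooth_def using step by blast
qed

text \<open>By the Leibniz rule the derivative of a product of smooth functions is a sum of two such
  products; closing under sums therefore gives a class stable under differentiation.\<close>

inductive sum_of_products :: "(real \<Rightarrow> real) \<Rightarrow> bool" where
  prod: "smooth f \<Longrightarrow> smooth g \<Longrightarrow> sum_of_products (\<lambda>x. f x * g x)"
| add: "sum_of_products f \<Longrightarrow> sum_of_products g \<Longrightarrow> sum_of_products (\<lambda>x. f x + g x)"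

lemma smooth_sum_of_products: "sum_of_products f \<Longrightarrow> smooth f"
proof (rule smooth_closed_class[where S = "Collect sum_of_products"])
  fix f assume "f \<in> Collect sum_of_products"
  then have "sum_of_products f" by simp
  then show "\<exists>f'\<in>Collect sum_of_products. \<forall>x. (f has_real_derivative f' x) (at x)"
  proof induction
    case (prod f g)
    have "sum_of_products (\<lambda>x. f x * deriv g x + deriv f x * g x)"
      by (intro sum_of_products.intros prod smooth_deriv)
    moreover have "((\<lambda>x. f x * g x) has_real_derivative f x * deriv g x + deriv f x * g x) (at x)" for x
      using smooth_DERIV[OF prod(1), of 0 x] smooth_DERIV[OF prod(2), of 0 x]
      by (auto intro!: derivative_eq_intros)
    ultimately show ?case
      by (intro bexI[of _ "\<lambda>x. f x * deriv g x + deriv f x * g x"]) auto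
  next
    case (add f g)
    then obtain f' g' where "sum_of_products f'" "\<And>x. (f has_real_derivative f' x) (at x)"
      "sum_of_products g'" "\<And>x. (g has_real_derivative g' x) (at x)" by blast
    then show ?case
      by (intro bexI[of _ "\<lambda>x. f' x + g' x"]) (auto intro: sum_of_products.add DERIV_add)
  qed
qed simp

lemma smooth_mult: "smooth f \<Longrightarrow> smooth g \<Longrightarrow> smooth (\<lambda>x. f x * g x)"
  by (rule smooth_sum_of_products, rule sum_of_products.prod)

lemma smooth_const: "smooth (\<lambda>x. c)"
  by (rule smooth_closed_class[where S = "range (\<lambda>c x. c)"])
    (auto intro!: exI[of _ 0])

lemma smooth_add:
  assumes "smooth f" "smooth g" shows "smooth (\<lambda>x. f x + g x)"
proof -
  have "smooth (\<lambda>x. f x * 1 + g x * 1)"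
    by (rule smooth_sum_of_products) (intro sum_of_products.intros smooth_const assms)
  then show ?thesis by simp
qed

lemma smooth_affine:
  assumes "smooth f" shows "smooth (\<lambda>x. f (\<alpha> * x + \<beta>))"
\<comment> \<open>The chain rule produces a factor \<open>\<alpha>\<close>, hence the free constant
  \<open>k\<close> in the class.\<close>
proof (rule smooth_closed_class[where S = "{\<lambda>x. k * g (\<alpha> * x + \<beta>) | k g. smooth g}"])
  fix h assume "h \<in> {\<lambda>x. k * g (\<alpha> * x + \<beta>) | k g. smooth g}"
  then obtain k g where h: "h = (\<lambda>x. k * g (\<alpha> * x + \<beta>))" "smooth g" by blast
  have "(h has_real_derivative (k * \<alpha>) * deriv g (\<alpha> * x + \<beta>)) (at x)" for x
    unfolding h(1)
    by (rule derivative_eq_intros DERIV_chain2[OF smooth_DERIV[OF h(2), of 0, simplified]] refl | simp)+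
  then show "\<exists>f'\<in>{\<lambda>x. k * g (\<alpha> * x + \<beta>) | k g. smooth g}. \<forall>x. (h has_real_derivative f' x) (at x)"
    using smooth_deriv[OF h(2)] by (intro bexI[of _ "\<lambda>x. (k * \<alpha>) * deriv g (\<alpha> * x + \<beta>)"]) blast+
next
  have "(\<lambda>x. f (\<alpha> * x + \<beta>)) = (\<lambda>x. 1 * f (\<alpha> * x + \<beta>))" by simp
  then show "(\<lambda>x. f (\<alpha> * x + \<beta>)) \<in> {\<lambda>x. k * g (\<alpha> * x + \<beta>) | k g. smooth g}"
    using assms by blast
qed

section \<open>The flat function at the origin\<close>

lemma poly_times_exp_tendsto_0: "((\<lambda>u. poly p u * exp (- u)) \<longlongrightarrow> (0::real)) at_top"
proof -
  have "((\<lambda>u. \<Sum>i\<le>degree p. coeff p i * (u ^ i / exp u)) \<longlongrightarrow> (\<Sum>i\<le>degree p. coeff p i * 0)) at_top"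
    by (intro tendsto_sum tendsto_mult tendsto_const tendsto_power_div_exp_0)
  then show ?thesis
    by (simp add: poly_altdef exp_minus field_simps sum_divide_distrib)
qed

text \<open>The functions p(1/x) exp(-1/x), continued by zero, form a class closed under
  differentiation: differentiating replaces p by X^2 (p - p'). For p = 1 this is the classical
  smooth function that is flat at 0.\<close>

definition flat :: "real poly \<Rightarrow> real \<Rightarrow> real" where
  "flat p x = (if x > 0 then poly p (1 / x) * exp (- (1 / x)) else 0)"

lemma flat_DERIV:
  "(flat p has_real_derivative flat ([:0, 0, 1:] * (p - pderiv p)) x) (at x)"
proof -
  consider "x > 0" | "x < 0" | "x = 0" by linarith
  then show ?thesis
  proof cases
    case 1
    have D: "((\<lambda>x. poly p (1 / x) * exp (- (1 / x))) has_real_derivative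
        flat ([:0, 0, 1:] * (p - pderiv p)) x) (at x)"
      using 1 by (auto intro!: derivative_eq_intros DERIV_chain2[OF poly_DERIV]
          simp: flat_def field_simps power2_eq_square)
    have ev: "eventually (\<lambda>y. flat p y = poly p (1 / y) * exp (- (1 / y))) (nhds x)"
      using eventually_nhds_in_open[OF open_greaterThan, of x 0] 1
      by (auto elim!: eventually_mono simp: flat_def)
    show ?thesis
      by (rule DERIV_cong_ev[OF refl ev refl, THEN iffD2, OF D])
  next
    case 2
    have ev: "eventually (\<lambda>y. flat p y = 0) (nhds x)"
      using eventually_nhds_in_open[OF open_lessThan, of x 0] 2
      by (auto elim!: eventually_mono simp: flat_def)
    have D: "((\<lambda>y. 0) has_real_derivative flat ([:0, 0, 1:] * (p - pderiv p)) x) (at x)"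
      using 2 by (simp add: flat_def)
    show ?thesis
      by (rule DERIV_cong_ev[OF refl ev refl, THEN iffD2, OF D])
  next
    case 3
    have "((\<lambda>y. (flat p y - flat p 0) / (y - 0)) \<longlongrightarrow> 0) (at 0)"
    proof (rule filterlim_split_at)
      have "eventually (\<lambda>y. (flat p y - flat p 0) / (y - 0) = 0) (at_left 0)"
        by (auto simp: eventually_at_filter flat_def)
      then show "((\<lambda>y. (flat p y - flat p 0) / (y - 0)) \<longlongrightarrow> 0) (at_left 0)"
        by (rule tendsto_eventually)
      \<comment> \<open>The difference quotient at 0 divides by y, that is, it replaces p by X p;
        exponential decay then beats the polynomial.\<close>
      have "((\<lambda>y. poly ([:0, 1:] * p) (inverse y) * exp (- inverse y)) \<longlongrightarrow> 0) (at_right 0)"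
        by (rule filterlim_compose[OF poly_times_exp_tendsto_0 filterlim_inverse_at_top_right])
      moreover have eqR: "poly ([:0, 1:] * p) (inverse y) * exp (- inverse y)
          = (flat p y - flat p 0) / (y - 0)" if "y > 0" for y
        using that by (simp add: flat_def divide_inverse ac_simps)
      have "eventually (\<lambda>y. poly ([:0, 1:] * p) (inverse y) * exp (- inverse y)
          = (flat p y - flat p 0) / (y - 0)) (at_right 0)"
        by (rule eventually_mono[OF eventually_at_right_less eqR])
      ultimately show "((\<lambda>y. (flat p y - flat p 0) / (y - 0)) \<longlongrightarrow> 0) (at_right 0)"
        by (rule Lim_transform_eventually)
    qed
    then show ?thesis using 3 by (simp add: has_field_derivative_iff flat_def)
  qed
qed

lemma smooth_flat: "smooth (flat p)"
  by (rule smooth_closed_class[where S = "range flat"]) (use flat_DERIV in auto)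

text \<open>Compactness of the closed support inside the open interval gives the bounds
  \<open>c\<close> and \<open>d\<close>. Supports of sums, shifts and derivatives are easily tracked
  in this form.\<close>

lemma test_function_iff:
  "test_function a b \<phi> \<longleftrightarrow> smooth \<phi> \<and> (\<exists>c d. a < c \<and> d < b \<and> (\<forall>x. \<phi> x \<noteq> 0 \<longrightarrow> c \<le> x \<and> x \<le> d))"
proof
  assume t: "test_function a b \<phi>"
  let ?S = "closure {x. \<phi> x \<noteq> 0}"
  have S: "?S \<subseteq> {a<..<b}" and sm: "smooth \<phi>" using t unfolding test_function_def smooth_def by auto
  have "compact ?S"
    using S by (meson bounded_closed_interval bounded_subset closed_closure compact_eq_bounded_closed
        greaterThanLessThan_subseteq_atLeastAtMost_iff order_refl subset_trans)
  have "\<exists>c d. a < c \<and> d < b \<and> (\<forall>x. \<phi> x \<noteq> 0 \<longrightarrow> c \<le> x \<and> x \<le> d)"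
  proof (cases "?S = {}")
    case True
    then have "\<phi> x = 0" for x using closure_subset by blast
    \<comment> \<open>For the zero function any bound beyond the respective endpoint will do; the
      two need not be ordered.\<close>
    then show ?thesis by (intro exI[of _ "a + 1"] exI[of _ "b - 1"]) auto
  next
    case False
    obtain c where c: "c \<in> ?S" "\<And>x. x \<in> ?S \<Longrightarrow> c \<le> x" using compact_attains_inf[OF \<open>compact ?S\<close> False] by auto
    obtain d where d: "d \<in> ?S" "\<And>x. x \<in> ?S \<Longrightarrow> x \<le> d" using compact_attains_sup[OF \<open>compact ?S\<close> False] by auto
    show ?thesis
      using c d S closure_subset[of "{x. \<phi> x \<noteq> 0}"] by (intro exI[of _ c] exI[of _ d]) auto
  qed
  then show "smooth \<phi> \<and> (\<exists>c d. a < c \<and> d < b \<and> (\<forall>x. \<phi> x \<noteq> 0 \<longrightarrow> c \<le> x \<and> x \<le> d))" using sm by blast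
next
  assume "smooth \<phi> \<and> (\<exists>c d. a < c \<and> d < b \<and> (\<forall>x. \<phi> x \<noteq> 0 \<longrightarrow> c \<le> x \<and> x \<le> d))"
  then obtain c d where cd: "smooth \<phi>" "a < c" "d < b" "\<And>x. \<phi> x \<noteq> 0 \<Longrightarrow> c \<le> x \<and> x \<le> d" by blast
  have "closure {x. \<phi> x \<noteq> 0} \<subseteq> {c..d}" by (rule closure_minimal) (use cd in auto)
  then show "test_function a b \<phi>" using cd unfolding test_function_def smooth_def by force
qed

lemma test_function_smooth: "test_function a b \<phi> \<Longrightarrow> smooth \<phi>"
  unfolding test_function_iff by blast

lemma test_function_outside: "test_function a b \<phi> \<Longrightarrow> x \<notin> {a<..<b} \<Longrightarrow> \<phi> x = 0"
  unfolding test_function_iff by force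

lemma test_function_mono: "test_function c d \<phi> \<Longrightarrow> a \<le> c \<Longrightarrow> d \<le> b \<Longrightarrow> test_function a b \<phi>"
  unfolding test_function_iff by force

lemma test_function_deriv:
  assumes "test_function a b \<phi>" shows "test_function a b (deriv \<phi>)"
proof -
  obtain c d where cd: "smooth \<phi>" "a < c" "d < b" "\<And>x. \<phi> x \<noteq> 0 \<Longrightarrow> c \<le> x \<and> x \<le> d"
    using assms unfolding test_function_iff by blast
  have "deriv \<phi> x = 0" if "x \<notin> {c..d}" for x
  proof -
    have "open (- {c..d})" by auto
    then have "eventually (\<lambda>y. \<phi> y = 0) (nhds x)"
      using eventually_nhds_in_open[of "- {c..d}" x] that cd(4) by (auto elim!: eventually_mono)
    then have "(\<phi> has_real_derivative 0) (at x)"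
      using DERIV_cong_ev[OF refl _ refl, of \<phi> "\<lambda>y. 0" x 0] by auto
    then show ?thesis by (rule DERIV_imp_deriv)
  qed
  then show ?thesis
    unfolding test_function_iff using smooth_deriv[OF cd(1)] cd(2,3)
    by (intro conjI exI[of _ c] exI[of _ d]) auto
qed

lemma test_function_funpow_deriv: "test_function a b \<phi> \<Longrightarrow> test_function a b ((deriv ^^ n) \<phi>)"
  by (induction n) (auto simp: test_function_deriv)

lemma test_function_continuous: "test_function a b \<phi> \<Longrightarrow> continuous_on S \<phi>"
  using smooth_DERIV[OF test_function_smooth, of a b \<phi> 0]
  by (metis DERIV_isCont continuous_at_imp_continuous_on funpow_0)

lemma test_function_bounded:
  assumes "test_function a b \<phi>" obtains M where "\<And>x. \<bar>\<phi> x\<bar> \<le> M"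
proof -
  have "compact (\<phi> ` {a..b})"
    by (intro compact_continuous_image test_function_continuous[OF assms]) auto
  then obtain M where "\<forall>y\<in>\<phi> ` {a..b}. norm y \<le> M"
    using compact_imp_bounded[of "\<phi> ` {a..b}"] unfolding bounded_iff by blast
  then have M: "\<bar>\<phi> x\<bar> \<le> M" if "x \<in> {a..b}" for x using that by auto
  have "\<bar>\<phi> x\<bar> \<le> max M 0" for x
    using M[of x] test_function_outside[OF assms, of x] by (cases "x \<in> {a..b}") auto
  then show thesis by (rule that)
qed

lemma test_function_borel: "test_function a b \<phi> \<Longrightarrow> \<phi> \<in> borel_measurable borel"
  by (intro borel_measurable_continuous_onI test_function_continuous)

lemma integrable_bounded_scaleR:
  fixes g :: "real \<Rightarrow> 'a::euclidean_space"
  assumes g: "integrable lebesgue g" and \<phi>: "\<phi> \<in> borel_measurable lebesgue" "\<And>x. \<bar>\<phi> x\<bar> \<le> M"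
  shows "integrable lebesgue (\<lambda>x. \<phi> x *\<^sub>R g x)"
proof (rule Bochner_Integration.integrable_bound)
  show "integrable lebesgue (\<lambda>x. M * norm (g x))" using g by simp
  show "(\<lambda>x. \<phi> x *\<^sub>R g x) \<in> borel_measurable lebesgue" using g \<phi> by measurable
  show "AE x in lebesgue. norm (\<phi> x *\<^sub>R g x) \<le> norm (M * norm (g x))"
    using \<phi>(2) by (auto intro!: mult_right_mono AE_I2 simp: abs_mult intro: order_trans[OF _ abs_ge_self])
qed

lemma integrable_test_function:
  fixes g :: "real \<Rightarrow> 'a::euclidean_space"
  assumes "test_function a b \<phi>" "integrable lebesgue g"
  shows "integrable lebesgue (\<lambda>x. \<phi> x *\<^sub>R g x)"
proof -
  obtain M where "\<And>x. \<bar>\<phi> x\<bar> \<le> M" using test_function_bounded[OF assms(1)] by blast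
  then show ?thesis
    using test_function_borel[OF assms(1)] by (intro integrable_bounded_scaleR[OF assms(2)])
      (auto intro: measurable_completion)
qed

text \<open>A product of two rescaled copies of exp(-1/u). The subtracted 1 in the arguments keeps
  the support of the n-th function at distance 1/(n+1) from \<open>c\<close> and \<open>d\<close>,
  so it is admissible even if \<open>c = a\<close>; as n grows the arguments tend to infinity inside
  the interval, where exp(-1/u) tends to 1.\<close>

lemma test_function_approx_indicator:
  assumes "a \<le> c" "d \<le> b"
  obtains \<psi> :: "nat \<Rightarrow> real \<Rightarrow> real" where "\<And>n. test_function a b (\<psi> n)" "\<And>n x. \<bar>\<psi> n x\<bar> \<le> 1"
    "\<And>x. (\<lambda>n. \<psi> n x) \<longlonglongrightarrow> indicator {c<..<d} x"
proof -
  define E where "E = flat 1"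
  define \<psi> where "\<psi> n x = E (real (Suc n) * x + (- real (Suc n) * c - 1)) * E ((- real (Suc n)) * x + (real (Suc n) * d - 1))" for n x
  have E: "0 \<le> E x" "E x \<le> 1" for x by (auto simp: E_def flat_def)
  have lim: "(\<lambda>n. E (real (Suc n) * t - 1)) \<longlonglongrightarrow> (if t > 0 then 1 else 0)" for t
  proof (cases "t > 0")
    case True
    have "filterlim (\<lambda>n. - 1 + t * real (Suc n)) at_top sequentially"
      by (intro filterlim_tendsto_add_at_top[OF tendsto_const]
          filterlim_tendsto_pos_mult_at_top[OF tendsto_const True]
          filterlim_compose[OF filterlim_real_sequentially filterlim_Suc])
    then have top: "filterlim (\<lambda>n. real (Suc n) * t - 1) at_top sequentially"
      by (simp add: mult.commute del: of_nat_Suc)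
    have "((\<lambda>u::real. exp (- (1 / u))) \<longlongrightarrow> exp (- 0)) at_top"
      by (intro tendsto_intros tendsto_divide_0[OF tendsto_const] filterlim_at_top_imp_at_infinity filterlim_ident)
    then have "(\<lambda>n. exp (- (1 / (real (Suc n) * t - 1)))) \<longlonglongrightarrow> 1"
      using filterlim_compose[OF _ top] by simp
    moreover have "eventually (\<lambda>n. exp (- (1 / (real (Suc n) * t - 1))) = E (real (Suc n) * t - 1)) sequentially"
      using filterlim_at_top_dense[THEN iffD1, OF top, rule_format, of 0]
      by (auto elim!: eventually_mono simp: E_def flat_def)
    ultimately show ?thesis using True tendsto_cong by fastforce
  next
    case False
    then have "real (Suc n) * t - 1 \<le> 0" for n
      by (smt (verit) mult_nonneg_nonpos of_nat_0_le_iff)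
    then have "E (real (Suc n) * t - 1) = 0" for n by (simp add: E_def flat_def not_less del: of_nat_Suc)
    then show ?thesis using False by simp
  qed
  have supp: "c + 1 / real (Suc n) \<le> x \<and> x \<le> d - 1 / real (Suc n)" if "\<psi> n x \<noteq> 0" for n x
  proof -
    have "real (Suc n) * x + (- real (Suc n) * c - 1) > 0" "(- real (Suc n)) * x + (real (Suc n) * d - 1) > 0"
      using that unfolding \<psi>_def E_def flat_def by (auto split: if_splits simp del: of_nat_Suc)
    then have "1 \<le> real (Suc n) * (x - c)" "1 \<le> real (Suc n) * (d - x)"
      by (simp_all add: algebra_simps del: of_nat_Suc)
    then have "1 / real (Suc n) \<le> x - c" "1 / real (Suc n) \<le> d - x"
      by (simp_all add: divide_le_eq mult.commute del: of_nat_Suc)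
    then show ?thesis by linarith
  qed
  show thesis
  proof (rule that[of \<psi>])
    fix n
    have "smooth (\<psi> n)" unfolding \<psi>_def E_def by (intro smooth_mult smooth_affine smooth_flat)
    moreover have "0 < 1 / real (Suc n)" by simp
    then have "a < c + 1 / real (Suc n)" "d - 1 / real (Suc n) < b" using assms by linarith+
    ultimately show "test_function a b (\<psi> n)" unfolding test_function_iff using supp by blast
    show "\<bar>\<psi> n x\<bar> \<le> 1" for x unfolding \<psi>_def abs_mult using E by (intro mult_le_one) auto
    fix x
    have "(\<lambda>n. E (real (Suc n) * (x - c) - 1) * E (real (Suc n) * (d - x) - 1))
        \<longlonglongrightarrow> (if x - c > 0 then 1 else 0) * (if d - x > 0 then 1 else 0)"
      by (intro tendsto_mult lim)
    moreover have "(if x - c > 0 then 1 else 0) * (if d - x > 0 then 1 else 0) = (indicator {c<..<d} x :: real)"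
      by (auto simp: indicator_def)
    moreover have "(\<lambda>n. E (real (Suc n) * (x - c) - 1) * E (real (Suc n) * (d - x) - 1)) = (\<lambda>n. \<psi> n x)"
      unfolding \<psi>_def by (rule ext) (simp add: algebra_simps del: of_nat_Suc)
    ultimately show "(\<lambda>n. \<psi> n x) \<longlonglongrightarrow> indicator {c<..<d} x" by simp
  qed
qed

lemma sigma_finite_lebesgue: "sigma_finite_measure (lebesgue :: real measure)"
proof
  have U: "x \<in> (\<Union>n::nat. {- real n..real n})" for x :: real
  proof -
    obtain n where "\<bar>x\<bar> \<le> real n" using real_arch_simple by blast
    then show ?thesis by (auto intro!: exI[of _ n])
  qed
  show "\<exists>A :: real set set. countable A \<and> A \<subseteq> sets lebesgue \<and> \<Union> A = space lebesgue \<and>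
      (\<forall>a\<in>A. emeasure lebesgue a \<noteq> \<infinity>)"
    by (intro exI[of _ "range (\<lambda>n::nat. {- real n..real n})"])
      (use U in \<open>auto simp: emeasure_completion\<close>)
qed

text \<open>The Borel sets over which \<open>h\<close> integrates to zero contain the intervals and
  are closed under countable disjoint unions and, by the condition on the whole line, under
  complements, so the pi-lambda theorem reaches all of them. Uniqueness of densities then compares
  \<open>h\<close> with 0.\<close>

lemma integral_interval_eq_0_imp_AE:
  fixes h :: "real \<Rightarrow> 'a::euclidean_space"
  assumes h: "integrable lebesgue h"
    and 0: "\<And>c d. (LINT x|lebesgue. indicator {c<..<d} x *\<^sub>R h x) = 0"
    and UNIV: "(LINT x|lebesgue. h x) = 0"
  shows "AE x in lebesgue. h x = 0"
proof -
  have si: "set_integrable lebesgue A h" if "A \<in> sets lebesgue" for A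
    using h that unfolding set_integrable_def by (rule integrable_mult_indicator[rotated])
  have sets_borel_box: "sets borel = sigma_sets UNIV (range (\<lambda>(c, d). box c (d::real)))"
    by (subst borel_eq_box) (rule sets_measure_of, simp)
  have borel: "(LINT x:A|lebesgue. h x) = 0" if "A \<in> sigma_sets UNIV (range (\<lambda>(c, d). box c (d::real)))" for A
  proof -
    have meas: "B \<in> sets lebesgue" if "B \<in> sigma_sets UNIV (range (\<lambda>(c, d). box c (d::real)))" for B
    proof -
      have "B \<in> sets borel"
        using that unfolding sets_borel_box .
      then show ?thesis by simp
    qed
    have "Int_stable (range (\<lambda>(c, d). box c (d::real)))"
    proof (rule Int_stableI_image)
      fix x y :: "real \<times> real"
      show "\<exists>z\<in>UNIV. (case x of (c, d) \<Rightarrow> box c d) \<inter> (case y of (c, d) \<Rightarrow> box c d)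
          = (case z of (c, d) \<Rightarrow> box c d)"
        by (cases x, cases y)
          (auto intro!: bexI[of _ "(max (fst x) (fst y), min (snd x) (snd y))"])
    qed
    then show ?thesis
      using _ that
    proof (rule sigma_sets_induct_disjoint[where P = "\<lambda>A. (LINT x:A|lebesgue. h x) = 0"])
      show "range (\<lambda>(c, d). box c (d::real)) \<subseteq> Pow UNIV" by simp
      show "(LINT x:A|lebesgue. h x) = 0" if "A \<in> range (\<lambda>(c, d). box c (d::real))" for A
        using that 0 unfolding set_lebesgue_integral_def by (auto simp: box_real)
      show "(LINT x:{}|lebesgue. h x) = 0" by (simp add: set_lebesgue_integral_def)
    next
      fix A assume A: "A \<in> sigma_sets UNIV (range (\<lambda>(c, d). box c (d::real)))" "(LINT x:A|lebesgue. h x) = 0"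
      have "(LINT x:A \<union> (UNIV - A)|lebesgue. h x) = (LINT x:A|lebesgue. h x) + (LINT x:UNIV - A|lebesgue. h x)"
        by (rule set_integral_Un) (use meas[OF A(1)] in \<open>auto intro!: si sets.Diff\<close>)
      moreover have "(LINT x:A \<union> (UNIV - A)|lebesgue. h x) = 0"
        using UNIV unfolding set_lebesgue_integral_def by simp
      ultimately show "(LINT x:UNIV - A|lebesgue. h x) = 0" using A(2) by simp
    next
      fix A :: "nat \<Rightarrow> real set"
      assume A: "disjoint_family A" "range A \<subseteq> sigma_sets UNIV (range (\<lambda>(c, d). box c (d::real)))"
        "\<And>i. (LINT x:A i|lebesgue. h x) = 0"
      have "A i \<in> sets lebesgue" for i using A(2) meas by blast
      then have "(LINT x:(\<Union>i. A i)|lebesgue. h x) = (\<Sum>i. (LINT x:A i|lebesgue. h x))"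
        using A(1) by (intro lebesgue_integral_countable_add si) (auto simp: disjoint_family_on_def)
      then show "(LINT x:\<Union> (range A)|lebesgue. h x) = 0" using A(3) by simp
    qed
  qed
  \<comment> \<open>A Lebesgue set differs from a Borel set by a null set, which the integral
    ignores.\<close>
  have "(LINT x:A|lebesgue. h x) = 0" if A: "A \<in> sets lebesgue" for A
  proof -
    obtain S N N' where S: "A = S \<union> N" "N \<subseteq> N'" "N' \<in> null_sets lborel" "S \<in> sets lborel"
      using A by (rule sets_completionE)
    have "AE x in lborel. x \<notin> N'" using S(3) by (rule AE_not_in)
    then have "AE x in lebesgue. x \<notin> N'" by (simp add: AE_completion_iff)
    then have "AE x in lebesgue. indicator A x *\<^sub>R h x = indicator S x *\<^sub>R h x"
      by eventually_elim (use S in \<open>auto simp: indicator_def\<close>)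
    then have "(LINT x:A|lebesgue. h x) = (LINT x:S|lebesgue. h x)"
      unfolding set_lebesgue_integral_def by (rule integral_lebesgue_cong_AE(2))
    moreover have "S \<in> sigma_sets UNIV (range (\<lambda>(c, d). box c (d::real)))"
      using S(4) unfolding sets_lborel sets_borel_box .
    ultimately show ?thesis using borel by simp
  qed
  then show ?thesis
    by (intro sigma_finite_measure.density_unique_banach[of lebesgue h "\<lambda>x. 0"])
      (use h in \<open>auto simp: set_lebesgue_integral_def sigma_finite_lebesgue\<close>)
qed

text \<open>The fundamental lemma of the calculus of variations. Dominated convergence along test
  functions tending to an indicator gives vanishing integrals over all subintervals; cutting
  \<open>h\<close> off outside the interval then covers arbitrary intervals.\<close>

lemma fundamental_lemma:
  fixes h :: "real \<Rightarrow> 'a::euclidean_space"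
  assumes h: "integrable lebesgue h"
    and 0: "\<And>\<phi>. test_function a b \<phi> \<Longrightarrow> (LINT x|lebesgue. \<phi> x *\<^sub>R h x) = 0"
  shows "AE x in lebesgue. x \<in> {a<..<b} \<longrightarrow> h x = 0"
proof -
  have sub: "(LINT x|lebesgue. indicator {c<..<d} x *\<^sub>R h x) = 0" if cd: "a \<le> c" "d \<le> b" for c d
  proof -
    obtain \<psi> :: "nat \<Rightarrow> real \<Rightarrow> real" where \<psi>: "\<And>n. test_function a b (\<psi> n)" "\<And>n x. \<bar>\<psi> n x\<bar> \<le> 1"
      "\<And>x. (\<lambda>n. \<psi> n x) \<longlonglongrightarrow> indicator {c<..<d} x"
      using test_function_approx_indicator[OF cd] by blast
    have [measurable]: "h \<in> borel_measurable lebesgue"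
      using h by (rule borel_measurable_integrable)
    have "(\<lambda>n. LINT x|lebesgue. \<psi> n x *\<^sub>R h x) \<longlonglongrightarrow> (LINT x|lebesgue. indicator {c<..<d} x *\<^sub>R h x)"
    proof (rule integral_dominated_convergence[where w = "\<lambda>x. norm (h x)"])
      show "(\<lambda>x. indicator {c<..<d} x *\<^sub>R h x) \<in> borel_measurable lebesgue"
        using h by (intro borel_measurable_scaleR borel_measurable_indicator) auto
      show "(\<lambda>x. \<psi> n x *\<^sub>R h x) \<in> borel_measurable lebesgue" for n
        using integrable_test_function[OF \<psi>(1) h, of n] by auto
      show "integrable lebesgue (\<lambda>x. norm (h x))" using h by simp
      show "AE x in lebesgue. (\<lambda>n. \<psi> n x *\<^sub>R h x) \<longlonglongrightarrow> indicator {c<..<d} x *\<^sub>R h x"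
        by (intro AE_I2 tendsto_scaleR \<psi>(3) tendsto_const)
      show "AE x in lebesgue. norm (\<psi> n x *\<^sub>R h x) \<le> norm (h x)" for n
        using \<psi>(2) by (intro AE_I2) (simp add: mult_left_le_one_le)
    qed
    then show ?thesis using 0[OF \<psi>(1)] by (simp add: LIMSEQ_const_iff)
  qed
  have "AE x in lebesgue. indicator {a<..<b} x *\<^sub>R h x = 0"
  proof (rule integral_interval_eq_0_imp_AE)
    show "integrable lebesgue (\<lambda>x. indicator {a<..<b} x *\<^sub>R h x)"
      using h by (intro integrable_mult_indicator) auto
    fix c d
    have "(LINT x|lebesgue. indicator {c<..<d} x *\<^sub>R indicator {a<..<b} x *\<^sub>R h x)
        = (LINT x|lebesgue. indicator {max a c<..<min b d} x *\<^sub>R h x)"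
      by (rule Bochner_Integration.integral_cong) (auto simp: indicator_def)
    then show "(LINT x|lebesgue. indicator {c<..<d} x *\<^sub>R indicator {a<..<b} x *\<^sub>R h x) = 0"
      using sub[of "max a c" "min b d"] by simp
    show "(LINT x|lebesgue. indicator {a<..<b} x *\<^sub>R h x) = 0" using sub by simp
  qed
  then show ?thesis by eventually_elim (auto simp: indicator_def)
qed

section \<open>Weak derivatives of order one\<close>

lemma AE_lebesgue_lborel: "(AE x in lborel. P x) \<Longrightarrow> (AE x in lebesgue. P x)"
  by (simp add: AE_completion_iff)

text \<open>Fubini below asks for joint measurability, which is obtained for Borel functions; a
  Lebesgue measurable function becomes one after a change on a null set, coordinate by
  coordinate.\<close>

lemma lebesgue_ex_borel_representative:
  fixes f :: "real \<Rightarrow> 'a::euclidean_space"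
  assumes "f \<in> borel_measurable lebesgue"
  obtains g where "g \<in> borel_measurable borel" "AE x in lebesgue. f x = g x"
proof -
  have "\<exists>g\<in>borel_measurable lborel. AE x in lborel. inner (f x) i = g x" for i
    using assms by (intro completion_ex_borel_measurable_real) auto
  then obtain G where G: "\<And>i. G i \<in> borel_measurable lborel" "\<And>i. AE x in lborel. inner (f x) i = G i x"
    by metis
  have "AE x in lborel. \<forall>i\<in>Basis. inner (f x) i = G i x"
    using G(2) by (intro AE_finite_allI) auto
  then have "AE x in lborel. f x = (\<Sum>i\<in>Basis. G i x *\<^sub>R i)"
    by eventually_elim (metis (mono_tags, lifting) euclidean_representation sum.cong)
  moreover have "(\<lambda>x. \<Sum>i\<in>Basis. G i x *\<^sub>R i) \<in> borel_measurable borel"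
    using G(1) by (intro borel_measurable_sum borel_measurable_scaleR) auto
  ultimately show thesis using that AE_lebesgue_lborel by blast
qed

text \<open>For \<open>t \<le> a\<close> the interval is empty and the value is 0, without the sign
  change of an oriented integral.\<close>

definition primitive :: "real \<Rightarrow> (real \<Rightarrow> 'a::euclidean_space) \<Rightarrow> real \<Rightarrow> 'a" where
  "primitive a g t = (LINT x|lebesgue. indicator {a<..<t} x *\<^sub>R g x)"

lemma emeasure_lebesgue_bounded:
  fixes A :: "real set"
  shows "bounded A \<Longrightarrow> A \<in> sets borel \<Longrightarrow> emeasure lebesgue A < \<infinity>"
  using emeasure_bounded_finite[of A] by (simp add: emeasure_completion)

lemma integrable_indicator_lebesgue:
  fixes g :: "real \<Rightarrow> 'a::euclidean_space"
  shows "integrable lebesgue g \<Longrightarrow> A \<in> sets lebesgue \<Longrightarrow> integrable lebesgue (\<lambda>x. indicator A x *\<^sub>R g x)"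
  by (rule integrable_mult_indicator)

lemma primitive_borel_measurable:
  fixes g :: "real \<Rightarrow> 'a::euclidean_space"
  assumes "g \<in> borel_measurable lebesgue"
  shows "primitive a g \<in> borel_measurable borel"
proof -
  obtain g' where g': "g' \<in> borel_measurable borel" "AE x in lebesgue. g x = g' x"
    using lebesgue_ex_borel_representative[OF assms] by blast
  note [measurable] = g'(1)
  have "primitive a g t = (LINT x|lborel. indicator {a<..<t} x *\<^sub>R g' x)" for t
  proof -
    have "primitive a g t = (LINT x|lebesgue. indicator {a<..<t} x *\<^sub>R g' x)"
      unfolding primitive_def
      by (rule integral_lebesgue_cong_AE(2)) (use g'(2) in \<open>eventually_elim, simp\<close>)
    also have "\<dots> = (LINT x|lborel. indicator {a<..<t} x *\<^sub>R g' x)"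
      by (rule integral_completion) measurable
    finally show ?thesis .
  qed
  moreover have "(\<lambda>t. LINT x|lborel. indicator {a<..<t} x *\<^sub>R g' x) \<in> borel_measurable borel"
  proof (rule lborel.borel_measurable_lebesgue_integral)
    have "(\<lambda>p. (if a < snd p \<and> snd p < fst p then 1 else 0) *\<^sub>R g' (snd p)) \<in> borel_measurable (borel \<Otimes>\<^sub>M lborel)"
      by measurable
    also have "(\<lambda>p. (if a < snd p \<and> snd p < fst p then 1 else 0) *\<^sub>R g' (snd p))
        = (\<lambda>(t, x). indicator {a<..<t} x *\<^sub>R g' x)"
      by (auto simp: indicator_def fun_eq_iff)
    finally show "(\<lambda>(t, x). indicator {a<..<t} x *\<^sub>R g' x) \<in> borel_measurable (borel \<Otimes>\<^sub>M lborel)" .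
  qed
  ultimately show ?thesis by (metis (no_types, lifting) ext)
qed

lemma test_function_integral_deriv:
  assumes \<phi>: "test_function a b \<phi>" and x: "a < x" "x < b"
  shows "(LINT t|lborel. indicator {x<..<b} t * deriv \<phi> t) = - \<phi> x"
proof -
  have "(LINT t|lborel. indicator {x..b} t *\<^sub>R deriv \<phi> t) = \<phi> b - \<phi> x"
  proof (rule integral_FTC_atLeastAtMost)
    show "x \<le> b" using x by simp
    show "(\<phi> has_vector_derivative deriv \<phi> t) (at t within {x..b})" for t
      using smooth_DERIV[OF test_function_smooth[OF \<phi>], of 0 t]
      by (simp add: has_real_derivative_iff_has_vector_derivative[symmetric] has_field_derivative_at_within)
    show "continuous_on {x..b} (deriv \<phi>)"
      by (rule test_function_continuous[OF test_function_deriv[OF \<phi>]])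
  qed
  moreover have "\<phi> b = 0" by (rule test_function_outside[OF \<phi>]) simp
  moreover have "(LINT t|lborel. indicator {x<..<b} t * deriv \<phi> t) = (LINT t|lborel. indicator {x..b} t *\<^sub>R deriv \<phi> t)"
  proof (rule integral_cong_AE)
    have [measurable]: "deriv \<phi> \<in> borel_measurable borel"
      by (rule test_function_borel[OF test_function_deriv[OF \<phi>]])
    show "(\<lambda>t. indicator {x<..<b} t * deriv \<phi> t) \<in> borel_measurable lborel" by measurable
    show "(\<lambda>t. indicator {x..b} t *\<^sub>R deriv \<phi> t) \<in> borel_measurable lborel" by measurable
    have "AE t in lborel. t \<noteq> x" "AE t in lborel. t \<noteq> b" by (rule AE_lborel_singleton)+
    then show "AE t in lborel. indicator {x<..<b} t * deriv \<phi> t = indicator {x..b} t *\<^sub>R deriv \<phi> t"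
      by eventually_elim (auto simp: indicator_def)
  qed
  ultimately show ?thesis by simp
qed

text \<open>Fubini over the triangle a < x < t < b: integrating \<open>deriv \<phi>\<close> in t
  from x to b leaves \<open>- \<phi> x\<close>, because \<open>\<phi>\<close> vanishes at b.\<close>

lemma primitive_by_parts:
  fixes g :: "real \<Rightarrow> 'a::euclidean_space"
  assumes g: "integrable lebesgue g" and \<phi>: "test_function a b \<phi>"
  shows "(LINT t|lebesgue. deriv \<phi> t *\<^sub>R (if a < t \<and> t < b then primitive a g t else 0))
    = - (LINT x|lebesgue. \<phi> x *\<^sub>R g x)"
proof -
  have gm: "g \<in> borel_measurable lebesgue" using g by (rule borel_measurable_integrable)
  obtain g' where g': "g' \<in> borel_measurable borel" "AE x in lebesgue. g x = g' x"
    using lebesgue_ex_borel_representative[OF gm] by blast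
  note [measurable] = g'(1)
  have [measurable]: "deriv \<phi> \<in> borel_measurable borel" "\<phi> \<in> borel_measurable borel"
    using test_function_borel[OF test_function_deriv[OF \<phi>]] test_function_borel[OF \<phi>] .
  have [measurable]: "primitive a g \<in> borel_measurable borel" by (rule primitive_borel_measurable[OF gm])
  have ig': "integrable lborel g'"
    using integral_lebesgue_cong_AE(1)[OF g'(2)] g integrable_completion[of g' lborel] by simp
  obtain M where M: "\<And>x. \<bar>deriv \<phi> x\<bar> \<le> M" using test_function_bounded[OF test_function_deriv[OF \<phi>]] by blast
  have prim: "primitive a g t = (LINT x|lborel. indicator {a<..<t} x *\<^sub>R g' x)" for t
  proof -
    have "primitive a g t = (LINT x|lebesgue. indicator {a<..<t} x *\<^sub>R g' x)"
      unfolding primitive_def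
      by (rule integral_lebesgue_cong_AE(2)) (use g'(2) in \<open>eventually_elim, simp\<close>)
    also have "\<dots> = (LINT x|lborel. indicator {a<..<t} x *\<^sub>R g' x)"
      by (rule integral_completion) measurable
    finally show ?thesis .
  qed
  \<comment> \<open>The indicator of the triangle is part of \<open>F\<close>, so both iterated
    integrals run over the whole line. A bound M for \<open>deriv \<phi>\<close> dominates
    \<open>F\<close> by an integrable product of a function of t and a function of x.\<close>
  define F where "F t x = ((if a < x \<and> x < t \<and> t < b then 1 else 0) * deriv \<phi> t) *\<^sub>R g' x" for t x
  have Fm: "case_prod F \<in> borel_measurable (lborel \<Otimes>\<^sub>M lborel)"
    unfolding F_def case_prod_beta by measurable
  have int: "integrable (lborel \<Otimes>\<^sub>M lborel) (case_prod F)"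
  proof (rule lborel_pair.Fubini_integrable[OF Fm])
    have nF: "norm (F t x) \<le> (indicator {a<..<b} t * M) * norm (g' x)" for t x
      unfolding F_def using M[of t] by (auto simp: indicator_def abs_mult intro!: mult_right_mono)
    have 1: "integrable lborel (\<lambda>x. F t x)" for t
    proof (rule Bochner_Integration.integrable_bound)
      show "integrable lborel (\<lambda>x. (indicator {a<..<b} t * M) * norm (g' x))" using ig' by simp
      show "F t \<in> borel_measurable lborel" unfolding F_def by measurable
      show "AE x in lborel. norm (F t x) \<le> norm ((indicator {a<..<b} t * M) * norm (g' x))"
        using nF by (intro AE_I2) (metis abs_ge_self order_trans real_norm_def)
    qed
    then show "AE x in lborel. integrable lborel (\<lambda>y. case (x, y) of (x, y) \<Rightarrow> F x y)" by simp
    show "integrable lborel (\<lambda>x. LINT y|lborel. norm (case (x, y) of (x, y) \<Rightarrow> F x y))"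
    proof (rule Bochner_Integration.integrable_bound)
      show "integrable lborel (\<lambda>t. indicator {a<..<b} t *\<^sub>R (M * (LINT x|lborel. norm (g' x))))"
        using emeasure_bounded_finite[of "{a<..<b}"] by (intro integrable_indicator) simp_all
      show "(\<lambda>x. LINT y|lborel. norm (case (x, y) of (x, y) \<Rightarrow> F x y)) \<in> borel_measurable lborel"
        using Fm by measurable
      show "AE t in lborel. norm (LINT x|lborel. norm (case (t, x) of (x, y) \<Rightarrow> F x y))
          \<le> norm (indicator {a<..<b} t *\<^sub>R (M * (LINT x|lborel. norm (g' x))))"
      proof (rule AE_I2)
        fix t
        have "(LINT x|lborel. norm (F t x)) \<le> (LINT x|lborel. (indicator {a<..<b} t * M) * norm (g' x))"
          using nF ig' by (intro integral_mono integrable_norm 1) auto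
        then show "norm (LINT x|lborel. norm (case (t, x) of (x, y) \<Rightarrow> F x y))
          \<le> norm (indicator {a<..<b} t *\<^sub>R (M * (LINT x|lborel. norm (g' x))))"
          by (simp add: mult.assoc)
      qed
    qed
  qed
  have "(LINT t|lebesgue. deriv \<phi> t *\<^sub>R (if a < t \<and> t < b then primitive a g t else 0))
      = (LINT t|lborel. deriv \<phi> t *\<^sub>R (if a < t \<and> t < b then primitive a g t else 0))"
    by (rule integral_completion) measurable
  also have "\<dots> = (LINT t|lborel. LINT x|lborel. F t x)"
  proof (rule Bochner_Integration.integral_cong)
    fix t
    have "F t = (\<lambda>x. (indicator {..<b} t * deriv \<phi> t) *\<^sub>R (indicator {a<..<t} x *\<^sub>R g' x))"
      unfolding F_def by (auto simp: indicator_def fun_eq_iff)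
    moreover have "integrable lborel (\<lambda>x. indicator {a<..<t} x *\<^sub>R g' x)"
      using ig' by (intro integrable_mult_indicator) auto
    ultimately have "(LINT x|lborel. F t x) = (indicator {..<b} t * deriv \<phi> t) *\<^sub>R primitive a g t"
      by (simp add: prim del: scaleR_scaleR)
    moreover have "primitive a g t = 0" if "\<not> a < t"
    proof -
      have "{a<..<t} = {}" using that by auto
      then show ?thesis unfolding primitive_def by simp
    qed
    ultimately show "deriv \<phi> t *\<^sub>R (if a < t \<and> t < b then primitive a g t else 0) = (LINT x|lborel. F t x)"
      by (auto simp: indicator_def)
  qed simp
  also have "\<dots> = (LINT x|lborel. LINT t|lborel. F t x)"
    by (rule lborel_pair.Fubini_integral[OF int, symmetric])
  also have "\<dots> = (LINT x|lborel. - (\<phi> x *\<^sub>R g' x))"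
  proof (rule Bochner_Integration.integral_cong)
    fix x
    show "(LINT t|lborel. F t x) = - (\<phi> x *\<^sub>R g' x)"
    proof (cases "a < x \<and> x < b")
      case True
      have "(\<lambda>t. F t x) = (\<lambda>t. (indicator {x<..<b} t * deriv \<phi> t) *\<^sub>R g' x)"
        unfolding F_def using True by (auto simp: indicator_def fun_eq_iff)
      moreover have "integrable lborel (\<lambda>t. indicator {x<..<b} t * deriv \<phi> t)"
      proof (rule Bochner_Integration.integrable_bound)
        show "integrable lborel (\<lambda>t. indicator {x<..<b} t *\<^sub>R M)"
          using emeasure_bounded_finite[of "{x<..<b}"] by (intro integrable_indicator) simp_all
        show "AE t in lborel. norm (indicator {x<..<b} t * deriv \<phi> t) \<le> norm (indicator {x<..<b} t *\<^sub>R M)"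
          using M by (intro AE_I2) (auto simp: indicator_def intro: order_trans[OF _ abs_ge_self])
      qed measurable
      ultimately show ?thesis using test_function_integral_deriv[OF \<phi>, of x] True by simp
    next
      case False
      then have "(\<lambda>t. F t x) = (\<lambda>t. 0)" unfolding F_def by auto
      moreover have "\<phi> x = 0" using False by (intro test_function_outside[OF \<phi>]) auto
      ultimately show ?thesis by simp
    qed
  qed simp
  also have "\<dots> = - (LINT x|lborel. \<phi> x *\<^sub>R g' x)" by simp
  also have "(LINT x|lborel. \<phi> x *\<^sub>R g' x) = (LINT x|lebesgue. \<phi> x *\<^sub>R g' x)"
    by (rule integral_completion[symmetric]) measurable
  also have "\<dots> = (LINT x|lebesgue. \<phi> x *\<^sub>R g x)"
    by (rule integral_lebesgue_cong_AE(2)) (use g'(2) in \<open>eventually_elim, simp\<close>)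
  finally show ?thesis .
qed

text \<open>The integral from \<open>a\<close> vanishes left of the support of
  \<open>\<zeta>\<close>, and right of it as well because the total integral is zero; so it is again
  compactly supported.\<close>

lemma test_function_antiderivative:
  assumes \<zeta>: "test_function a b \<zeta>" and 0: "(LINT x|lebesgue. \<zeta> x) = 0"
  obtains \<Phi> where "test_function a b \<Phi>" "deriv \<Phi> = \<zeta>"
proof -
  obtain c d where cd: "smooth \<zeta>" "a < c" "d < b" "\<And>x. \<zeta> x \<noteq> 0 \<Longrightarrow> c \<le> x \<and> x \<le> d"
    using \<zeta> unfolding test_function_iff by blast
  define \<Phi> where "\<Phi> x = integral {a..x} \<zeta>" for x
  have cont: "continuous_on S \<zeta>" for S by (rule test_function_continuous[OF \<zeta>])
  have \<Phi>0: "\<Phi> x = 0" if "x < c" for x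
  proof -
    have "\<Phi> x = integral {a..x} (\<lambda>x. 0)"
      unfolding \<Phi>_def by (rule integral_cong) (use cd(4) that in force)
    then show ?thesis by simp
  qed
  have D: "(\<Phi> has_real_derivative \<zeta> x) (at x)" for x
  proof (cases "x < c")
    case True
    have "eventually (\<lambda>y. \<Phi> y = 0) (nhds x)"
      using eventually_nhds_in_open[OF open_lessThan, of x c] True by (auto elim!: eventually_mono simp: \<Phi>0)
    then have "(\<Phi> has_real_derivative 0) (at x)"
      using DERIV_cong_ev[OF refl _ refl, of \<Phi> "\<lambda>y. 0" x 0] by simp
    moreover have "\<zeta> x = 0" using cd(4)[of x] True by auto
    ultimately show ?thesis by simp
  next
    case False
    then have x: "a < x" using cd(2) by simp
    have "(\<Phi> has_real_derivative \<zeta> x) (at x within {a..x + 1})"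
      unfolding \<Phi>_def using x by (intro integral_has_real_derivative cont) auto
    moreover have "at x within {a..x + 1} = at x" using x by (intro at_within_interior) auto
    ultimately show ?thesis by simp
  qed
  have \<Phi>1: "\<Phi> x = 0" if "d < x" for x
  proof (cases "x < c")
    case False
    have one: "integrable lebesgue (\<lambda>x. indicator {a..b} x :: real)"
      using emeasure_lebesgue_bounded[of "{a..b}"] by (intro integrable_real_indicator) simp_all
    have "(\<lambda>x. \<zeta> x *\<^sub>R (indicator {a..b} x :: real)) = \<zeta>"
      using cd by (force simp: fun_eq_iff indicator_def)
    then have "integrable lebesgue \<zeta>" using integrable_test_function[OF \<zeta> one] by simp
    then have "(\<zeta> has_integral 0) UNIV" using has_integral_integral_lebesgue[of \<zeta>] 0 by simp
    moreover have "(\<lambda>y. if y \<in> {a..x} then \<zeta> y else 0) = \<zeta>" using cd that by (force simp: fun_eq_iff)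
    ultimately have "(\<zeta> has_integral 0) {a..x}" using has_integral_restrict_UNIV[of "{a..x}" \<zeta> 0] by simp
    then show ?thesis unfolding \<Phi>_def by (rule integral_unique)
  qed (rule \<Phi>0)
  have "smooth \<Phi>"
  \<comment> \<open>Adding \<open>\<Phi>\<close> to the smooth functions keeps the class closed
    under differentiation, since its derivative \<open>\<zeta>\<close> is smooth.\<close>
  proof (rule smooth_closed_class[where S = "insert \<Phi> (Collect smooth)"])
    fix f assume "f \<in> insert \<Phi> (Collect smooth)"
    then consider "f = \<Phi>" | "smooth f" by blast
    then show "\<exists>f'\<in>insert \<Phi> (Collect smooth). \<forall>x. (f has_real_derivative f' x) (at x)"
    proof cases
      case 1
      then show ?thesis using D cd(1) by (intro bexI[of _ \<zeta>]) auto
    next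
      case 2
      then show ?thesis using smooth_DERIV[OF 2, of 0] smooth_deriv by (intro bexI[of _ "deriv f"]) auto
    qed
  qed simp
  moreover have "c \<le> x \<and> x \<le> d" if "\<Phi> x \<noteq> 0" for x
    using \<Phi>0[of x] \<Phi>1[of x] that by (meson not_less)
  ultimately have "test_function a b \<Phi>" unfolding test_function_iff using cd(2,3) by blast
  moreover have "deriv \<Phi> = \<zeta>" using D by (auto intro: DERIV_imp_deriv)
  ultimately show thesis by (rule that)
qed

lemma integrable_indicator_interval:
  fixes a b :: real and C :: "'a::euclidean_space"
  shows "integrable lebesgue (\<lambda>x. indicator {a<..<b} x *\<^sub>R C)"
  using emeasure_lebesgue_bounded[of "{a<..<b}"] by (intro integrable_indicator) simp_all

text \<open>With one test function \<open>\<eta>\<close> of nonzero integral k, every test function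
  minus a suitable multiple of \<open>\<eta>\<close> has integral zero and is thus the derivative of
  a test function. This turns the hypothesis into orthogonality of \<open>h - C\<close> to all test
  functions, where C is the integral of \<open>\<eta> h\<close> divided by k.\<close>

lemma du_Bois_Reymond:
  fixes h :: "real \<Rightarrow> 'a::euclidean_space"
  assumes h: "integrable lebesgue h"
    and 0: "\<And>\<phi>. test_function a b \<phi> \<Longrightarrow> (LINT x|lebesgue. deriv \<phi> x *\<^sub>R h x) = 0"
  shows "\<exists>C. AE x in lebesgue. x \<in> {a<..<b} \<longrightarrow> h x = C"
proof (cases "a < b")
  case False
  then show ?thesis by auto
next
  case ab: True
  have int1: "integrable lebesgue \<psi>" if "test_function a b \<psi>" for \<psi>
  proof -
    have "(\<lambda>x. \<psi> x *\<^sub>R (indicator {a<..<b} x *\<^sub>R (1::real))) = \<psi>"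
      using test_function_outside[OF that] by (auto simp: fun_eq_iff indicator_def)
    then show ?thesis using integrable_test_function[OF that integrable_indicator_interval[of a b "1::real"]] by simp
  qed
  \<comment> \<open>If all test functions had integral zero, the fundamental lemma applied to the
    indicator of the interval would make the interval a null set.\<close>
  obtain \<eta> where \<eta>: "test_function a b \<eta>" "(LINT x|lebesgue. \<eta> x) \<noteq> 0"
  proof (rule ccontr)
    assume "\<not> thesis"
    then have "(LINT x|lebesgue. \<phi> x *\<^sub>R (indicator {a<..<b} x *\<^sub>R (1::real))) = 0" if "test_function a b \<phi>" for \<phi>
    proof -
      have "(\<lambda>x. \<phi> x *\<^sub>R (indicator {a<..<b} x *\<^sub>R (1::real))) = \<phi>"
        using test_function_outside[OF that] by (auto simp: fun_eq_iff indicator_def)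
      then show ?thesis using \<open>\<not> thesis\<close> \<open>\<And>\<eta>. \<lbrakk>test_function a b \<eta>; (LINT x|lebesgue. \<eta> x) \<noteq> 0\<rbrakk> \<Longrightarrow> thesis\<close> that by force
    qed
    from fundamental_lemma[where a = a and b = b, OF integrable_indicator_interval this]
    have "AE x in lebesgue. x \<notin> {a<..<b}" by (auto elim!: eventually_mono simp: indicator_def)
    then have "emeasure lebesgue {x \<in> space lebesgue. x \<in> {a<..<b}} = 0" by (rule emeasure_eq_0_AE)
    moreover have "{x \<in> space lebesgue. x \<in> {a<..<b}} = {a<..<b}" by auto
    ultimately have "emeasure lebesgue {a<..<b} = 0" by (simp only:)
    then show False using ab by (simp add: emeasure_completion)
  qed
  define k where "k = (LINT x|lebesgue. \<eta> x)"
  define C where "C = (1 / k) *\<^sub>R (LINT x|lebesgue. \<eta> x *\<^sub>R h x)"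
  define h' where "h' x = indicator {a<..<b} x *\<^sub>R (h x - C)" for x
  have h': "integrable lebesgue h'"
    unfolding h'_def scaleR_diff_right
    by (intro Bochner_Integration.integrable_diff integrable_indicator_lebesgue h integrable_indicator_interval) simp
  have Z: "(LINT x|lebesgue. \<psi> x *\<^sub>R h' x) = 0" if \<psi>: "test_function a b \<psi>" for \<psi>
  proof -
    define m where "m = (LINT x|lebesgue. \<psi> x)"
    define \<zeta> where "\<zeta> x = \<psi> x + (- (m / k)) * \<eta> x" for x
    obtain c d where cd: "smooth \<psi>" "a < c" "d < b" "\<And>x. \<psi> x \<noteq> 0 \<Longrightarrow> c \<le> x \<and> x \<le> d"
      using \<psi> unfolding test_function_iff by blast
    obtain c' d' where cd': "smooth \<eta>" "a < c'" "d' < b" "\<And>x. \<eta> x \<noteq> 0 \<Longrightarrow> c' \<le> x \<and> x \<le> d'"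
      using \<eta>(1) unfolding test_function_iff by blast
    have "min c c' \<le> x \<and> x \<le> max d d'" if "\<zeta> x \<noteq> 0" for x
    proof -
      have "\<psi> x \<noteq> 0 \<or> \<eta> x \<noteq> 0" using that unfolding \<zeta>_def by auto
      then show ?thesis using cd(4)[of x] cd'(4)[of x] by auto
    qed
    moreover have "smooth \<zeta>" unfolding \<zeta>_def by (intro smooth_add smooth_mult smooth_const cd(1) cd'(1))
    moreover have "a < min c c'" "max d d' < b" using cd cd' by auto
    ultimately have \<zeta>: "test_function a b \<zeta>" unfolding test_function_iff by blast
    have "(LINT x|lebesgue. \<zeta> x) = m - m / k * k"
      unfolding \<zeta>_def m_def using int1[OF \<psi>] int1[OF \<eta>(1)] by (simp add: k_def)
    then have "(LINT x|lebesgue. \<zeta> x) = 0" using \<eta>(2) by (simp add: k_def)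
    then obtain \<Phi> where \<Phi>: "test_function a b \<Phi>" "deriv \<Phi> = \<zeta>"
      using test_function_antiderivative[OF \<zeta>] by blast
    have "0 = (LINT x|lebesgue. \<zeta> x *\<^sub>R h x)" using 0[OF \<Phi>(1)] \<Phi>(2) by simp
    also have "\<dots> = (LINT x|lebesgue. \<psi> x *\<^sub>R h x + (- (m / k)) *\<^sub>R (\<eta> x *\<^sub>R h x))"
      unfolding \<zeta>_def by (simp add: scaleR_left_distrib scaleR_left_diff_distrib)
    also have "\<dots> = (LINT x|lebesgue. \<psi> x *\<^sub>R h x) + (- (m / k)) *\<^sub>R (LINT x|lebesgue. \<eta> x *\<^sub>R h x)"
      using integrable_test_function[OF \<psi> h] integrable_test_function[OF \<eta>(1) h]
      by (simp del: scaleR_scaleR)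
    finally have 1: "(LINT x|lebesgue. \<psi> x *\<^sub>R h x) = m *\<^sub>R C" unfolding C_def by simp
    have "\<psi> x *\<^sub>R h' x = \<psi> x *\<^sub>R h x - \<psi> x *\<^sub>R C" for x
      unfolding h'_def using test_function_outside[OF \<psi>, of x]
      by (auto simp: indicator_def scaleR_diff_right)
    then have "(LINT x|lebesgue. \<psi> x *\<^sub>R h' x) = (LINT x|lebesgue. \<psi> x *\<^sub>R h x) - m *\<^sub>R C"
      unfolding m_def using integrable_test_function[OF \<psi> h] int1[OF \<psi>] by simp
    then show ?thesis using 1 by simp
  qed
  have "AE x in lebesgue. x \<in> {a<..<b} \<longrightarrow> h' x = 0"
    by (rule fundamental_lemma[OF h']) (rule Z)
  then have "AE x in lebesgue. x \<in> {a<..<b} \<longrightarrow> h x = C"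
    by eventually_elim (auto simp: h'_def indicator_def)
  then show ?thesis by blast
qed

section \<open>The space of square integrable functions\<close>

text \<open>The body of \<open>in_L2\<close> under a name. With the transfer rule below, statements
  about \<open>in_L2\<close> transfer to this folded predicate instead of a conjunction of
  conditions.\<close>

definition L2_on :: "real \<Rightarrow> real \<Rightarrow> (real \<Rightarrow> 'a::euclidean_space) \<Rightarrow> bool" where
  "L2_on a b f \<longleftrightarrow> (AE x in lebesgue. x \<notin> {a<..<b} \<longrightarrow> f x = 0) \<and>
     f \<in> borel_measurable lebesgue \<and> integrable lebesgue (\<lambda>x. (norm (f x))\<^sup>2)"

lemma in_L2_transfer [transfer_rule]:
  "rel_fun (=) (rel_fun (=) (rel_fun (pcr_aefun (=)) (=))) L2_on in_L2"
  unfolding L2_on_def[abs_def] by (rule in_L2.transfer)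

declare in_L2.transfer [transfer_rule del]

lemma L2_on_measurable: "L2_on a b f \<Longrightarrow> f \<in> borel_measurable lebesgue"
  and L2_on_square: "L2_on a b f \<Longrightarrow> integrable lebesgue (\<lambda>x. (norm (f x))\<^sup>2)"
  unfolding L2_on_def by auto

lemma integrable_indicator_if_square:
  fixes f :: "real \<Rightarrow> 'a::euclidean_space"
  assumes m: "f \<in> borel_measurable lebesgue" and s: "integrable lebesgue (\<lambda>x. (norm (f x))\<^sup>2)"
  shows "integrable lebesgue (\<lambda>x. indicator {c<..<d} x *\<^sub>R f x)"
proof (rule Bochner_Integration.integrable_bound)
  show "integrable lebesgue (\<lambda>x. indicator {c<..<d} x *\<^sub>R (1::real) + (norm (f x))\<^sup>2)"
    using s integrable_indicator_interval[of c d "1::real"] by (intro Bochner_Integration.integrable_add)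
  show "(\<lambda>x. indicator {c<..<d} x *\<^sub>R f x) \<in> borel_measurable lebesgue"
    using m by (intro borel_measurable_scaleR borel_measurable_indicator) auto
  have "t \<le> 1 + t\<^sup>2" for t :: real
  proof -
    have "2 * t \<le> t\<^sup>2 + 1" using zero_le_power2[of "t - 1"] unfolding power2_diff by simp
    then show ?thesis using zero_le_power2[of t] by linarith
  qed
  then show "AE x in lebesgue. norm (indicator {c<..<d} x *\<^sub>R f x)
      \<le> norm (indicator {c<..<d} x *\<^sub>R (1::real) + (norm (f x))\<^sup>2)"
    by (intro AE_I2) (auto simp: indicator_def)
qed

lemma L2_on_integrable:
  fixes f :: "real \<Rightarrow> 'a::euclidean_space"
  assumes "L2_on a b f" shows "integrable lebesgue f"
proof -
  have AE: "AE x in lebesgue. f x = indicator {a<..<b} x *\<^sub>R f x"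
    using assms unfolding L2_on_def by (auto elim: eventually_mono simp: indicator_def)
  have "integrable lebesgue (\<lambda>x. indicator {a<..<b} x *\<^sub>R f x)"
    using assms by (intro integrable_indicator_if_square) (simp_all add: L2_on_def)
  then show ?thesis using integral_lebesgue_cong_AE(1)[OF AE] by blast
qed

text \<open>Cauchy-Schwarz against the indicator, obtained by expanding the nonnegative integral of
  (|f| - k)^2 over the interval with k the mean of |f|.\<close>

lemma integral_interval_Cauchy_Schwarz:
  fixes f :: "real \<Rightarrow> 'a::euclidean_space"
  assumes m: "f \<in> borel_measurable lebesgue" and s: "integrable lebesgue (\<lambda>x. (norm (f x))\<^sup>2)"
    and cd: "c \<le> d"
  shows "(LINT x|lebesgue. indicator {c<..<d} x * norm (f x)) \<le> sqrt (d - c) * sqrt (LINT x|lebesgue. (norm (f x))\<^sup>2)"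
proof (cases "c = d")
  case False
  then have l: "0 < d - c" using cd by simp
  let ?I = "indicator {c<..<d} :: real \<Rightarrow> real"
  define v where "v = (LINT x|lebesgue. ?I x * norm (f x))"
  define k where "k = v / (d - c)"
  have i1: "integrable lebesgue (\<lambda>x. ?I x * norm (f x))"
    using integrable_norm[OF integrable_indicator_if_square[OF m s, of c d]] by simp
  have i2: "integrable lebesgue (\<lambda>x. ?I x * (norm (f x))\<^sup>2)"
    using integrable_indicator_lebesgue[OF s, of "{c<..<d}"] by simp
  have i0: "integrable lebesgue (\<lambda>x. ?I x)" using integrable_indicator_interval[of c d "1::real"] by simp
  have len: "(LINT x|lebesgue. ?I x) = d - c"
    using l by (simp add: measure_completion)
  have "0 \<le> (LINT x|lebesgue. ?I x * (norm (f x) - k)\<^sup>2)"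
    by (rule integral_nonneg_AE) simp
  also have "(\<lambda>x. ?I x * (norm (f x) - k)\<^sup>2)
      = (\<lambda>x. ?I x * (norm (f x))\<^sup>2 - (2 * k) * (?I x * norm (f x)) + k\<^sup>2 * ?I x)"
    by (auto simp: fun_eq_iff power2_eq_square algebra_simps)
  also have "(LINT x|lebesgue. ?I x * (norm (f x))\<^sup>2 - (2 * k) * (?I x * norm (f x)) + k\<^sup>2 * ?I x)
      = (LINT x|lebesgue. ?I x * (norm (f x))\<^sup>2) - (2 * k) * v + k\<^sup>2 * (d - c)"
    unfolding v_def len[symmetric]
    using i0 i1 i2 by (simp del: integral_indicator)
  also have "\<dots> = (LINT x|lebesgue. ?I x * (norm (f x))\<^sup>2) - v\<^sup>2 / (d - c)"
  proof -
    have "x - 2 * (v / l) * v + (v / l)\<^sup>2 * l = x - v\<^sup>2 / l" if "l > 0" for x l :: real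
      using that by (simp add: field_simps power2_eq_square)
    then show ?thesis unfolding k_def using l by blast
  qed
  finally have "v\<^sup>2 \<le> (d - c) * (LINT x|lebesgue. ?I x * (norm (f x))\<^sup>2)"
    using l by (simp add: field_simps)
  also have "\<dots> \<le> (d - c) * (LINT x|lebesgue. (norm (f x))\<^sup>2)"
    using l i2 s by (intro mult_left_mono integral_mono) (auto simp: indicator_def)
  finally have "v \<le> sqrt ((d - c) * (LINT x|lebesgue. (norm (f x))\<^sup>2))" by (rule real_le_rsqrt)
  then show ?thesis unfolding v_def real_sqrt_mult .
qed simp

lemma norm_L2_nonneg: "0 \<le> norm_L2 f"
  by transfer simp

lemma norm_L2_uminus: "norm_L2 (- f) = norm_L2 f"
  by transfer simp

lemma in_L2_zero: "in_L2 a b 0"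
  by transfer (simp add: L2_on_def)

lemma in_L2_uminus: "in_L2 a b f \<Longrightarrow> in_L2 a b (- f)"
  by transfer (simp add: L2_on_def)

lemma integrable_square_add:
  fixes f g :: "real \<Rightarrow> 'a::euclidean_space"
  assumes m: "f \<in> borel_measurable lebesgue" "g \<in> borel_measurable lebesgue"
    and s: "integrable lebesgue (\<lambda>x. (norm (f x))\<^sup>2)" "integrable lebesgue (\<lambda>x. (norm (g x))\<^sup>2)"
  shows "integrable lebesgue (\<lambda>x. (norm (f x + g x))\<^sup>2)"
proof (rule Bochner_Integration.integrable_bound)
  have "(norm (u + v))\<^sup>2 \<le> 2 * (norm u)\<^sup>2 + 2 * (norm v)\<^sup>2" for u v :: 'a
  proof -
    have "(norm (u + v))\<^sup>2 \<le> (norm u + norm v)\<^sup>2" by (intro power_mono norm_triangle_ineq) simp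
    also have "\<dots> \<le> 2 * (norm u)\<^sup>2 + 2 * (norm v)\<^sup>2"
      using zero_le_power2[of "norm u - norm v"] unfolding power2_diff power2_sum by simp
    finally show ?thesis .
  qed
  then show "AE x in lebesgue. norm ((norm (f x + g x))\<^sup>2) \<le> norm (2 * (norm (f x))\<^sup>2 + 2 * (norm (g x))\<^sup>2)"
    by (intro AE_I2) simp
  show "integrable lebesgue (\<lambda>x. 2 * (norm (f x))\<^sup>2 + 2 * (norm (g x))\<^sup>2)" using s by simp
  show "(\<lambda>x. (norm (f x + g x))\<^sup>2) \<in> borel_measurable lebesgue"
    using m by measurable
qed

lemma L2_on_add: "L2_on a b f \<Longrightarrow> L2_on a b g \<Longrightarrow> L2_on a b (\<lambda>x. f x + g x)"
  unfolding L2_on_def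
  by (auto intro!: integrable_square_add elim!: eventually_elim2)

lemma in_L2_add: "in_L2 a b f \<Longrightarrow> in_L2 a b g \<Longrightarrow> in_L2 a b (f + g)"
  by transfer (rule L2_on_add)

lemma in_L2_diff: "in_L2 a b f \<Longrightarrow> in_L2 a b g \<Longrightarrow> in_L2 a b (f - g)"
  using in_L2_add[OF _ in_L2_uminus, of a b f g] by simp

lemma in_L2_scale:
  fixes f :: "'a::{real_normed_field,euclidean_space} aefun"
  shows "in_L2 a b f \<Longrightarrow> in_L2 a b (scale_aefun c f)"
  by transfer (auto simp: L2_on_def norm_mult power_mult_distrib elim!: eventually_mono)

lemma norm_L2_scale:
  fixes f :: "'a::{real_normed_field,euclidean_space} aefun"
  shows "norm_L2 (scale_aefun c f) = norm c * norm_L2 f"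
  by transfer (simp add: norm_mult power_mult_distrib real_sqrt_mult)

lemma norm_L2_zero: "norm_L2 0 = 0"
  by transfer simp

lemma norm_L2_eq_0_imp: "in_L2 a b f \<Longrightarrow> norm_L2 f = 0 \<Longrightarrow> f = 0"
proof transfer
  fix a b and f :: "real \<Rightarrow> 'a"
  assume f: "L2_on a b f" "sqrt (LINT x|lebesgue. (norm (f x))\<^sup>2) = 0"
  then have "AE x in lebesgue. (norm (f x))\<^sup>2 = 0"
    using integral_nonneg_eq_0_iff_AE[OF L2_on_square[OF f(1)]] by simp
  then show "AE x in lebesgue. f x = 0" by simp
qed

text \<open>The weighted inequality |u+v|^2 \<le> (A+B)/A |u|^2 + (A+B)/B |v|^2 integrates to the
  bound (A+B)^2 once A and B are at least the two norms. Adding e/2 to the norms keeps the weights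
  meaningful when a norm is zero.\<close>

lemma norm_L2_triangle: "in_L2 a b f \<Longrightarrow> in_L2 a b g \<Longrightarrow> norm_L2 (f + g) \<le> norm_L2 f + norm_L2 g"
proof -
  assume fg: "in_L2 a b f" "in_L2 a b g"
  show ?thesis
  proof (rule field_le_epsilon)
    fix e :: real assume e: "0 < e"
    define A where "A = norm_L2 f + e / 2"
    define B where "B = norm_L2 g + e / 2"
    have AB: "A > 0" "B > 0" unfolding A_def B_def using norm_L2_nonneg[of f] norm_L2_nonneg[of g] e by linarith+
    have le: "(norm (u + v))\<^sup>2 \<le> (A + B) / A * (norm u)\<^sup>2 + (A + B) / B * (norm v)\<^sup>2" for u v :: 'a
    proof -
      have "(norm (u + v))\<^sup>2 \<le> (norm u + norm v)\<^sup>2" by (intro power_mono norm_triangle_ineq) simp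
      also have "\<dots> \<le> (A + B) / A * (norm u)\<^sup>2 + (A + B) / B * (norm v)\<^sup>2"
      proof -
        have "0 \<le> (B * norm u - A * norm v)\<^sup>2 / (A * B)" using AB by simp
        also have "\<dots> = (A + B) / A * (norm u)\<^sup>2 + (A + B) / B * (norm v)\<^sup>2 - (norm u + norm v)\<^sup>2"
          using AB by (simp add: field_simps power2_eq_square)
        finally show ?thesis by simp
      qed
      finally show ?thesis .
    qed
    have "(norm_L2 (f + g))\<^sup>2 \<le> (A + B) / A * (norm_L2 f)\<^sup>2 + (A + B) / B * (norm_L2 g)\<^sup>2"
      using fg in_L2_add[OF fg]
    proof (transfer fixing: A B)
      fix a b and f g :: "real \<Rightarrow> 'a"
      assume f: "L2_on a b f" and g: "L2_on a b g" and fg: "L2_on a b (\<lambda>x. f x + g x)"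
      have "(LINT x|lebesgue. (norm (f x + g x))\<^sup>2)
          \<le> (LINT x|lebesgue. (A + B) / A * (norm (f x))\<^sup>2 + (A + B) / B * (norm (g x))\<^sup>2)"
        using L2_on_square[OF f] L2_on_square[OF g] L2_on_square[OF fg] le by (intro integral_mono) auto
      then show "(sqrt (LINT x|lebesgue. (norm (f x + g x))\<^sup>2))\<^sup>2
          \<le> (A + B) / A * (sqrt (LINT x|lebesgue. (norm (f x))\<^sup>2))\<^sup>2
            + (A + B) / B * (sqrt (LINT x|lebesgue. (norm (g x))\<^sup>2))\<^sup>2"
        using L2_on_square[OF f] L2_on_square[OF g] by simp
    qed
    also have "\<dots> \<le> (A + B) / A * A\<^sup>2 + (A + B) / B * B\<^sup>2"
      using AB e norm_L2_nonneg[of f] norm_L2_nonneg[of g]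
      by (intro add_mono mult_left_mono power_mono) (auto simp: A_def B_def)
    also have "\<dots> = (A + B)\<^sup>2" using AB by (simp add: field_simps power2_eq_square)
    finally have "norm_L2 (f + g) \<le> A + B" by (rule power2_le_imp_le) (use AB in simp)
    then show "norm_L2 (f + g) \<le> norm_L2 f + norm_L2 g + e" by (simp add: A_def B_def)
  qed
qed

lemma norm_L2_sum_le:
  assumes "\<And>i. i \<in> I \<Longrightarrow> in_L2 a b (f i)"
  shows "in_L2 a b (\<Sum>i\<in>I. f i)" "norm_L2 (\<Sum>i\<in>I. f i) \<le> (\<Sum>i\<in>I. norm_L2 (f i))"
proof -
  have "in_L2 a b (\<Sum>i\<in>I. f i) \<and> norm_L2 (\<Sum>i\<in>I. f i) \<le> (\<Sum>i\<in>I. norm_L2 (f i))"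
    using assms
  proof (induction I rule: infinite_finite_induct)
    case (insert i I)
    then have "in_L2 a b (f i)" "in_L2 a b (\<Sum>i\<in>I. f i)" by auto
    from norm_L2_triangle[OF this] in_L2_add[OF this] show ?case using insert by simp
  qed (auto simp: in_L2_zero norm_L2_zero)
  then show "in_L2 a b (\<Sum>i\<in>I. f i)" "norm_L2 (\<Sum>i\<in>I. f i) \<le> (\<Sum>i\<in>I. norm_L2 (f i))" by auto
qed

text \<open>The weights \<open>2 ^ n\<close> turn convergence of the series of the integrals into pointwise
  summability almost everywhere.\<close>

lemma L2_on_complete:
  fixes f :: "nat \<Rightarrow> real \<Rightarrow> 'a::euclidean_space"
  assumes f: "\<And>n. L2_on a b (f n)"
    and d: "\<And>n. (LINT x|lebesgue. (norm (f (Suc n) x - f n x))\<^sup>2) \<le> C / 4 ^ n"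
    and dm: "\<And>m n. n \<le> m \<Longrightarrow> (LINT x|lebesgue. (norm (f m x - f n x))\<^sup>2) \<le> D n"
    and D: "D \<longlonglongrightarrow> 0"
  obtains g where "L2_on a b g" "(\<lambda>n. LINT x|lebesgue. (norm (f n x - g x))\<^sup>2) \<longlonglongrightarrow> 0"
proof -
  have fm [measurable]: "f n \<in> borel_measurable lebesgue" for n using f by (rule L2_on_measurable)
  have sq: "integrable lebesgue (\<lambda>x. (norm (f m x - f n x))\<^sup>2)" for m n
    using integrable_square_add[of "f m" "\<lambda>x. - f n x"] fm L2_on_square[OF f, of m] L2_on_square[OF f, of n]
    by simp
  have "(\<integral>\<^sup>+ x. (\<Sum>n. ennreal (2 ^ n * (norm (f (Suc n) x - f n x))\<^sup>2)) \<partial>lebesgue)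
      = (\<Sum>n. \<integral>\<^sup>+ x. ennreal (2 ^ n * (norm (f (Suc n) x - f n x))\<^sup>2) \<partial>lebesgue)"
    by (rule nn_integral_suminf) measurable
  also have "\<dots> \<le> (\<Sum>n. ennreal (\<bar>C\<bar> * (1 / 2) ^ n))"
  proof (rule suminf_le)
    fix n
    have "(\<integral>\<^sup>+ x. ennreal (2 ^ n * (norm (f (Suc n) x - f n x))\<^sup>2) \<partial>lebesgue)
        = ennreal (LINT x|lebesgue. 2 ^ n * (norm (f (Suc n) x - f n x))\<^sup>2)"
      using sq by (intro nn_integral_eq_integral) auto
    also have "\<dots> = ennreal (2 ^ n * (LINT x|lebesgue. (norm (f (Suc n) x - f n x))\<^sup>2))" by simp
    also have "\<dots> \<le> ennreal (2 ^ n * (\<bar>C\<bar> / 4 ^ n))"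
    proof (intro ennreal_leI mult_left_mono)
      have "C / 4 ^ n \<le> \<bar>C\<bar> / 4 ^ n" by (intro divide_right_mono) auto
      then show "(LINT x|lebesgue. (norm (f (Suc n) x - f n x))\<^sup>2) \<le> \<bar>C\<bar> / 4 ^ n"
        using d[of n] by linarith
    qed simp
    also have "2 ^ n * (\<bar>C\<bar> / 4 ^ n) = \<bar>C\<bar> * (1 / 2) ^ n"
    proof -
      have "(4::real) ^ n = (2 * 2) ^ n" by simp
      also have "\<dots> = 2 ^ n * 2 ^ n" by (rule power_mult_distrib)
      finally have "(4::real) ^ n = 2 ^ n * 2 ^ n" .
      then show ?thesis by (simp add: field_simps power_divide)
    qed
    finally show "(\<integral>\<^sup>+ x. ennreal (2 ^ n * (norm (f (Suc n) x - f n x))\<^sup>2) \<partial>lebesgue) \<le> ennreal (\<bar>C\<bar> * (1 / 2) ^ n)" .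
  qed auto
  also have "\<dots> < \<infinity>"
  proof -
    have "summable (\<lambda>n. \<bar>C\<bar> * (1 / 2) ^ n)" by (intro summable_mult summable_geometric) simp
    then show ?thesis by (subst suminf_ennreal2) auto
  qed
  finally have fin: "(\<integral>\<^sup>+ x. (\<Sum>n. ennreal (2 ^ n * (norm (f (Suc n) x - f n x))\<^sup>2)) \<partial>lebesgue) < \<infinity>" .
  have "AE x in lebesgue. (\<Sum>n. ennreal (2 ^ n * (norm (f (Suc n) x - f n x))\<^sup>2)) \<noteq> \<infinity>"
  proof (rule nn_integral_noteq_infinite)
    show "(\<lambda>x. \<Sum>n. ennreal (2 ^ n * (norm (f (Suc n) x - f n x))\<^sup>2)) \<in> borel_measurable lebesgue"
      by measurable
  qed (use fin in \<open>simp only: less_top[symmetric] infinity_ennreal_def not_False_eq_True\<close>)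
  then have "AE x in lebesgue. convergent (\<lambda>n. f n x)"
  proof eventually_elim
    case (elim x)
    have s: "summable (\<lambda>n. 2 ^ n * (norm (f (Suc n) x - f n x))\<^sup>2)"
    proof (rule summable_suminf_not_top)
      show "0 \<le> 2 ^ n * (norm (f (Suc n) x - f n x))\<^sup>2" for n by simp
      show "(\<Sum>n. ennreal (2 ^ n * (norm (f (Suc n) x - f n x))\<^sup>2)) \<noteq> top_class.top"
        using elim unfolding infinity_ennreal_def .
    qed
    \<comment> \<open>With c = 2 ^ n this trades the n-th increment for the n-th term of the
      weighted series of squares plus (1/2) ^ n, both summable.\<close>
    have "t \<le> c * t\<^sup>2 + 1 / c" if c: "c > 0" for t c :: real
    proof -
      have "0 \<le> (c * t - 1)\<^sup>2 / c" using c by simp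
      also have "\<dots> = c * t\<^sup>2 - 2 * t + 1 / c"
        using c by (simp add: field_simps power2_eq_square)
      finally have "2 * t \<le> c * t\<^sup>2 + 1 / c" by simp
      moreover have "0 \<le> c * t\<^sup>2 + 1 / c" using c by simp
      ultimately show ?thesis by linarith
    qed
    from this[of "2 ^ n" for n] have "t \<le> 2 ^ n * t\<^sup>2 + (1 / 2) ^ n" for t :: real and n
      by (simp add: power_one_over)
    then have le: "norm (norm (f (Suc n) x - f n x)) \<le> 2 ^ n * (norm (f (Suc n) x - f n x))\<^sup>2 + (1 / 2) ^ n" for n
      unfolding real_norm_def abs_norm_cancel .
    have "summable (\<lambda>n. 2 ^ n * (norm (f (Suc n) x - f n x))\<^sup>2 + (1 / 2) ^ n)"
      by (rule summable_add[OF s summable_geometric]) simp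
    then have "summable (\<lambda>n. norm (f (Suc n) x - f n x))"
      by (rule summable_comparison_test'[where N = 0]) (rule le)
    then have "summable (\<lambda>n. f (Suc n) x - f n x)" by (rule summable_norm_cancel)
    then have "convergent (\<lambda>n. \<Sum>i<n. f (Suc i) x - f i x)" by (simp add: summable_iff_convergent)
    then have "convergent (\<lambda>n. f n x - f 0 x)" 
      unfolding sum_lessThan_telescope[of "\<lambda>n. f n x"] .
    from convergent_add[OF this convergent_const[of "f 0 x"]] show ?case by simp
  qed
  then have lim: "AE x in lebesgue. (\<lambda>n. f n x) \<longlonglongrightarrow> lim (\<lambda>n. f n x)"
    by eventually_elim (simp add: convergent_LIMSEQ_iff)
  define g where "g x = lim (\<lambda>n. f n x)" for x
  have gm [measurable]: "g \<in> borel_measurable lebesgue"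
    unfolding g_def by (rule borel_measurable_lim_metric) measurable
  \<comment> \<open>Fatou's lemma carries the estimate \<open>dm\<close> from \<open>f m\<close> to
    the pointwise limit.\<close>
  have bound: "(\<integral>\<^sup>+ x. ennreal ((norm (g x - f n x))\<^sup>2) \<partial>lebesgue) \<le> ennreal (D n)" for n
  proof -
    have "(\<integral>\<^sup>+ x. ennreal ((norm (g x - f n x))\<^sup>2) \<partial>lebesgue)
        = (\<integral>\<^sup>+ x. liminf (\<lambda>m. ennreal ((norm (f m x - f n x))\<^sup>2)) \<partial>lebesgue)"
    proof (rule nn_integral_cong_AE)
      show "AE x in lebesgue. ennreal ((norm (g x - f n x))\<^sup>2) = liminf (\<lambda>m. ennreal ((norm (f m x - f n x))\<^sup>2))"
        using lim
      proof eventually_elim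
        case (elim x)
        then have "(\<lambda>m. f m x) \<longlonglongrightarrow> g x" unfolding g_def .
        then have "(\<lambda>m. ennreal ((norm (f m x - f n x))\<^sup>2)) \<longlonglongrightarrow> ennreal ((norm (g x - f n x))\<^sup>2)"
          by (intro tendsto_ennrealI tendsto_power tendsto_norm tendsto_diff tendsto_const)
        then show ?case by (rule lim_imp_Liminf[OF trivial_limit_sequentially, symmetric])
      qed
    qed
    also have "\<dots> \<le> liminf (\<lambda>m. \<integral>\<^sup>+ x. ennreal ((norm (f m x - f n x))\<^sup>2) \<partial>lebesgue)"
      by (rule nn_integral_liminf) measurable
    also have "\<dots> \<le> ennreal (D n)"
    proof (rule Liminf_le)
      show "eventually (\<lambda>m. (\<integral>\<^sup>+ x. ennreal ((norm (f m x - f n x))\<^sup>2) \<partial>lebesgue) \<le> ennreal (D n)) sequentially"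
        using eventually_ge_at_top[of n]
      proof eventually_elim
        case (elim m)
        have "(\<integral>\<^sup>+ x. ennreal ((norm (f m x - f n x))\<^sup>2) \<partial>lebesgue) = ennreal (LINT x|lebesgue. (norm (f m x - f n x))\<^sup>2)"
          by (rule nn_integral_eq_integral[OF sq]) simp
        then show ?case using dm[OF elim] by (simp add: ennreal_leI)
      qed
    qed simp
    finally show ?thesis .
  qed
  have gsq: "integrable lebesgue (\<lambda>x. (norm (g x - f n x))\<^sup>2)" for n
  proof (rule integrableI_bounded)
    show "(\<lambda>x. (norm (g x - f n x))\<^sup>2) \<in> borel_measurable lebesgue" by measurable
    have "ennreal (D n) < \<infinity>" by simp
    then show "(\<integral>\<^sup>+ x. ennreal (norm ((norm (g x - f n x))\<^sup>2)) \<partial>lebesgue) < \<infinity>"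
      using le_less_trans[OF bound[of n]] by simp
  qed
  \<comment> \<open>\<open>g\<close> itself is reached as the square integrable difference
    \<open>g - f 0\<close> plus \<open>f 0\<close>.\<close>
  have g0: "L2_on a b (\<lambda>x. g x - f 0 x)"
    unfolding L2_on_def
  proof (intro conjI)
    have "AE x in lebesgue. \<forall>n. x \<notin> {a<..<b} \<longrightarrow> f n x = 0"
      using f unfolding L2_on_def by (intro AE_all_countable[THEN iffD2]) auto
    then show "AE x in lebesgue. x \<notin> {a<..<b} \<longrightarrow> g x - f 0 x = 0"
      by eventually_elim (auto simp: g_def)
    show "(\<lambda>x. g x - f 0 x) \<in> borel_measurable lebesgue" by measurable
  qed (rule gsq)
  from L2_on_add[OF g0 f[of 0]] have g: "L2_on a b g" by simp
  have "(LINT x|lebesgue. (norm (f n x - g x))\<^sup>2) \<le> \<bar>D n\<bar>" for n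
  proof -
    have "ennreal (LINT x|lebesgue. (norm (g x - f n x))\<^sup>2) \<le> ennreal (D n)"
      using bound[of n] nn_integral_eq_integral[OF gsq[of n]] by simp
    also have "\<dots> \<le> ennreal \<bar>D n\<bar>" by (intro ennreal_leI) simp
    finally show ?thesis by (simp add: norm_minus_commute)
  qed
  then have "norm (LINT x|lebesgue. (norm (f n x - g x))\<^sup>2) \<le> \<bar>D n\<bar>" for n
    by (simp add: integral_nonneg_AE)
  then have "(\<lambda>n. LINT x|lebesgue. (norm (f n x - g x))\<^sup>2) \<longlonglongrightarrow> 0"
    by (intro Lim_null_comparison[OF always_eventually tendsto_rabs_zero[OF D]]) blast
  then show thesis using g that by blast
qed

section \<open>Translation and restriction\<close>

lemma
  fixes h :: real
  shows lebesgue_shift_measurable: "(\<lambda>x. x + h) \<in> lebesgue \<rightarrow>\<^sub>M lebesgue"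
    and lebesgue_distr_shift: "distr lebesgue lebesgue (\<lambda>x. x + h) = lebesgue"
proof -
  show "(\<lambda>x. x + h) \<in> lebesgue \<rightarrow>\<^sub>M lebesgue"
    using lebesgue_affine_measurable[where c = "\<lambda>x::real. 1" and t = h] by (simp add: add.commute)
  show "distr lebesgue lebesgue (\<lambda>x. x + h) = lebesgue"
    using lebesgue_real_affine[of 1 h] by (simp add: density_1 add.commute)
qed

lemma integral_lebesgue_shift:
  fixes f :: "real \<Rightarrow> 'a::euclidean_space"
  assumes "f \<in> borel_measurable lebesgue"
  shows "(LINT x|lebesgue. f (x + h)) = (LINT x|lebesgue. f x)"
    and "integrable lebesgue (\<lambda>x. f (x + h)) \<longleftrightarrow> integrable lebesgue f"
  using integral_distr[OF lebesgue_shift_measurable assms, of h]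
    integrable_distr_eq[OF lebesgue_shift_measurable assms, of h]
  by (simp_all add: lebesgue_distr_shift)

lemma L2_on_shift:
  fixes f :: "real \<Rightarrow> 'a::euclidean_space"
  assumes "L2_on a b f" shows "L2_on (a - h) (b - h) (\<lambda>x. f (x + h))"
  unfolding L2_on_def
proof (intro conjI)
  have "AE x in lebesgue. x \<notin> {a<..<b} \<longrightarrow> f x = 0" using assms by (simp add: L2_on_def)
  then have "AE x in lebesgue. x + h \<notin> {a<..<b} \<longrightarrow> f (x + h) = 0" by (rule AE_lebesgue_shift)
  then show "AE x in lebesgue. x \<notin> {a - h<..<b - h} \<longrightarrow> f (x + h) = 0"
    by eventually_elim auto
  show "(\<lambda>x. f (x + h)) \<in> borel_measurable lebesgue"
    using measurable_compose[OF lebesgue_shift_measurable L2_on_measurable[OF assms]] .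
  have "(\<lambda>x. (norm (f x))\<^sup>2) \<in> borel_measurable lebesgue"
    using L2_on_square[OF assms] by (rule borel_measurable_integrable)
  from integral_lebesgue_shift(2)[OF this, of h]
  show "integrable lebesgue (\<lambda>x. (norm (f (x + h)))\<^sup>2)" using L2_on_square[OF assms] by simp
qed

lemma in_L2_shift: "in_L2 a b f \<Longrightarrow> in_L2 (a - h) (b - h) (shift_aefun h f)"
  by transfer (rule L2_on_shift)

lemma norm_L2_shift: "in_L2 a b f \<Longrightarrow> norm_L2 (shift_aefun h f) = norm_L2 f"
proof transfer
  fix a b h and f :: "real \<Rightarrow> 'a"
  assume f: "L2_on a b f"
  have "(\<lambda>x. (norm (f x))\<^sup>2) \<in> borel_measurable lebesgue"
    using L2_on_square[OF f] by (rule borel_measurable_integrable)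
  from integral_lebesgue_shift(1)[OF this, of h]
  show "sqrt (LINT x|lebesgue. (norm (f (x + h)))\<^sup>2) = sqrt (LINT x|lebesgue. (norm (f x))\<^sup>2)" by simp
qed

lemma L2_on_restrict:
  assumes "L2_on a b f" shows "L2_on c d (\<lambda>x. if c < x \<and> x < d then f x else 0)"
    and "(LINT x|lebesgue. (norm (if c < x \<and> x < d then f x else 0))\<^sup>2) \<le> (LINT x|lebesgue. (norm (f x))\<^sup>2)"
proof -
  have eq: "(\<lambda>x. if c < x \<and> x < d then f x else 0) = (\<lambda>x. indicator {c<..<d} x *\<^sub>R f x)"
    "(\<lambda>x. (norm (indicator {c<..<d} x *\<^sub>R f x))\<^sup>2) = (\<lambda>x. indicator {c<..<d} x *\<^sub>R (norm (f x))\<^sup>2)"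
    by (auto simp: indicator_def fun_eq_iff)
  have i: "integrable lebesgue (\<lambda>x. indicator {c<..<d} x *\<^sub>R (norm (f x))\<^sup>2)"
    by (intro integrable_indicator_lebesgue L2_on_square[OF assms]) simp
  show "L2_on c d (\<lambda>x. if c < x \<and> x < d then f x else 0)"
    unfolding L2_on_def
  proof (intro conjI)
    show "(\<lambda>x. if c < x \<and> x < d then f x else 0) \<in> borel_measurable lebesgue"
      unfolding eq(1) using L2_on_measurable[OF assms]
      by (intro borel_measurable_scaleR borel_measurable_indicator) auto
    show "integrable lebesgue (\<lambda>x. (norm (if c < x \<and> x < d then f x else 0))\<^sup>2)"
      using i eq by (simp add: fun_eq_iff)
  qed simp
  have "(LINT x|lebesgue. (norm (indicator {c<..<d} x *\<^sub>R f x))\<^sup>2) \<le> (LINT x|lebesgue. (norm (f x))\<^sup>2)"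
    unfolding eq(2) by (intro integral_mono i L2_on_square[OF assms]) (auto simp: indicator_def)
  then show "(LINT x|lebesgue. (norm (if c < x \<and> x < d then f x else 0))\<^sup>2) \<le> (LINT x|lebesgue. (norm (f x))\<^sup>2)"
    using eq(1) by (simp add: fun_eq_iff)
qed

lemma in_L2_restrict: "in_L2 a b f \<Longrightarrow> in_L2 c d (restrict_aefun c d f)"
  by transfer (rule L2_on_restrict)

lemma norm_L2_restrict: "in_L2 a b f \<Longrightarrow> norm_L2 (restrict_aefun c d f) \<le> norm_L2 f"
  by transfer (rule real_sqrt_le_mono[OF L2_on_restrict(2)])

lemma in_L2_mono: "in_L2 c d f \<Longrightarrow> a \<le> c \<Longrightarrow> d \<le> b \<Longrightarrow> in_L2 a b f"
  by transfer (auto simp: L2_on_def elim!: eventually_mono)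

lemma restrict_id: "in_L2 c d f \<Longrightarrow> a \<le> c \<Longrightarrow> d \<le> b \<Longrightarrow> restrict_aefun a b f = f"
  by transfer (auto simp: L2_on_def elim!: eventually_mono)

lemma L2_on_bounded:
  fixes F :: "real \<Rightarrow> 'a::euclidean_space"
  assumes ab: "a \<le> b" and m: "F \<in> borel_measurable lebesgue" and 0: "\<And>t. t \<notin> {a<..<b} \<Longrightarrow> F t = 0"
    and K: "\<And>t. t \<in> {a<..<b} \<Longrightarrow> norm (F t) \<le> K" "0 \<le> K"
  shows "L2_on a b F" "sqrt (LINT x|lebesgue. (norm (F x))\<^sup>2) \<le> sqrt (b - a) * K"
proof -
  have le: "(norm (F t))\<^sup>2 \<le> indicator {a<..<b} t *\<^sub>R K\<^sup>2" for t
    using K(1)[of t] 0[of t] by (auto simp: indicator_def intro: power_mono)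
  have i: "integrable lebesgue (\<lambda>x. (norm (F x))\<^sup>2)"
  proof (rule Bochner_Integration.integrable_bound)
    show "integrable lebesgue (\<lambda>t. indicator {a<..<b} t *\<^sub>R K\<^sup>2)" by (rule integrable_indicator_interval)
    show "AE x in lebesgue. norm ((norm (F x))\<^sup>2) \<le> norm (indicator {a<..<b} x *\<^sub>R K\<^sup>2)"
      using le by (intro AE_I2) simp
  qed (use m in measurable)
  then show "L2_on a b F" using m 0 by (simp add: L2_on_def)
  have "(LINT x|lebesgue. (norm (F x))\<^sup>2) \<le> (LINT x|lebesgue. indicator {a<..<b} x *\<^sub>R K\<^sup>2)"
    by (intro integral_mono i integrable_indicator_interval le)
  also have "\<dots> = (b - a) * K\<^sup>2" using ab by (simp add: measure_completion)
  finally have "sqrt (LINT x|lebesgue. (norm (F x))\<^sup>2) \<le> sqrt ((b - a) * K\<^sup>2)" by (rule real_sqrt_le_mono)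
  then show "sqrt (LINT x|lebesgue. (norm (F x))\<^sup>2) \<le> sqrt (b - a) * K"
    using K(2) by (simp add: real_sqrt_mult)
qed


section \<open>Sobolev spaces\<close>

lemma weak_deriv_0: "weak_deriv a b 0 f f"
  by transfer simp

lemma weak_deriv_zero: "weak_deriv a b m 0 0"
  by transfer simp

lemma weak_deriv_uminus: "weak_deriv a b m f g \<Longrightarrow> weak_deriv a b m (- f) (- g)"
  by transfer simp

lemma weak_deriv_scale:
  fixes f :: "'a::{real_normed_field,euclidean_space} aefun"
  shows "weak_deriv a b m f g \<Longrightarrow> weak_deriv a b m (scale_aefun c f) (scale_aefun c g)"
proof transfer
  fix a b m c and f g :: "real \<Rightarrow> 'a"
  assume 1: "\<forall>\<phi>. test_function a b \<phi> \<longrightarrow>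
        (LINT x|lebesgue. (deriv ^^ m) \<phi> x *\<^sub>R f x) = (-1) ^ m *\<^sub>R (LINT x|lebesgue. \<phi> x *\<^sub>R g x)"
  have c: "(LINT x|lebesgue. \<psi> x *\<^sub>R (c * u x)) = c * (LINT x|lebesgue. \<psi> x *\<^sub>R u x)"
    for \<psi> and u :: "real \<Rightarrow> 'a"
    by (simp only: mult_scaleR_right[symmetric] integral_mult_right_zero)
  show "\<forall>\<phi>. test_function a b \<phi> \<longrightarrow>
        (LINT x|lebesgue. (deriv ^^ m) \<phi> x *\<^sub>R (c * f x)) = (-1) ^ m *\<^sub>R (LINT x|lebesgue. \<phi> x *\<^sub>R (c * g x))"
  proof (intro allI impI)
    fix \<phi> assume "test_function a b \<phi>"
    then show "(LINT x|lebesgue. (deriv ^^ m) \<phi> x *\<^sub>R (c * f x)) = (-1) ^ m *\<^sub>R (LINT x|lebesgue. \<phi> x *\<^sub>R (c * g x))"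
      unfolding c using 1 by (simp only: mult_scaleR_right)
  qed
qed

lemma weak_deriv_add:
  assumes "in_L2 a b f" "in_L2 a b g" "in_L2 a b f'" "in_L2 a b g'"
    "weak_deriv a b m f g" "weak_deriv a b m f' g'"
  shows "weak_deriv a b m (f + f') (g + g')"
  using assms
proof transfer
  fix a b m and f g f' g' :: "real \<Rightarrow> 'a"
  assume L: "L2_on a b f" "L2_on a b g" "L2_on a b f'" "L2_on a b g'"
    and 1: "\<forall>\<phi>. test_function a b \<phi> \<longrightarrow>
        (LINT x|lebesgue. (deriv ^^ m) \<phi> x *\<^sub>R f x) = (-1) ^ m *\<^sub>R (LINT x|lebesgue. \<phi> x *\<^sub>R g x)"
    and 2: "\<forall>\<phi>. test_function a b \<phi> \<longrightarrow>
        (LINT x|lebesgue. (deriv ^^ m) \<phi> x *\<^sub>R f' x) = (-1) ^ m *\<^sub>R (LINT x|lebesgue. \<phi> x *\<^sub>R g' x)"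
  note i = L[THEN L2_on_integrable]
  show "\<forall>\<phi>. test_function a b \<phi> \<longrightarrow>
      (LINT x|lebesgue. (deriv ^^ m) \<phi> x *\<^sub>R (f x + f' x)) = (-1) ^ m *\<^sub>R (LINT x|lebesgue. \<phi> x *\<^sub>R (g x + g' x))"
  proof (intro allI impI)
    fix \<phi> assume \<phi>: "test_function a b \<phi>"
    note \<phi>' = test_function_funpow_deriv[OF \<phi>, of m]
    show "(LINT x|lebesgue. (deriv ^^ m) \<phi> x *\<^sub>R (f x + f' x)) = (-1) ^ m *\<^sub>R (LINT x|lebesgue. \<phi> x *\<^sub>R (g x + g' x))"
      unfolding scaleR_add_right
      using integrable_test_function[OF \<phi>' i(1)] integrable_test_function[OF \<phi>' i(3)]
        integrable_test_function[OF \<phi> i(2)] integrable_test_function[OF \<phi> i(4)]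
        1[rule_format, OF \<phi>] 2[rule_format, OF \<phi>]
      by (simp add: scaleR_add_right)
  qed
qed

text \<open>This justifies the definite description in \<open>wderiv\<close>. The fundamental lemma
  gives equality inside the interval, and outside both functions vanish.\<close>

lemma weak_deriv_unique:
  assumes "in_L2 a b g" "in_L2 a b g'" "weak_deriv a b m f g" "weak_deriv a b m f g'"
  shows "g = g'"
  using assms
proof transfer
  fix a b m and f g g' :: "real \<Rightarrow> 'a"
  assume L: "L2_on a b g" "L2_on a b g'"
    and 1: "\<forall>\<phi>. test_function a b \<phi> \<longrightarrow>
        (LINT x|lebesgue. (deriv ^^ m) \<phi> x *\<^sub>R f x) = (-1) ^ m *\<^sub>R (LINT x|lebesgue. \<phi> x *\<^sub>R g x)"
    and 2: "\<forall>\<phi>. test_function a b \<phi> \<longrightarrow>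
        (LINT x|lebesgue. (deriv ^^ m) \<phi> x *\<^sub>R f x) = (-1) ^ m *\<^sub>R (LINT x|lebesgue. \<phi> x *\<^sub>R g' x)"
  note i = L[THEN L2_on_integrable]
  have "AE x in lebesgue. x \<in> {a<..<b} \<longrightarrow> g x - g' x = 0"
  proof (rule fundamental_lemma)
    show "integrable lebesgue (\<lambda>x. g x - g' x)" using i by simp
    fix \<phi> assume \<phi>: "test_function a b \<phi>"
    have "(-1::real) ^ m *\<^sub>R (LINT x|lebesgue. \<phi> x *\<^sub>R g x) = (-1) ^ m *\<^sub>R (LINT x|lebesgue. \<phi> x *\<^sub>R g' x)"
      using 1[rule_format, OF \<phi>] 2[rule_format, OF \<phi>] by simp
    then have "(LINT x|lebesgue. \<phi> x *\<^sub>R g x) = (LINT x|lebesgue. \<phi> x *\<^sub>R g' x)" by simp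
    then show "(LINT x|lebesgue. \<phi> x *\<^sub>R (g x - g' x)) = 0"
      using integrable_test_function[OF \<phi> i(1)] integrable_test_function[OF \<phi> i(2)]
      by (simp add: scaleR_diff_right)
  qed
  then show "AE x in lebesgue. g x = g' x"
    using conjunct1[OF L(1)[unfolded L2_on_def]] conjunct1[OF L(2)[unfolded L2_on_def]]
    by eventually_elim auto
qed

text \<open>Testing the given relation with the n-th derivative of a test function converts one
  statement into the other. The equivalence serves both to compose derivatives and to split
  them.\<close>

lemma weak_deriv_trans_iff:
  assumes "weak_deriv a b m f g"
  shows "weak_deriv a b (n + m) f h \<longleftrightarrow> weak_deriv a b n g h"
  using assms
proof transfer
  fix a b m n and f g h :: "real \<Rightarrow> 'a"
  assume 1: "\<forall>\<phi>. test_function a b \<phi> \<longrightarrow>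
        (LINT x|lebesgue. (deriv ^^ m) \<phi> x *\<^sub>R f x) = (-1) ^ m *\<^sub>R (LINT x|lebesgue. \<phi> x *\<^sub>R g x)"
  have "(LINT x|lebesgue. (deriv ^^ (n + m)) \<phi> x *\<^sub>R f x) = (-1) ^ m *\<^sub>R (LINT x|lebesgue. (deriv ^^ n) \<phi> x *\<^sub>R g x)"
    if "test_function a b \<phi>" for \<phi>
    using 1[rule_format, OF test_function_funpow_deriv[OF that, of n]]
    by (simp add: add.commute[of n m] funpow_add)
  moreover have "(-1::real) ^ m *\<^sub>R u = (-1) ^ (n + m) *\<^sub>R v \<longleftrightarrow> u = (-1) ^ n *\<^sub>R v" for u v :: 'a
    by (simp add: power_add mult.commute flip: scaleR_scaleR)
  ultimately show "(\<forall>\<phi>. test_function a b \<phi> \<longrightarrow>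
        (LINT x|lebesgue. (deriv ^^ (n + m)) \<phi> x *\<^sub>R f x) = (-1) ^ (n + m) *\<^sub>R (LINT x|lebesgue. \<phi> x *\<^sub>R h x)) =
      (\<forall>\<phi>. test_function a b \<phi> \<longrightarrow>
        (LINT x|lebesgue. (deriv ^^ n) \<phi> x *\<^sub>R g x) = (-1) ^ n *\<^sub>R (LINT x|lebesgue. \<phi> x *\<^sub>R h x))"
    by simp
qed

text \<open>A test function on the smaller interval is also one on the larger interval, and it does
  not see the cut.\<close>

lemma weak_deriv_restrict:
  assumes "weak_deriv a b m f g" "a \<le> c" "d \<le> b"
  shows "weak_deriv c d m (restrict_aefun c d f) (restrict_aefun c d g)"
  using assms
proof transfer
  fix a b m c d and f g :: "real \<Rightarrow> 'a"
  assume 1: "\<forall>\<phi>. test_function a b \<phi> \<longrightarrow>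
        (LINT x|lebesgue. (deriv ^^ m) \<phi> x *\<^sub>R f x) = (-1) ^ m *\<^sub>R (LINT x|lebesgue. \<phi> x *\<^sub>R g x)"
    and cd: "a \<le> c" "d \<le> b"
  have eq: "\<psi> x *\<^sub>R (if c < x \<and> x < d then u x else 0) = \<psi> x *\<^sub>R u x"
    if "test_function c d \<psi>" for \<psi> x and u :: "real \<Rightarrow> 'a"
    using test_function_outside[OF that, of x] by auto
  show "\<forall>\<phi>. test_function c d \<phi> \<longrightarrow>
      (LINT x|lebesgue. (deriv ^^ m) \<phi> x *\<^sub>R (if c < x \<and> x < d then f x else 0))
      = (-1) ^ m *\<^sub>R (LINT x|lebesgue. \<phi> x *\<^sub>R (if c < x \<and> x < d then g x else 0))"
    using 1 test_function_mono[OF _ cd] by (simp add: eq test_function_funpow_deriv)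
qed

lemma funpow_deriv_shift: "(deriv ^^ m) (\<lambda>x. \<phi> (x + h)) = (\<lambda>x. (deriv ^^ m) \<phi> (x + h :: real))"
proof (induction m)
  case (Suc m)
  have "deriv (\<lambda>x. \<psi> (x + h)) = (\<lambda>x. deriv \<psi> (x + h))" for \<psi> :: "real \<Rightarrow> real"
    unfolding deriv_def by (simp add: DERIV_shift fun_eq_iff)
  then show ?case by (simp add: Suc)
qed simp

lemma weak_deriv_shift:
  assumes "weak_deriv a b m f g" "in_L2 a b f" "in_L2 a b g"
  shows "weak_deriv (a - h) (b - h) m (shift_aefun h f) (shift_aefun h g)"
  using assms
proof transfer
  fix a b m h and f g :: "real \<Rightarrow> 'a"
  assume 1: "\<forall>\<phi>. test_function a b \<phi> \<longrightarrow>
        (LINT x|lebesgue. (deriv ^^ m) \<phi> x *\<^sub>R f x) = (-1) ^ m *\<^sub>R (LINT x|lebesgue. \<phi> x *\<^sub>R g x)"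
    and L: "L2_on a b f" "L2_on a b g"
  have sh: "(LINT x|lebesgue. \<psi> x *\<^sub>R u (x + h)) = (LINT x|lebesgue. \<psi> (x - h) *\<^sub>R u x)"
    if "test_function c d \<psi>" "L2_on a b u" for \<psi> c d and u :: "real \<Rightarrow> 'a"
  proof -
    have [measurable]: "u \<in> borel_measurable lebesgue" using that(2) by (rule L2_on_measurable)
    have "(\<lambda>x. x - h) \<in> lebesgue \<rightarrow>\<^sub>M lebesgue" using lebesgue_shift_measurable[of "- h"] by simp
    moreover have "\<psi> \<in> borel_measurable lebesgue"
      using test_function_borel[OF that(1)] by (auto intro: measurable_completion)
    ultimately have "(\<lambda>x. \<psi> (x - h)) \<in> borel_measurable lebesgue" by (rule measurable_compose)
    then have "(\<lambda>x. \<psi> (x - h) *\<^sub>R u x) \<in> borel_measurable lebesgue" by measurable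
    from integral_lebesgue_shift(1)[OF this, of h] show ?thesis by simp
  qed
  show "\<forall>\<phi>. test_function (a - h) (b - h) \<phi> \<longrightarrow>
      (LINT x|lebesgue. (deriv ^^ m) \<phi> x *\<^sub>R f (x + h)) = (-1) ^ m *\<^sub>R (LINT x|lebesgue. \<phi> x *\<^sub>R g (x + h))"
  proof (intro allI impI)
    fix \<phi> assume \<phi>: "test_function (a - h) (b - h) \<phi>"
    define \<psi> where "\<psi> x = \<phi> (x + (- h))" for x
    have \<psi>': "(deriv ^^ m) \<psi> = (\<lambda>x. (deriv ^^ m) \<phi> (x - h))"
      unfolding \<psi>_def[abs_def] funpow_deriv_shift by simp
    obtain c d where cd: "smooth \<phi>" "a - h < c" "d < b - h" "\<And>x. \<phi> x \<noteq> 0 \<Longrightarrow> c \<le> x \<and> x \<le> d"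
      using \<phi> unfolding test_function_iff by blast
    have "smooth \<psi>" using smooth_affine[OF cd(1), of 1 "- h"] unfolding \<psi>_def by simp
    moreover have "c + h \<le> x \<and> x \<le> d + h" if "\<psi> x \<noteq> 0" for x
      using cd(4)[of "x - h"] that unfolding \<psi>_def by auto
    moreover have "a < c + h" "d + h < b" using cd(2,3) by auto
    ultimately have \<psi>: "test_function a b \<psi>" unfolding test_function_iff by blast
    have "(LINT x|lebesgue. (deriv ^^ m) \<phi> x *\<^sub>R f (x + h)) = (LINT x|lebesgue. (deriv ^^ m) \<psi> x *\<^sub>R f x)"
      unfolding \<psi>' by (rule sh[OF test_function_funpow_deriv[OF \<phi>] L(1)])
    also have "\<dots> = (-1) ^ m *\<^sub>R (LINT x|lebesgue. \<psi> x *\<^sub>R g x)" using 1 \<psi> by blast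
    also have "(LINT x|lebesgue. \<psi> x *\<^sub>R g x) = (LINT x|lebesgue. \<phi> x *\<^sub>R g (x + h))"
      unfolding \<psi>_def using sh[OF \<phi> L(2)] by simp
    finally show "(LINT x|lebesgue. (deriv ^^ m) \<phi> x *\<^sub>R f (x + h)) = (-1) ^ m *\<^sub>R (LINT x|lebesgue. \<phi> x *\<^sub>R g (x + h))" .
  qed
qed

section \<open>The Sobolev norm and operators bounded for it\<close>

lemma wderiv_eqI: "in_L2 a b g \<Longrightarrow> weak_deriv a b m f g \<Longrightarrow> wderiv a b m f = g"
  unfolding wderiv_def by (rule the_equality) (auto intro: weak_deriv_unique)

lemma sobolev_simps [simp]:
  fixes f :: "'a::{real_normed_field,euclidean_space} aefun"
  shows "f \<in> carr (sobolev k a b) \<longleftrightarrow>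
      in_L2 a b f \<and> (\<forall>m\<le>k. \<exists>g. in_L2 a b g \<and> weak_deriv a b m f g)"
    "scal (sobolev k a b) = (scale_aefun :: 'a \<Rightarrow> _)"
  by (simp_all add: sobolev_def)

text \<open>In this form the Minkowski inequality for finite sums applies to the vector of
  derivative norms.\<close>

lemma nrm_sobolev:
  "nrm (sobolev k a b) f = L2_set (\<lambda>m. norm_L2 (wderiv a b m f)) {..k}"
  by (simp add: sobolev_def L2_set_def)

lemma sobolev_wderiv:
  assumes "f \<in> carr (sobolev k a b)" "m \<le> k"
  shows "in_L2 a b (wderiv a b m f)" "weak_deriv a b m f (wderiv a b m f)"
proof -
  obtain g where "in_L2 a b g" "weak_deriv a b m f g" using assms by auto
  then show "in_L2 a b (wderiv a b m f)" "weak_deriv a b m f (wderiv a b m f)"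
    using wderiv_eqI by metis+
qed

lemma wderiv_0: "in_L2 a b f \<Longrightarrow> wderiv a b 0 f = f"
  by (rule wderiv_eqI[OF _ weak_deriv_0])

lemma sobolev_0: "f \<in> carr (sobolev 0 a b) \<longleftrightarrow> in_L2 a b f"
  using weak_deriv_0 by auto

lemma norm_L2_wderiv_le: "m \<le> k \<Longrightarrow> norm_L2 (wderiv a b m f) \<le> nrm (sobolev k a b) f"
  unfolding nrm_sobolev by (rule member_le_L2_set) auto

lemma nrm_sobolev_le: "nrm (sobolev k a b) f \<le> (\<Sum>m\<le>k. norm_L2 (wderiv a b m f))"
  unfolding nrm_sobolev by (rule L2_set_le_sum) (rule norm_L2_nonneg)

lemma nrm_sobolev_0: "in_L2 a b f \<Longrightarrow> nrm (sobolev 0 a b) f = norm_L2 f"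
  unfolding nrm_sobolev by (simp add: wderiv_0 norm_L2_nonneg)

lemma wderiv_add:
  assumes "f \<in> carr (sobolev k a b)" "g \<in> carr (sobolev k a b)" "m \<le> k"
  shows "wderiv a b m (f + g) = wderiv a b m f + wderiv a b m g"
  using sobolev_wderiv[OF assms(1,3)] sobolev_wderiv[OF assms(2,3)] assms(1,2)
  by (intro wderiv_eqI in_L2_add weak_deriv_add) auto

lemma wderiv_scale:
  assumes "f \<in> carr (sobolev k a b)" "m \<le> k"
  shows "wderiv a b m (scale_aefun c f) = scale_aefun c (wderiv a b m f)"
  using sobolev_wderiv[OF assms] by (intro wderiv_eqI in_L2_scale weak_deriv_scale)

text \<open>If no weak derivative exists, \<open>wderiv\<close> describes a nonexistent object; it
  takes the same value for \<open>f\<close> and \<open>- f\<close> because the two describing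
  predicates are equal. The norm is thus even on the whole type, as \<open>normed_carrier\<close>
  demands.\<close>

lemma norm_L2_wderiv_uminus: "norm_L2 (wderiv a b m (- f)) = norm_L2 (wderiv a b m f)"
proof (cases "\<exists>g. in_L2 a b g \<and> weak_deriv a b m f g")
  case True
  then obtain g where g: "in_L2 a b g" "weak_deriv a b m f g" by blast
  then show ?thesis
    using wderiv_eqI[OF g] wderiv_eqI[OF in_L2_uminus[OF g(1)] weak_deriv_uminus[OF g(2)]]
    by (simp add: norm_L2_uminus)
next
  case False
  moreover have "\<not> (\<exists>g. in_L2 a b g \<and> weak_deriv a b m (- f) g)"
    using False in_L2_uminus weak_deriv_uminus by (metis minus_minus)
  ultimately have "(\<lambda>g. in_L2 a b g \<and> weak_deriv a b m (- f) g) = (\<lambda>g. in_L2 a b g \<and> weak_deriv a b m f g)"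
    by blast
  then have "wderiv a b m (- f) = wderiv a b m f" unfolding wderiv_def by (rule arg_cong)
  then show ?thesis by simp
qed

lemma normed_carrier_sobolev:
  "normed_carrier (sobolev k a b :: ('a::{real_normed_field,euclidean_space}, 'a aefun) normed_space)"
proof -
  let ?S = "sobolev k a b :: ('a, 'a aefun) normed_space"
  interpret vector_space "scal ?S" by (simp add: vector_space_scale_aefun)
  have add: "f + g \<in> carr ?S" if fg: "f \<in> carr ?S" "g \<in> carr ?S" for f g
  proof -
    have "\<exists>h. in_L2 a b h \<and> weak_deriv a b m (f + g) h" if "m \<le> k" for m
      using sobolev_wderiv[OF fg(1) that] sobolev_wderiv[OF fg(2) that] fg
      by (intro exI[of _ "wderiv a b m f + wderiv a b m g"] conjI in_L2_add weak_deriv_add) auto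
    then show ?thesis using fg in_L2_add by auto
  qed
  have scale: "scale_aefun c f \<in> carr ?S" if f: "f \<in> carr ?S" for c f
  proof -
    have "\<exists>h. in_L2 a b h \<and> weak_deriv a b m (scale_aefun c f) h" if "m \<le> k" for m
      using sobolev_wderiv[OF f that]
      by (intro exI[of _ "scale_aefun c (wderiv a b m f)"] conjI in_L2_scale weak_deriv_scale) auto
    then show ?thesis using f in_L2_scale by auto
  qed
  show ?thesis
  proof (intro normed_carrier.intro normed_carrier_axioms.intro)
    show "vector_space (scal ?S)" by (simp add: vector_space_scale_aefun)
    show "subspace (carr ?S)"
    proof -
      have zero: "0 \<in> carr ?S" by (auto intro!: exI[of _ 0] in_L2_zero weak_deriv_zero)
      have scale': "scal ?S c f \<in> carr ?S" if "f \<in> carr ?S" for c f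
        unfolding sobolev_simps(2) using that by (rule scale)
      show ?thesis unfolding subspace_def by (intro conjI ballI allI zero add scale')
    qed
    fix x :: "'a aefun"
    show "0 \<le> nrm ?S x" by (simp add: nrm_sobolev)
    show "nrm ?S (- x) = nrm ?S x" by (simp add: nrm_sobolev norm_L2_wderiv_uminus)
    assume x: "x \<in> carr ?S"
    show "x = 0" if "nrm ?S x = 0"
    proof -
      have "norm_L2 x \<le> 0" using norm_L2_wderiv_le[of 0 k a b x] that x by (simp add: wderiv_0)
      then show ?thesis using norm_L2_eq_0_imp[of a b x] norm_L2_nonneg[of x] x by auto
    qed
    show "nrm ?S (scal ?S c x) = norm c * nrm ?S x" for c
    proof -
      have "nrm ?S (scal ?S c x) = L2_set (\<lambda>m. norm c * norm_L2 (wderiv a b m x)) {..k}"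
        unfolding nrm_sobolev by (rule L2_set_cong) (simp_all add: wderiv_scale[OF x] norm_L2_scale)
      then show ?thesis by (simp add: nrm_sobolev L2_set_right_distrib)
    qed
    fix y assume y: "y \<in> carr ?S"
    have "nrm ?S (x + y) \<le> L2_set (\<lambda>m. norm_L2 (wderiv a b m x) + norm_L2 (wderiv a b m y)) {..k}"
      unfolding nrm_sobolev
    proof (rule L2_set_mono)
      fix m assume "m \<in> {..k}"
      then have "m \<le> k" by simp
      then show "norm_L2 (wderiv a b m (x + y)) \<le> norm_L2 (wderiv a b m x) + norm_L2 (wderiv a b m y)"
        using norm_L2_triangle sobolev_wderiv(1)[OF x] sobolev_wderiv(1)[OF y]
        by (metis wderiv_add[OF x y])
    qed (rule norm_L2_nonneg)
    also have "\<dots> \<le> nrm ?S x + nrm ?S y"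
      unfolding nrm_sobolev by (rule L2_set_triangle_ineq)
    finally show "nrm ?S (x + y) \<le> nrm ?S x + nrm ?S y" .
  qed
qed

text \<open>The Sobolev norm is at most the sum of the k + 1 derivative norms, hence the factor
  \<open>Suc k\<close>. Exhibiting some derivative \<open>g\<close> with a bound suffices, since it
  equals \<open>wderiv\<close> by uniqueness.\<close>

lemma bounded_operator_sobolevI:
  fixes T :: "'a::{real_normed_field,euclidean_space} aefun \<Rightarrow> 'a aefun"
  assumes add: "\<And>f g. f \<in> carr (sobolev n a b) \<Longrightarrow> g \<in> carr (sobolev n a b) \<Longrightarrow> T (f + g) = T f + T g"
    and scale: "\<And>f s. f \<in> carr (sobolev n a b) \<Longrightarrow> T (scale_aefun s f) = scale_aefun s (T f)"
    and L2: "\<And>f. f \<in> carr (sobolev n a b) \<Longrightarrow> in_L2 c d (T f)"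
    and ex: "\<And>f i. f \<in> carr (sobolev n a b) \<Longrightarrow> i \<le> k \<Longrightarrow>
      \<exists>g. in_L2 c d g \<and> weak_deriv c d i (T f) g \<and> norm_L2 g \<le> C * nrm (sobolev n a b) f"
  shows "bounded_operator (sobolev n a b) (sobolev k c d) T"
proof (rule bounded_operatorI[where C = "real (Suc k) * C"])
  fix f :: "'a aefun" assume f: "f \<in> carr (sobolev n a b)"
  have w: "in_L2 c d (wderiv c d i (T f)) \<and> norm_L2 (wderiv c d i (T f)) \<le> C * nrm (sobolev n a b) f"
    if "i \<le> k" for i
    using ex[OF f that] wderiv_eqI by metis
  show "T f \<in> carr (sobolev k c d)" using L2[OF f] ex[OF f] by auto
  have "nrm (sobolev k c d) (T f) \<le> (\<Sum>m\<le>k. C * nrm (sobolev n a b) f)"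
    using nrm_sobolev_le by (rule order_trans) (intro sum_mono, use w in auto)
  then show "nrm (sobolev k c d) (T f) \<le> real (Suc k) * C * nrm (sobolev n a b) f" by simp
qed (use add scale in auto)

lemma restrict_add: "restrict_aefun c d (f + g) = restrict_aefun c d f + restrict_aefun c d g"
  by transfer auto

lemma restrict_scale: "restrict_aefun c d (scale_aefun s f) = scale_aefun s (restrict_aefun c d f)"
  by transfer auto

lemma shift_add: "shift_aefun h (f + g) = shift_aefun h f + shift_aefun h g"
  by transfer auto

lemma shift_scale: "shift_aefun h (scale_aefun s f) = scale_aefun s (shift_aefun h f)"
  by transfer auto

lemma wderiv_restrict:
  assumes "f \<in> carr (sobolev k a b)" "i \<le> k" "a \<le> c" "d \<le> b"
  shows "wderiv c d i (restrict_aefun c d f) = restrict_aefun c d (wderiv a b i f)"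
  using sobolev_wderiv[OF assms(1,2)] assms(3,4)
  by (intro wderiv_eqI in_L2_restrict weak_deriv_restrict)

lemma bounded_operator_restrict:
  assumes "a \<le> c" "d \<le> b"
  shows "bounded_operator (sobolev k a b) (sobolev k c d) (restrict_aefun c d)"
proof (rule bounded_operator_sobolevI[where C = 1])
  fix f :: "'a aefun" and i assume f: "f \<in> carr (sobolev k a b)"
  show "in_L2 c d (restrict_aefun c d f)" using f by (auto intro: in_L2_restrict)
  assume i: "i \<le> k"
  note w = sobolev_wderiv[OF f i]
  have "norm_L2 (restrict_aefun c d (wderiv a b i f)) \<le> nrm (sobolev k a b) f"
    by (rule order_trans[OF norm_L2_restrict[OF w(1)] norm_L2_wderiv_le[OF i]])
  then show "\<exists>g. in_L2 c d g \<and> weak_deriv c d i (restrict_aefun c d f) g \<and> norm_L2 g \<le> 1 * nrm (sobolev k a b) f"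
    using in_L2_restrict[OF w(1)] weak_deriv_restrict[OF w(2) assms] by auto
qed (simp_all add: restrict_add restrict_scale)

lemma wderiv_shift:
  assumes "f \<in> carr (sobolev k a b)" "i \<le> k"
  shows "wderiv (a - h) (b - h) i (shift_aefun h f) = shift_aefun h (wderiv a b i f)"
  using sobolev_wderiv[OF assms] assms(1)
  by (intro wderiv_eqI in_L2_shift weak_deriv_shift) auto

lemma bounded_operator_shift:
  "bounded_operator (sobolev k a b) (sobolev k (a - h) (b - h)) (shift_aefun h)"
proof (rule bounded_operator_sobolevI[where C = 1])
  fix f :: "'a aefun" and i assume f: "f \<in> carr (sobolev k a b)"
  then have f0: "in_L2 a b f" by simp
  show "in_L2 (a - h) (b - h) (shift_aefun h f)" using f0 by (rule in_L2_shift)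
  assume i: "i \<le> k"
  note w = sobolev_wderiv[OF f i]
  show "\<exists>g. in_L2 (a - h) (b - h) g \<and> weak_deriv (a - h) (b - h) i (shift_aefun h f) g
      \<and> norm_L2 g \<le> 1 * nrm (sobolev k a b) f"
    using in_L2_shift[OF w(1)] weak_deriv_shift[OF w(2) f0 w(1)] norm_L2_shift[OF w(1)]
      norm_L2_wderiv_le[OF i, of a b f] by (metis mult_1)
qed (simp_all add: shift_add shift_scale)

lemma wderiv_wderiv:
  assumes "f \<in> carr (sobolev (i + k) a b)" "j \<le> k"
  shows "wderiv a b j (wderiv a b i f) = wderiv a b (j + i) f"
    and "weak_deriv a b j (wderiv a b i f) (wderiv a b (j + i) f)"
proof -
  have i: "i \<le> i + k" "j + i \<le> i + k" using assms(2) by auto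
  show "weak_deriv a b j (wderiv a b i f) (wderiv a b (j + i) f)"
    using sobolev_wderiv(2)[OF assms(1) i(2)] weak_deriv_trans_iff[OF sobolev_wderiv(2)[OF assms(1) i(1)]]
    by blast
  then show "wderiv a b j (wderiv a b i f) = wderiv a b (j + i) f"
    using sobolev_wderiv(1)[OF assms(1) i(2)] by (intro wderiv_eqI)
qed

lemma bounded_operator_wderiv:
  "bounded_operator (sobolev (i + k) a b) (sobolev k a b) (wderiv a b i)"
proof (rule bounded_operator_sobolevI[where C = 1])
  fix f :: "'a aefun" and j assume f: "f \<in> carr (sobolev (i + k) a b)"
  show "in_L2 a b (wderiv a b i f)" using sobolev_wderiv(1)[OF f] by simp
  assume j: "j \<le> k"
  show "\<exists>g. in_L2 a b g \<and> weak_deriv a b j (wderiv a b i f) g \<and> norm_L2 g \<le> 1 * nrm (sobolev (i + k) a b) f"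
    using wderiv_wderiv(2)[OF f j] sobolev_wderiv(1)[OF f, of "j + i"]
      norm_L2_wderiv_le[of "j + i" "i + k" a b f] j by auto
qed (auto intro: wderiv_add wderiv_scale)

lemma sobolev_antimono: "j \<le> k \<Longrightarrow> f \<in> carr (sobolev k a b) \<Longrightarrow> f \<in> carr (sobolev j a b)"
  by auto

lemma bounded_operator_inclusion:
  assumes "j \<le> k" shows "bounded_operator (sobolev k a b) (sobolev j a b) (\<lambda>f. f)"
proof (rule bounded_operator_id[where C = 1])
  show "nrm (sobolev j a b) f \<le> 1 * nrm (sobolev k a b) f" for f
    unfolding nrm_sobolev L2_set_def using assms by (auto intro!: real_sqrt_le_mono sum_mono2)
qed (use assms in auto)

text \<open>Functions are stored with their extension by zero, so the extension operator is the
  identity. Order zero is essential, since jumps at the endpoints would spoil weak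
  derivatives.\<close>

lemma bounded_operator_L2_extension:
  assumes "a \<le> c" "d \<le> b" shows "bounded_operator (sobolev 0 c d) (sobolev 0 a b) (\<lambda>f. f)"
proof (rule bounded_operator_id[where C = 1])
  show "carr (sobolev 0 c d) \<subseteq> carr (sobolev 0 a b)"
    using in_L2_mono[OF _ assms] unfolding subset_iff sobolev_0 by blast
  show "nrm (sobolev 0 a b) f \<le> 1 * nrm (sobolev 0 c d) f" if "f \<in> carr (sobolev 0 c d)" for f
  proof -
    have "in_L2 c d f" using that unfolding sobolev_0 .
    then show ?thesis by (simp add: nrm_sobolev_0 in_L2_mono[OF _ assms])
  qed
qed simp

section \<open>Integrals, means and primitives\<close>

lift_definition interval_integral :: "real \<Rightarrow> real \<Rightarrow> 'a::euclidean_space aefun \<Rightarrow> 'a"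
  is "\<lambda>c d f. LINT x|lebesgue. indicator {c<..<d} x *\<^sub>R f x"
  by (rule integral_lebesgue_cong_AE(2)) (erule eventually_mono, simp)

lift_definition unit_aefun :: "real \<Rightarrow> real \<Rightarrow> 'a::{zero,one} aefun"
  is "\<lambda>a b x. if a < x \<and> x < b then 1 else 0" .

lift_definition primitive_aefun :: "real \<Rightarrow> real \<Rightarrow> 'a::euclidean_space aefun \<Rightarrow> 'a aefun"
  is "\<lambda>a b f t. if a < t \<and> t < b then primitive a f t else 0"
proof -
  fix a b and f g :: "real \<Rightarrow> 'a"
  assume eq: "AE x in lebesgue. f x = g x"
  have "primitive a f t = primitive a g t" for t
    unfolding primitive_def by (rule integral_lebesgue_cong_AE(2)) (rule eventually_mono[OF eq], simp)
  then show "AE t in lebesgue. (if a < t \<and> t < b then primitive a f t else 0)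
      = (if a < t \<and> t < b then primitive a g t else 0)" by simp
qed

lemma interval_integral_add:
  assumes "in_L2 a b f" "in_L2 a b g"
  shows "interval_integral c d (f + g) = interval_integral c d f + interval_integral c d g"
  using assms
proof transfer
  fix a b c d and f g :: "real \<Rightarrow> 'a"
  assume "L2_on a b f" "L2_on a b g"
  then have "integrable lebesgue (\<lambda>x. indicator {c<..<d} x *\<^sub>R f x)" "integrable lebesgue (\<lambda>x. indicator {c<..<d} x *\<^sub>R g x)"
    by (auto intro!: integrable_indicator_lebesgue dest: L2_on_integrable)
  then show "(LINT x|lebesgue. indicator {c<..<d} x *\<^sub>R (f x + g x))
      = (LINT x|lebesgue. indicator {c<..<d} x *\<^sub>R f x) + (LINT x|lebesgue. indicator {c<..<d} x *\<^sub>R g x)"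
    by (simp add: scaleR_add_right)
qed

lemma interval_integral_scale:
  fixes f :: "'a::{real_normed_field,euclidean_space} aefun"
  shows "interval_integral c d (scale_aefun s f) = s * interval_integral c d f"
  by transfer (simp only: mult_scaleR_right[symmetric] integral_mult_right_zero)

lemma norm_interval_integral_le:
  assumes "in_L2 a b f" "c \<le> d"
  shows "norm (interval_integral c d f) \<le> sqrt (d - c) * norm_L2 f"
  using assms
proof transfer
  fix a b c d and f :: "real \<Rightarrow> 'a"
  assume f: "L2_on a b f" and cd: "c \<le> (d::real)"
  have "norm (LINT x|lebesgue. indicator {c<..<d} x *\<^sub>R f x) \<le> (LINT x|lebesgue. norm (indicator {c<..<d} x *\<^sub>R f x))"
    by (rule integral_norm_bound)
  also have "\<dots> = (LINT x|lebesgue. indicator {c<..<d} x * norm (f x))" by simp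
  also have "\<dots> \<le> sqrt (d - c) * sqrt (LINT x|lebesgue. (norm (f x))\<^sup>2)"
    by (rule integral_interval_Cauchy_Schwarz[OF L2_on_measurable[OF f] L2_on_square[OF f] cd])
  finally show "norm (LINT x|lebesgue. indicator {c<..<d} x *\<^sub>R f x) \<le> sqrt (d - c) * sqrt (LINT x|lebesgue. (norm (f x))\<^sup>2)" .
qed

lemma interval_integral_split:
  assumes "in_L2 a b f" "c \<le> s" "s \<le> d"
  shows "interval_integral c d f = interval_integral c s f + interval_integral s d f"
  using assms
proof transfer
  fix a b c s d and f :: "real \<Rightarrow> 'a"
  assume f: "L2_on a b f" and cd: "c \<le> s" "s \<le> (d::real)"
  have i: "integrable lebesgue (\<lambda>x. indicator {u<..<v} x *\<^sub>R f x)" for u v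
    using L2_on_integrable[OF f] by (rule integrable_indicator_lebesgue) simp
  have "AE x in lebesgue. x \<noteq> s" by (intro AE_lebesgue_lborel AE_lborel_singleton)
  then have "AE x in lebesgue. indicator {c<..<d} x *\<^sub>R f x
      = indicator {c<..<s} x *\<^sub>R f x + indicator {s<..<d} x *\<^sub>R f x"
    by eventually_elim (use cd in \<open>auto simp: indicator_def\<close>)
  then have "(LINT x|lebesgue. indicator {c<..<d} x *\<^sub>R f x)
      = (LINT x|lebesgue. indicator {c<..<s} x *\<^sub>R f x + indicator {s<..<d} x *\<^sub>R f x)"
    by (rule integral_lebesgue_cong_AE(2))
  then show "(LINT x|lebesgue. indicator {c<..<d} x *\<^sub>R f x)
      = (LINT x|lebesgue. indicator {c<..<s} x *\<^sub>R f x) + (LINT x|lebesgue. indicator {s<..<d} x *\<^sub>R f x)"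
    using i by simp
qed

lemma interval_integral_unit:
  "a \<le> c \<Longrightarrow> c \<le> d \<Longrightarrow> d \<le> b \<Longrightarrow>
    interval_integral c d (unit_aefun a b :: 'a::{real_normed_field,euclidean_space} aefun) = of_real (d - c)"
proof (transfer fixing: a b c d)
  assume *: "a \<le> c" "c \<le> d" "d \<le> b"
  have "(\<lambda>x. indicator {c<..<d} x *\<^sub>R (if a < x \<and> x < b then 1 else 0)) = (\<lambda>x. indicator {c<..<d} x *\<^sub>R (1::'a))"
    using * by (auto simp: fun_eq_iff indicator_def)
  then show "(LINT x|lebesgue. indicator {c<..<d} x *\<^sub>R (if a < x \<and> x < b then 1 else (0::'a))) = of_real (d - c)"
    using * emeasure_lebesgue_bounded[of "{c<..<d}"] by (simp add: measure_completion scaleR_conv_of_real)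
qed

lemma interval_integral_unit_disjoint:
  "d \<le> a \<or> b \<le> c \<Longrightarrow>
    interval_integral c d (unit_aefun a b :: 'a::{real_normed_field,euclidean_space} aefun) = 0"
proof (transfer fixing: a b c d)
  assume *: "d \<le> a \<or> b \<le> c"
  have "(\<lambda>x. indicator {c<..<d} x *\<^sub>R (if a < x \<and> x < b then 1 else 0)) = (\<lambda>x. 0 :: 'a)"
    using * by (auto simp: fun_eq_iff indicator_def)
  then show "(LINT x|lebesgue. indicator {c<..<d} x *\<^sub>R (if a < x \<and> x < b then 1 else (0::'a))) = 0" by simp
qed

definition interval_mean :: "real \<Rightarrow> real \<Rightarrow> 'a::{real_normed_field,euclidean_space} aefun \<Rightarrow> 'a" where
  "interval_mean c d f = of_real (1 / (d - c)) * interval_integral c d f"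

lemma bounded_operator_interval_mean:
  assumes "c < d" shows "bounded_operator (sobolev 0 a b) scalars (interval_mean c d)"
proof (rule bounded_operatorI[where C = "1 / (d - c) * sqrt (d - c)"])
  fix f g :: "'a aefun" assume f: "f \<in> carr (sobolev 0 a b)" and g: "g \<in> carr (sobolev 0 a b)"
  show "interval_mean c d (f + g) = interval_mean c d f + interval_mean c d g"
    using interval_integral_add[of a b f g c d] f g unfolding sobolev_0
    by (simp add: interval_mean_def distrib_left)
  show "interval_mean c d (scal (sobolev 0 a b) s f) = scal scalars s (interval_mean c d f)" for s
    by (simp add: interval_mean_def interval_integral_scale)
  show "nrm scalars (interval_mean c d f) \<le> 1 / (d - c) * sqrt (d - c) * nrm (sobolev 0 a b) f"
  proof -
    have f': "in_L2 a b f" using f unfolding sobolev_0 .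
    have "norm (interval_mean c d f) = 1 / (d - c) * norm (interval_integral c d f)"
      unfolding interval_mean_def norm_mult norm_of_real using assms by simp
    also have "\<dots> \<le> 1 / (d - c) * (sqrt (d - c) * norm_L2 f)"
      using assms by (intro mult_left_mono norm_interval_integral_le[OF f']) simp_all
    finally show ?thesis by (simp add: nrm_sobolev_0[OF f'])
  qed
qed simp

lemma in_L2_unit: "in_L2 a b (unit_aefun a b :: 'a::{real_normed_field,euclidean_space} aefun)"
proof transfer
  fix a b :: real
  have eq: "(\<lambda>x. if a < x \<and> x < b then 1 else 0) = (\<lambda>x. indicator {a<..<b} x *\<^sub>R (1::'a))"
    "(\<lambda>x. (norm (if a < x \<and> x < b then 1 else (0::'a)))\<^sup>2) = (\<lambda>x. indicator {a<..<b} x *\<^sub>R (1::real))"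
    by (auto simp: fun_eq_iff indicator_def)
  have "(\<lambda>x. if a < x \<and> x < b then 1 else (0::'a)) \<in> borel_measurable lebesgue"
    unfolding eq(1) using integrable_indicator_interval by (rule borel_measurable_integrable)
  moreover have "integrable lebesgue (\<lambda>x. (norm (if a < x \<and> x < b then 1 else (0::'a)))\<^sup>2)"
    unfolding eq(2) by (rule integrable_indicator_interval)
  ultimately show "L2_on a b (\<lambda>x. if a < x \<and> x < b then 1 else (0::'a))" by (simp add: L2_on_def)
qed

lemma weak_deriv_unit: "weak_deriv a b (Suc m) (unit_aefun a b :: 'a::{real_normed_field,euclidean_space} aefun) 0"
proof (transfer, intro allI impI)
  fix a b m \<phi> assume t: "test_function a b \<phi>"
  define \<psi> where "\<psi> = (deriv ^^ m) \<phi>"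
  have "test_function a b \<psi>" unfolding \<psi>_def by (rule test_function_funpow_deriv[OF t])
  \<comment> \<open>The formula for the integral of a derivative wants its lower limit strictly
    inside the interval; widening to (a - 1, b) admits the limit \<open>a\<close>.\<close>
  then have \<psi>: "test_function (a - 1) b \<psi>" by (rule test_function_mono) auto
  have "(LINT x|lebesgue. deriv \<psi> x *\<^sub>R (if a < x \<and> x < b then 1 else (0::'a))) = 0"
  proof (cases "a < b")
    case True
    have [measurable]: "deriv \<psi> \<in> borel_measurable borel"
      by (rule test_function_borel[OF test_function_deriv[OF \<psi>]])
    have 1: "(LINT x|lborel. indicator {a<..<b} x * deriv \<psi> x) = 0"
      using test_function_integral_deriv[OF \<psi>, of a] True
        test_function_outside[OF \<open>test_function a b \<psi>\<close>, of a] by simp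
    have i: "integrable lebesgue (\<lambda>x. indicator {a<..<b} x * deriv \<psi> x)"
      using integrable_test_function[OF test_function_deriv[OF \<psi>] integrable_indicator_interval[of a b "1::real"]]
      by (simp add: mult.commute)
    have "(LINT x|lebesgue. deriv \<psi> x *\<^sub>R (if a < x \<and> x < b then 1 else (0::'a)))
        = (LINT x|lebesgue. (indicator {a<..<b} x * deriv \<psi> x) *\<^sub>R (1::'a))"
      by (rule Bochner_Integration.integral_cong) (auto simp: indicator_def)
    also have "\<dots> = (LINT x|lebesgue. indicator {a<..<b} x * deriv \<psi> x) *\<^sub>R (1::'a)"
      using i by simp
    also have "(LINT x|lebesgue. indicator {a<..<b} x * deriv \<psi> x) = (LINT x|lborel. indicator {a<..<b} x * deriv \<psi> x)"
      by (rule integral_completion) measurable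
    finally show ?thesis using 1 by simp
  next
    case False
    then have "(\<lambda>x. deriv \<psi> x *\<^sub>R (if a < x \<and> x < b then 1 else (0::'a))) = (\<lambda>x. 0)" by auto
    then show ?thesis by simp
  qed
  then show "(LINT x|lebesgue. (deriv ^^ Suc m) \<phi> x *\<^sub>R (if a < x \<and> x < b then 1 else (0::'a)))
      = (-1) ^ Suc m *\<^sub>R (LINT x|lebesgue. \<phi> x *\<^sub>R (0::'a))"
    by (simp add: \<psi>_def)
qed

lemma weak_deriv_1_eq_0_imp_const:
  fixes f :: "'a::{real_normed_field,euclidean_space} aefun"
  assumes "in_L2 a b f" "weak_deriv a b 1 f 0"
  shows "\<exists>C. f = scale_aefun C (unit_aefun a b)"
  using assms
proof transfer
  fix a b and f :: "real \<Rightarrow> 'a"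
  assume f: "L2_on a b f" and w: "\<forall>\<phi>. test_function a b \<phi> \<longrightarrow>
      (LINT x|lebesgue. (deriv ^^ 1) \<phi> x *\<^sub>R f x) = (-1) ^ 1 *\<^sub>R (LINT x|lebesgue. \<phi> x *\<^sub>R 0)"
  obtain C where "AE x in lebesgue. x \<in> {a<..<b} \<longrightarrow> f x = C"
    using du_Bois_Reymond[OF L2_on_integrable[OF f], of a b] w by auto
  then have "AE x in lebesgue. f x = C * (if a < x \<and> x < b then 1 else 0)"
    using conjunct1[OF f[unfolded L2_on_def]] by eventually_elim auto
  then show "\<exists>C. AE x in lebesgue. f x = C * (if a < x \<and> x < b then 1 else 0)" by blast
qed

text \<open>Used twice: with the Cauchy-Schwarz bound on the integrals it makes the primitive a
  bounded operator, and with the much smaller bound for functions of vanishing cell means it yields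
  the smallness of the perturbation.\<close>

lemma primitive_aefun_bound:
  fixes g :: "'a::{real_normed_field,euclidean_space} aefun"
  assumes "in_L2 a b g" "a \<le> b" "0 \<le> K"
    and "\<And>t. a < t \<Longrightarrow> t < b \<Longrightarrow> norm (interval_integral a t g) \<le> K"
  shows "in_L2 a b (primitive_aefun a b g)" "norm_L2 (primitive_aefun a b g) \<le> sqrt (b - a) * K"
proof -
  have "in_L2 a b (primitive_aefun a b g) \<and> norm_L2 (primitive_aefun a b g) \<le> sqrt (b - a) * K"
    using assms
  proof (transfer fixing: K)
    fix a b and g :: "real \<Rightarrow> 'a"
    assume g: "L2_on a b g" and ab: "a \<le> b" "0 \<le> K"
      and K: "\<And>t. a < t \<Longrightarrow> t < b \<Longrightarrow> norm (LINT x|lebesgue. indicator {a<..<t} x *\<^sub>R g x) \<le> K"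
    define F where "F t = (if a < t \<and> t < b then primitive a g t else 0)" for t
    have [measurable]: "primitive a g \<in> borel_measurable borel"
      by (rule primitive_borel_measurable[OF L2_on_measurable[OF g]])
    have "F \<in> borel_measurable borel" unfolding F_def[abs_def] by measurable
    then have "F \<in> borel_measurable lebesgue" by (auto intro: measurable_completion)
    moreover have "F t = 0" if "t \<notin> {a<..<b}" for t using that by (auto simp: F_def)
    moreover have "norm (F t) \<le> K" if "t \<in> {a<..<b}" for t using that K by (auto simp: F_def primitive_def)
    ultimately have "L2_on a b F \<and> sqrt (LINT x|lebesgue. (norm (F x))\<^sup>2) \<le> sqrt (b - a) * K"
      using L2_on_bounded[OF ab(1) _ _ _ ab(2), of F] by blast
    then show "L2_on a b (\<lambda>t. if a < t \<and> t < b then primitive a g t else 0) \<and>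
        sqrt (LINT x|lebesgue. (norm (if a < x \<and> x < b then primitive a g x else 0))\<^sup>2) \<le> sqrt (b - a) * K"
      unfolding F_def[abs_def] .
  qed
  then show "in_L2 a b (primitive_aefun a b g)" "norm_L2 (primitive_aefun a b g) \<le> sqrt (b - a) * K" by auto
qed

lemma weak_deriv_primitive: "in_L2 a b g \<Longrightarrow> weak_deriv a b 1 (primitive_aefun a b g) g"
proof transfer
  fix a b and g :: "real \<Rightarrow> 'a"
  assume g: "L2_on a b g"
  show "\<forall>\<phi>. test_function a b \<phi> \<longrightarrow>
      (LINT x|lebesgue. (deriv ^^ 1) \<phi> x *\<^sub>R (if a < x \<and> x < b then primitive a g x else 0))
      = (-1) ^ 1 *\<^sub>R (LINT x|lebesgue. \<phi> x *\<^sub>R g x)"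
    using primitive_by_parts[OF L2_on_integrable[OF g]] by simp
qed

lemma primitive_aefun_add:
  "in_L2 a b f \<Longrightarrow> in_L2 a b g \<Longrightarrow> primitive_aefun a b (f + g) = primitive_aefun a b f + primitive_aefun a b g"
proof transfer
  fix a b and f g :: "real \<Rightarrow> 'a"
  assume "L2_on a b f" "L2_on a b g"
  then have "integrable lebesgue (\<lambda>x. indicator {c<..<d} x *\<^sub>R f x)" "integrable lebesgue (\<lambda>x. indicator {c<..<d} x *\<^sub>R g x)" for c d
    by (auto intro!: integrable_indicator_lebesgue dest: L2_on_integrable)
  then have "primitive a (\<lambda>x. f x + g x) t = primitive a f t + primitive a g t" for t
    by (simp add: primitive_def scaleR_add_right)
  then show "AE t in lebesgue. (if a < t \<and> t < b then primitive a (\<lambda>x. f x + g x) t else 0)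
      = (if a < t \<and> t < b then primitive a f t else 0) + (if a < t \<and> t < b then primitive a g t else 0)"
    by simp
qed

lemma primitive_aefun_scale:
  fixes f :: "'a::{real_normed_field,euclidean_space} aefun"
  shows "primitive_aefun a b (scale_aefun s f) = scale_aefun s (primitive_aefun a b f)"
proof transfer
  fix a b s and f :: "real \<Rightarrow> 'a"
  have "primitive a (\<lambda>x. s * f x) t = s * primitive a f t" for t
    unfolding primitive_def by (simp only: mult_scaleR_right[symmetric] integral_mult_right_zero)
  then show "AE t in lebesgue. (if a < t \<and> t < b then primitive a (\<lambda>x. s * f x) t else 0)
      = s * (if a < t \<and> t < b then primitive a f t else 0)" by simp
qed

lemma bounded_operator_primitive:
  assumes ab: "a \<le> b"
  shows "bounded_operator (sobolev 0 a b) (sobolev 0 a b)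
    (primitive_aefun a b :: 'a::{real_normed_field,euclidean_space} aefun \<Rightarrow> 'a aefun)"
proof (rule bounded_operatorI[where C = "sqrt (b - a) * sqrt (b - a)"])
  fix f g :: "'a aefun" assume fg: "f \<in> carr (sobolev 0 a b)" "g \<in> carr (sobolev 0 a b)"
  then have L: "in_L2 a b f" "in_L2 a b g" by auto
  have "norm (interval_integral a t f) \<le> sqrt (b - a) * norm_L2 f" if "a < t" "t < b" for t
  proof -
    have "norm (interval_integral a t f) \<le> sqrt (t - a) * norm_L2 f"
      using that by (intro norm_interval_integral_le[OF L(1)]) simp
    also have "\<dots> \<le> sqrt (b - a) * norm_L2 f" using that by (intro mult_right_mono norm_L2_nonneg) simp
    finally show ?thesis .
  qed
  from primitive_aefun_bound[OF L(1) ab _ this]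
  have J: "in_L2 a b (primitive_aefun a b f)" "norm_L2 (primitive_aefun a b f) \<le> sqrt (b - a) * (sqrt (b - a) * norm_L2 f)"
    using ab norm_L2_nonneg[of f] by auto
  then show "primitive_aefun a b f \<in> carr (sobolev 0 a b)" unfolding sobolev_0 by simp
  show "nrm (sobolev 0 a b) (primitive_aefun a b f) \<le> sqrt (b - a) * sqrt (b - a) * nrm (sobolev 0 a b) f"
    using J(2) unfolding nrm_sobolev_0[OF J(1)] nrm_sobolev_0[OF L(1)] mult.assoc .
  show "primitive_aefun a b (f + g) = primitive_aefun a b f + primitive_aefun a b g"
    by (rule primitive_aefun_add[OF L])
qed (simp add: primitive_aefun_scale)

text \<open>Normalising primitives to mean zero makes the means of the derivatives, which are bounded
  on \<open>L\<^sub>2\<close>, a system of coordinates; no traces are needed.\<close>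

definition mean_zero_primitive ::
    "real \<Rightarrow> real \<Rightarrow> 'a::{real_normed_field,euclidean_space} aefun \<Rightarrow> 'a aefun" where
  "mean_zero_primitive a b g =
     primitive_aefun a b g - scale_aefun (interval_mean a b (primitive_aefun a b g)) (unit_aefun a b)"

lemma interval_mean_unit:
  assumes "a \<le> c" "c < d" "d \<le> b"
  shows "interval_mean c d (unit_aefun a b :: 'a::{real_normed_field,euclidean_space} aefun) = 1"
proof -
  have "interval_mean c d (unit_aefun a b :: 'a aefun) = of_real (1 / (d - c) * (d - c))"
    using assms by (simp only: interval_mean_def interval_integral_unit less_imp_le of_real_mult)
  then show ?thesis using assms by simp
qed

lemma
  fixes h :: "'a::{real_normed_field,euclidean_space} aefun"
  assumes "a < b"
  shows bounded_operator_subtract_mean: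
      "bounded_operator (sobolev 0 a b) (sobolev 0 a b)
        (\<lambda>h :: 'a aefun. h - scale_aefun (interval_mean a b h) (unit_aefun a b))"
    and interval_mean_subtract_mean: "in_L2 a b h \<Longrightarrow>
      interval_mean a b (h - scale_aefun (interval_mean a b h) (unit_aefun a b)) = 0"
proof -
  let ?S = "sobolev 0 a b :: ('a, 'a aefun) normed_space"
  note n = normed_carrier_sobolev[of 0 a b, where 'a = 'a]
  note m = bounded_operator_interval_mean[OF assms, of a b, where 'a = 'a]
  have u: "unit_aefun a b \<in> carr ?S" unfolding sobolev_0 by (rule in_L2_unit)
  show "bounded_operator ?S ?S (\<lambda>h. h - scale_aefun (interval_mean a b h) (unit_aefun a b))"
    using bounded_operator_diff[OF bounded_operator_inclusion[OF order_refl] bounded_operator_scale_vector[OF m n u] n]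
    by simp
  assume "in_L2 a b h"
  then have h: "h \<in> carr ?S" unfolding sobolev_0 .
  have su: "scale_aefun (interval_mean a b h) (unit_aefun a b) \<in> carr ?S"
    unfolding sobolev_0 by (intro in_L2_scale in_L2_unit)
  have "interval_mean a b (h - scale_aefun (interval_mean a b h) (unit_aefun a b))
      = interval_mean a b h - interval_mean a b (scale_aefun (interval_mean a b h) (unit_aefun a b))"
    by (rule bounded_operator_linear(3)[OF m n normed_carrier_scalars h su])
  also have "interval_mean a b (scale_aefun (interval_mean a b h) (unit_aefun a b))
      = interval_mean a b h * interval_mean a b (unit_aefun a b)"
    using bounded_operatorD(3)[OF m u, of "interval_mean a b h"] by simp
  finally show "interval_mean a b (h - scale_aefun (interval_mean a b h) (unit_aefun a b)) = 0"
    using assms by (simp add: interval_mean_unit)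
qed

lemma in_L2_primitive:
  fixes g :: "'a::{real_normed_field,euclidean_space} aefun"
  shows "a \<le> b \<Longrightarrow> in_L2 a b g \<Longrightarrow> in_L2 a b (primitive_aefun a b g)"
  using bounded_operatorD(1)[OF bounded_operator_primitive] unfolding sobolev_0 by blast

lemma in_L2_mean_zero_primitive:
  "a \<le> b \<Longrightarrow> in_L2 a b g \<Longrightarrow> in_L2 a b (mean_zero_primitive a b g)"
  unfolding mean_zero_primitive_def
  by (intro in_L2_diff in_L2_primitive in_L2_scale in_L2_unit)

lemma interval_mean_mean_zero_primitive:
  "a < b \<Longrightarrow> in_L2 a b g \<Longrightarrow> interval_mean a b (mean_zero_primitive a b g) = 0"
  unfolding mean_zero_primitive_def
  by (intro interval_mean_subtract_mean in_L2_primitive) simp_all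

lemma weak_deriv_mean_zero_primitive:
  assumes "a \<le> b" "in_L2 a b g"
  shows "weak_deriv a b 1 (mean_zero_primitive a b g) g"
proof -
  let ?c = "- scale_aefun (interval_mean a b (primitive_aefun a b g)) (unit_aefun a b)"
  have "weak_deriv a b 1 (scale_aefun s (unit_aefun a b)) (scale_aefun s 0)" for s :: 'a
    using weak_deriv_unit[of a b 0] by (intro weak_deriv_scale) simp
  moreover have "scale_aefun s 0 = (0 :: 'a aefun)" for s by transfer simp
  ultimately have "weak_deriv a b 1 ?c (- 0)" by (intro weak_deriv_uminus) simp
  then have "weak_deriv a b 1 (primitive_aefun a b g + ?c) (g + (- 0))"
    using assms
    by (intro weak_deriv_add in_L2_primitive in_L2_uminus in_L2_scale in_L2_unit in_L2_zero weak_deriv_primitive)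
  then show ?thesis by (simp add: mean_zero_primitive_def)
qed

text \<open>The derivative of order j + 1 of the primitive is the derivative of order j of the
  function, so only order zero requires an estimate; this explains the constant
  \<open>max C 1\<close>.\<close>

lemma bounded_operator_mean_zero_primitive:
  assumes ab: "a < b"
  shows "bounded_operator (sobolev k a b) (sobolev (Suc k) a b)
    (mean_zero_primitive a b :: 'a::{real_normed_field,euclidean_space} aefun \<Rightarrow> 'a aefun)"
proof -
  let ?S = "sobolev 0 a b :: ('a, 'a aefun) normed_space"
  let ?J = "mean_zero_primitive a b :: 'a aefun \<Rightarrow> 'a aefun"
  note n = normed_carrier_sobolev[of 0 a b, where 'a = 'a]
  have J0: "bounded_operator ?S ?S ?J"
    unfolding mean_zero_primitive_def
    by (rule bounded_operator_compose[OF bounded_operator_primitive bounded_operator_subtract_mean n])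
      (use ab in auto)
  obtain C where C: "0 \<le> C" "\<And>g. g \<in> carr ?S \<Longrightarrow> nrm ?S (?J g) \<le> C * nrm ?S g"
    using bounded_operator_bound[OF J0 n] by blast
  show ?thesis
  proof (rule bounded_operator_sobolevI[where C = "max C 1"])
    fix f g :: "'a aefun" assume f: "f \<in> carr (sobolev k a b)"
    then have f0: "f \<in> carr ?S" "in_L2 a b f" unfolding sobolev_0 by auto
    show "?J (f + g) = ?J f + ?J g" if "g \<in> carr (sobolev k a b)"
      using bounded_operatorD(2)[OF J0 f0(1)] that unfolding sobolev_0 by auto
    show "?J (scale_aefun s f) = scale_aefun s (?J f)" for s
      using bounded_operatorD(3)[OF J0 f0(1)] by simp
    show L: "in_L2 a b (?J f)" using f0 ab by (intro in_L2_mean_zero_primitive) auto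
    fix i assume i: "i \<le> Suc k"
    have ff: "0 \<le> nrm (sobolev k a b) f" by (rule normed_carrier.nrm_ge_0[OF normed_carrier_sobolev])
    show "\<exists>g. in_L2 a b g \<and> weak_deriv a b i (?J f) g \<and> norm_L2 g \<le> max C 1 * nrm (sobolev k a b) f"
    proof (cases i)
      case 0
      have "norm_L2 (?J f) \<le> C * norm_L2 f"
        using C(2)[OF f0(1)] unfolding nrm_sobolev_0[OF L] nrm_sobolev_0[OF f0(2)] .
      also have "norm_L2 f \<le> nrm (sobolev k a b) f"
        using norm_L2_wderiv_le[of 0 k a b f] wderiv_0[OF f0(2)] by simp
      finally have "norm_L2 (?J f) \<le> C * nrm (sobolev k a b) f"
        using C(1) by (auto intro: mult_left_mono)
      also have "\<dots> \<le> max C 1 * nrm (sobolev k a b) f" using ff by (intro mult_right_mono) auto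
      finally show ?thesis using L weak_deriv_0 0 by blast
    next
      case (Suc j)
      then have j: "j \<le> k" using i by simp
      note w = sobolev_wderiv[OF f j]
      have "weak_deriv a b (j + 1) (?J f) (wderiv a b j f)"
        using weak_deriv_trans_iff[OF weak_deriv_mean_zero_primitive[OF _ f0(2)]] w(2) ab by simp
      moreover have "norm_L2 (wderiv a b j f) \<le> max C 1 * nrm (sobolev k a b) f"
      proof -
        have "norm_L2 (wderiv a b j f) \<le> 1 * nrm (sobolev k a b) f" using norm_L2_wderiv_le[OF j] by simp
        also have "\<dots> \<le> max C 1 * nrm (sobolev k a b) f" using ff by (intro mult_right_mono) auto
        finally show ?thesis .
      qed
      ultimately show ?thesis using w(1) Suc by auto
    qed
  qed
qed

section \<open>Iterated primitives and coordinates by means of derivatives\<close>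

lemma bounded_operator_funpow_mean_zero_primitive:
  assumes ab: "a < b"
  shows "bounded_operator (sobolev 0 a b) (sobolev m a b)
    (mean_zero_primitive a b ^^ m :: 'a::{real_normed_field,euclidean_space} aefun \<Rightarrow> 'a aefun)"
proof (induction m)
  case 0
  then show ?case using bounded_operator_inclusion[OF order_refl] by (simp add: id_def)
next
  case (Suc m)
  from bounded_operator_compose[OF Suc bounded_operator_mean_zero_primitive[OF ab] normed_carrier_sobolev]
  show ?case by (simp add: comp_def)
qed

lemma in_L2_funpow_mean_zero_primitive:
  "a \<le> b \<Longrightarrow> in_L2 a b g \<Longrightarrow> in_L2 a b ((mean_zero_primitive a b ^^ i) g)"
  by (induction i) (auto intro: in_L2_mean_zero_primitive)

lemma weak_deriv_funpow_mean_zero_primitive: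
  assumes "a \<le> b" "in_L2 a b g"
  shows "weak_deriv a b i ((mean_zero_primitive a b ^^ (i + j)) g) ((mean_zero_primitive a b ^^ j) g)"
proof (induction i)
  case 0
  then show ?case using weak_deriv_0 by simp
next
  case (Suc i)
  have "weak_deriv a b 1 ((mean_zero_primitive a b ^^ (Suc i + j)) g) ((mean_zero_primitive a b ^^ (i + j)) g)"
    using weak_deriv_mean_zero_primitive[OF assms(1) in_L2_funpow_mean_zero_primitive[OF assms, of "i + j"]] by simp
  from weak_deriv_trans_iff[OF this, of i] Suc show ?case by simp
qed

lemma wderiv_funpow_mean_zero_primitive:
  assumes "a \<le> b" "in_L2 a b g"
  shows "wderiv a b i ((mean_zero_primitive a b ^^ (i + j)) g) = (mean_zero_primitive a b ^^ j) g"
  by (rule wderiv_eqI[OF in_L2_funpow_mean_zero_primitive[OF assms] weak_deriv_funpow_mean_zero_primitive[OF assms]])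

lemma wderiv_funpow_unit:
  assumes "a \<le> b" "i < j"
  shows "wderiv a b j ((mean_zero_primitive a b ^^ i) (unit_aefun a b)) =
    (0 :: 'a::{real_normed_field,euclidean_space} aefun)"
proof (rule wderiv_eqI[OF in_L2_zero])
  obtain n where j: "j = Suc n + i" using assms(2) by (metis add.commute less_iff_Suc_add add_Suc)
  have "weak_deriv a b i ((mean_zero_primitive a b ^^ i) (unit_aefun a b)) (unit_aefun a b :: 'a aefun)"
    using weak_deriv_funpow_mean_zero_primitive[OF assms(1) in_L2_unit, of i 0] by simp
  from weak_deriv_trans_iff[OF this, of "Suc n"] weak_deriv_unit[of a b n, where 'a = 'a]
  show "weak_deriv a b j ((mean_zero_primitive a b ^^ i) (unit_aefun a b)) (0 :: 'a aefun)" by (simp only: j)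
qed

definition mean_coord :: "real \<Rightarrow> real \<Rightarrow> nat \<Rightarrow> 'a::{real_normed_field,euclidean_space} aefun \<Rightarrow> 'a" where
  "mean_coord a b i f = interval_mean a b (wderiv a b i f)"

text \<open>On (a, b) these are the rescaled Bernoulli polynomials (b-a)^i B_i((x-a)/(b-a)) / i!:
  each has the previous one as derivative and, from i = 1 on, mean zero.\<close>

definition mean_basis :: "real \<Rightarrow> real \<Rightarrow> nat \<Rightarrow> 'a::{real_normed_field,euclidean_space} aefun" where
  "mean_basis a b i = (mean_zero_primitive a b ^^ i) (unit_aefun a b)"

lemma bounded_operator_mean_coord:
  assumes "a < b" "i \<le> m"
  shows "bounded_operator (sobolev m a b) scalars
    (mean_coord a b i :: 'a::{real_normed_field,euclidean_space} aefun \<Rightarrow> 'a)"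
proof -
  have "bounded_operator (sobolev (i + (m - i)) a b) scalars (\<lambda>f :: 'a aefun. interval_mean a b (wderiv a b i f))"
    by (rule bounded_operator_compose[OF bounded_operator_compose[OF bounded_operator_wderiv
          bounded_operator_inclusion[of 0] normed_carrier_sobolev] bounded_operator_interval_mean normed_carrier_sobolev])
      (use assms in auto)
  then show ?thesis using assms by (simp add: mean_coord_def[abs_def])
qed

lemma mean_basis_in_sobolev:
  assumes "a < b"
  shows "(mean_basis a b i :: 'a::{real_normed_field,euclidean_space} aefun) \<in> carr (sobolev m a b)"
proof (induction i)
  case 0
  have "\<exists>g. in_L2 a b g \<and> weak_deriv a b j (unit_aefun a b :: 'a aefun) g" for j
    using in_L2_unit weak_deriv_0 weak_deriv_unit in_L2_zero by (cases j) blast+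
  then show ?case by (simp add: mean_basis_def in_L2_unit)
next
  case (Suc i)
  have "(mean_basis a b (Suc i) :: 'a aefun) = mean_zero_primitive a b (mean_basis a b i)" by (simp add: mean_basis_def)
  then have "(mean_basis a b (Suc i) :: 'a aefun) \<in> carr (sobolev (Suc m) a b)"
    using bounded_operatorD(1)[OF bounded_operator_mean_zero_primitive[OF assms] Suc] by simp
  then show ?case by (rule sobolev_antimono[rotated]) simp
qed

lemma mean_coord_funpow:
  assumes "a < b" "i < m" "in_L2 a b g"
  shows "mean_coord a b i ((mean_zero_primitive a b ^^ m) g) = 0"
proof -
  obtain n where m: "m = i + Suc n" using assms(2) by (metis less_iff_Suc_add add_Suc_right)
  have "wderiv a b i ((mean_zero_primitive a b ^^ m) g) = (mean_zero_primitive a b ^^ Suc n) g"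
    unfolding m using assms by (intro wderiv_funpow_mean_zero_primitive) auto
  then show ?thesis
    using assms by (simp add: mean_coord_def interval_mean_mean_zero_primitive in_L2_funpow_mean_zero_primitive)
qed

text \<open>For i \<le> j the i-th derivative of the j-th basis function is the basis function of
  index j - i, with mean zero if i < j and mean one if i = j; for i > j the derivative
  vanishes.\<close>

lemma mean_coord_basis:
  assumes "a < b"
  shows "mean_coord a b i (mean_basis a b j) = (if i = j then 1 else (0 :: 'a::{real_normed_field,euclidean_space}))"
proof -
  consider "i < j" | "i = j" | "j < i" by linarith
  then show ?thesis
  proof cases
    case 1
    then show ?thesis using mean_coord_funpow[OF assms 1 in_L2_unit] by (simp add: mean_basis_def)
  next
    case 2
    have "wderiv a b j ((mean_zero_primitive a b ^^ j) (unit_aefun a b)) = (unit_aefun a b :: 'a aefun)"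
      using wderiv_funpow_mean_zero_primitive[OF _ in_L2_unit, of a b j 0] assms by simp
    then show ?thesis using 2 assms by (simp add: mean_coord_def mean_basis_def interval_mean_unit)
  next
    case 3
    have "interval_mean a b (0 :: 'a aefun) = 0"
      by (rule bounded_operator_linear(1)[OF bounded_operator_interval_mean[OF assms] normed_carrier_sobolev normed_carrier_scalars])
    then show ?thesis
      using wderiv_funpow_unit[OF _ 3, of a b, where 'a = 'a] 3 assms by (simp add: mean_coord_def mean_basis_def)
  qed
qed

text \<open>Descending induction on the order: if the derivative of order i + 1 vanishes, the one of
  order i is constant, and its mean, the i-th coordinate, forces the constant to be zero.\<close>

lemma sobolev_eq_0_if_coords:
  fixes f :: "'a::{real_normed_field,euclidean_space} aefun"
  assumes ab: "a < b" and f: "f \<in> carr (sobolev m a b)" and D: "wderiv a b m f = 0"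
    and p: "\<And>i. i < m \<Longrightarrow> mean_coord a b i f = 0"
  shows "f = 0"
proof -
  have "j \<le> m \<Longrightarrow> wderiv a b (m - j) f = 0" for j
  proof (induction j)
    case 0
    then show ?case using D by simp
  next
    case (Suc j)
    define i where "i = m - Suc j"
    have i: "i < m" "m - j = 1 + i" using Suc.prems by (auto simp: i_def)
    have L: "in_L2 a b (wderiv a b i f)" using sobolev_wderiv(1)[OF f] i by simp
    have "weak_deriv a b 1 (wderiv a b i f) (wderiv a b (1 + i) f)"
      using wderiv_wderiv(2)[of f i "m - i" a b 1] f i by simp
    then have "weak_deriv a b 1 (wderiv a b i f) 0" using Suc i by simp
    from weak_deriv_1_eq_0_imp_const[OF L this]
    obtain C where C: "wderiv a b i f = scale_aefun C (unit_aefun a b)" by blast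
    have u: "(unit_aefun a b :: 'a aefun) \<in> carr (sobolev 0 a b)" unfolding sobolev_0 by (rule in_L2_unit)
    have "mean_coord a b i f = C"
      using bounded_operatorD(3)[OF bounded_operator_interval_mean[OF ab] u, of C] ab
      by (simp add: mean_coord_def C interval_mean_unit)
    then have "C = 0" using p[OF i(1)] by simp
    moreover have "scale_aefun 0 (unit_aefun a b) = (0 :: 'a aefun)" by transfer simp
    ultimately show ?case using C by (simp add: i_def)
  qed
  from this[of m] have "wderiv a b 0 f = 0" by simp
  then show ?thesis using wderiv_0[of a b f] f by simp
qed

lemma interval_integral_diff_scale_sum:
  fixes g :: "'a::{real_normed_field,euclidean_space} aefun"
  assumes "in_L2 a b g" "\<And>r. r \<in> R \<Longrightarrow> in_L2 a b (\<xi> r)" "c < d"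
  shows "interval_integral c d (g - (\<Sum>r\<in>R. scale_aefun (\<mu> r) (\<xi> r)))
    = interval_integral c d g - (\<Sum>r\<in>R. \<mu> r * interval_integral c d (\<xi> r))"
proof -
  let ?S = "sobolev 0 a b :: ('a, 'a aefun) normed_space"
  have b: "bounded_operator ?S scalars (interval_integral c d)"
  proof -
    have "bounded_operator ?S scalars (\<lambda>f. scal scalars (of_real (d - c)) (interval_mean c d f))"
      by (intro bounded_operator_scale bounded_operator_interval_mean normed_carrier_scalars assms)
    moreover have "of_real (d - c) * of_real (1 / (d - c)) = (1 :: 'a)"
      using assms(3) by (simp flip: of_real_mult)
    ultimately show ?thesis by (simp add: interval_mean_def mult.assoc[symmetric] del: of_real_divide of_real_diff)
  qed
  note L = bounded_operator_linear[OF b normed_carrier_sobolev normed_carrier_scalars]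
  interpret S: normed_carrier ?S by (rule normed_carrier_sobolev)
  have g: "g \<in> carr ?S" and x: "\<And>r. r \<in> R \<Longrightarrow> scale_aefun (\<mu> r) (\<xi> r) \<in> carr ?S"
    unfolding sobolev_0 using assms by (auto intro: in_L2_scale)
  have "(\<Sum>r\<in>R. scale_aefun (\<mu> r) (\<xi> r)) \<in> carr ?S" by (rule S.carr_sum) (rule x)
  from L(3)[OF g this] L(4)[of R "\<lambda>r. scale_aefun (\<mu> r) (\<xi> r)", OF x]
  show ?thesis by (simp add: interval_integral_scale)
qed

text \<open>This plays the role of a compact embedding, in quantitative form. Subtracting cell means
  makes the primitive vanish at every node; between nodes it only sees one cell of length h, where
  Cauchy-Schwarz contributes sqrt h.\<close>

lemma partition_means_small:
  fixes a b \<epsilon> :: real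
  assumes ab: "a < b" and \<epsilon>: "0 < \<epsilon>"
  obtains n :: nat and \<mu> :: "nat \<Rightarrow> 'a::{real_normed_field,euclidean_space} aefun \<Rightarrow> 'a" and \<xi>
  where "\<And>r. r < n \<Longrightarrow> bounded_operator (sobolev 0 a b) scalars (\<mu> r)"
    "\<And>r. r < n \<Longrightarrow> \<xi> r \<in> carr (sobolev 0 a b)"
    "\<And>r s. r < n \<Longrightarrow> s < n \<Longrightarrow> \<mu> r (\<xi> s) = (if r = s then 1 else 0)"
    "\<And>g. in_L2 a b g \<Longrightarrow>
      norm_L2 (primitive_aefun a b (g - (\<Sum>r<n. scale_aefun (\<mu> r g) (\<xi> r)))) \<le> \<epsilon> * norm_L2 g"
proof -
  \<comment> \<open>The final bound is 2 * sqrt (b - a) * sqrt h with h = (b - a) / n, that is 2 (b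
    - a) / sqrt n, and the choice of n makes it at most \<epsilon>. The successor below makes n
    positive.\<close>
  obtain n0 :: nat where n0: "(2 * (b - a) / \<epsilon>)\<^sup>2 \<le> real n0" using real_arch_simple by blast
  define n where "n = Suc n0"
  have n: "n > 0" "(2 * (b - a) / \<epsilon>)\<^sup>2 \<le> real n" using n0 by (auto simp: n_def)
  define h where "h = (b - a) / real n"
  have h: "h > 0" using ab n by (simp add: h_def)
  define t where "t r = a + real r * h" for r
  have t0: "t 0 = a" and tn: "t n = b" using n by (simp_all add: t_def h_def)
  have tS: "t (Suc r) = t r + h" for r by (simp add: t_def algebra_simps)
  have tmono: "r \<le> s \<Longrightarrow> t r \<le> t s" for r s using h by (simp add: t_def mult_right_mono)
  define \<mu> :: "nat \<Rightarrow> 'a aefun \<Rightarrow> 'a" where "\<mu> r = interval_mean (t r) (t (Suc r))" for r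
  define \<xi> :: "nat \<Rightarrow> 'a aefun" where "\<xi> r = unit_aefun (t r) (t (Suc r))" for r
  have lt: "t r < t (Suc r)" for r using h by (simp add: tS)
  have \<xi>L: "in_L2 a b (\<xi> r)" if "r < n" for r
    unfolding \<xi>_def using tmono[of 0 r] tmono[of "Suc r" n] that
    by (intro in_L2_mono[OF in_L2_unit]) (auto simp: t0 tn)
  have int0: "interval_integral c d (\<xi> r) = 0" if "t s \<le> c" "d \<le> t (Suc s)" "r \<noteq> s" for r s c d
  proof -
    have "d \<le> t r \<or> t (Suc r) \<le> c"
      using that tmono[of "Suc s" r] tmono[of "Suc r" s] by (cases "r < s") auto
    then show ?thesis unfolding \<xi>_def by (rule interval_integral_unit_disjoint)
  qed
  have int1: "interval_integral (t s) d (\<xi> s) = of_real (d - t s)" if "t s \<le> d" "d \<le> t (Suc s)" for s d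
    unfolding \<xi>_def using that by (intro interval_integral_unit) auto
  show thesis
  proof (rule that[of n \<mu> \<xi>])
    show "bounded_operator (sobolev 0 a b) scalars (\<mu> r)" for r
      unfolding \<mu>_def by (rule bounded_operator_interval_mean[OF lt])
    show "\<xi> r \<in> carr (sobolev 0 a b)" if "r < n" for r unfolding sobolev_0 by (rule \<xi>L[OF that])
    show "\<mu> r (\<xi> s) = (if r = s then 1 else 0)" for r s
    proof (cases "r = s")
      case True
      then show ?thesis unfolding \<mu>_def \<xi>_def using lt[of s] by (simp add: interval_mean_unit)
    next
      case False
      then show ?thesis unfolding \<mu>_def interval_mean_def using int0[of r "t r" "t (Suc r)" s] by simp
    qed
    fix g :: "'a aefun" assume g: "in_L2 a b g"
    define w where "w = g - (\<Sum>r<n. scale_aefun (\<mu> r g) (\<xi> r))"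
    have w: "in_L2 a b w"
      unfolding w_def by (intro in_L2_diff g norm_L2_sum_le(1) in_L2_scale \<xi>L) auto
    have part: "interval_integral (t s) d w = interval_integral (t s) d g - \<mu> s g * of_real (d - t s)"
      if "s < n" "t s < d" "d \<le> t (Suc s)" for s d
    proof -
      have "interval_integral (t s) d w
          = interval_integral (t s) d g - (\<Sum>r<n. \<mu> r g * interval_integral (t s) d (\<xi> r))"
        unfolding w_def by (rule interval_integral_diff_scale_sum[OF g]) (use \<xi>L that in auto)
      also have "(\<Sum>r<n. \<mu> r g * interval_integral (t s) d (\<xi> r))
          = (\<Sum>r<n. if r = s then \<mu> s g * of_real (d - t s) else 0)"
        using that by (intro sum.cong refl) (auto simp: int1 int0[of s])
      finally show ?thesis using that(1) by simp
    qed
    have full: "interval_integral (t s) (t (Suc s)) w = 0" if "s < n" for s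
    proof -
      have "\<mu> s g * of_real (t (Suc s) - t s) = of_real (1 / (t (Suc s) - t s) * (t (Suc s) - t s)) * interval_integral (t s) (t (Suc s)) g"
        by (simp only: \<mu>_def interval_mean_def of_real_mult mult.commute mult.left_commute mult.assoc)
      then have "\<mu> s g * of_real (t (Suc s) - t s) = interval_integral (t s) (t (Suc s)) g"
        using lt[of s] by simp
      then show ?thesis using part[OF that lt order_refl] by simp
    qed
    have nodes: "s \<le> n \<Longrightarrow> interval_integral a (t s) w = 0" for s
    proof (induction s)
      case 0
      have "norm (interval_integral a a w) \<le> sqrt (a - a) * norm_L2 w"
        by (rule norm_interval_integral_le[OF w order_refl])
      then show ?case by (simp add: t0)
    next
      case (Suc s)
      have "interval_integral a (t (Suc s)) w = interval_integral a (t s) w + interval_integral (t s) (t (Suc s)) w"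
        using tmono[of 0 s] lt[of s] by (intro interval_integral_split[OF w]) (auto simp: t0)
      then show ?case using Suc full[of s] by simp
    qed
    \<comment> \<open>Two terms of size sqrt h occur, one from \<open>g\<close> itself and one from
      its mean over the cell containing x; hence the factor 2.\<close>
    have bound: "norm (interval_integral a x w) \<le> 2 * sqrt h * norm_L2 g" if x: "a < x" "x < b" for x
    proof -
      define s where "s = nat \<lfloor>(x - a) / h\<rfloor>"
      have "0 \<le> (x - a) / h" using x h by simp
      then have s: "real s \<le> (x - a) / h" "(x - a) / h < real s + 1" unfolding s_def by linarith+
      then have s': "t s \<le> x" "x < t (Suc s)" using h by (auto simp: t_def field_simps)
      have "s < n"
      proof (rule ccontr)
        assume "\<not> s < n"
        then have "b \<le> t s" using tmono[of n s] tn by simp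
        then show False using s'(1) x(2) by simp
      qed
      show ?thesis
      proof (cases "t s = x")
        case True
        then show ?thesis using nodes[of s] \<open>s < n\<close> h norm_L2_nonneg[of g] by simp
      next
        case False
        then have tx: "t s < x" using s'(1) by simp
        have "interval_integral a x w = interval_integral (t s) x w"
          using interval_integral_split[OF w, of a "t s" x] nodes[of s] \<open>s < n\<close> s'(1) tmono[of 0 s] by (simp add: t0)
        also have "\<dots> = interval_integral (t s) x g - \<mu> s g * of_real (x - t s)"
          using part[OF \<open>s < n\<close> tx] s'(2) by simp
        finally have eq: "interval_integral a x w = interval_integral (t s) x g - \<mu> s g * of_real (x - t s)" .
        have 1: "norm (interval_integral (t s) x g) \<le> sqrt h * norm_L2 g"
        proof -
          have "norm (interval_integral (t s) x g) \<le> sqrt (x - t s) * norm_L2 g"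
            using tx by (intro norm_interval_integral_le[OF g]) simp
          also have "\<dots> \<le> sqrt h * norm_L2 g"
            using s'(2) by (intro mult_right_mono norm_L2_nonneg) (simp add: tS)
          finally show ?thesis .
        qed
        have "norm (\<mu> s g * of_real (x - t s)) = (x - t s) / h * norm (interval_integral (t s) (t (Suc s)) g)"
          unfolding \<mu>_def interval_mean_def norm_mult norm_of_real using tx h by (simp add: tS)
        also have "\<dots> \<le> 1 * (sqrt (t (Suc s) - t s) * norm_L2 g)"
          using tx s'(2) h lt[of s] by (intro mult_mono norm_interval_integral_le[OF g]) (auto simp: tS)
        finally have 2: "norm (\<mu> s g * of_real (x - t s)) \<le> sqrt h * norm_L2 g" by (simp add: tS)
        show ?thesis unfolding eq using norm_triangle_ineq4[of "interval_integral (t s) x g" "\<mu> s g * of_real (x - t s)"] 1 2 by linarith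
      qed
    qed
    have "0 \<le> 2 * sqrt h * norm_L2 g" using h norm_L2_nonneg[of g] by simp
    from primitive_aefun_bound(2)[OF w less_imp_le[OF ab] this bound]
    have "norm_L2 (primitive_aefun a b w) \<le> (2 * (sqrt (b - a) * sqrt h)) * norm_L2 g" by simp
    also have "2 * (sqrt (b - a) * sqrt h) \<le> \<epsilon>"
    proof -
      have s: "sqrt (b - a) * sqrt h = (b - a) / sqrt (real n)"
        using ab by (simp add: h_def real_sqrt_divide)
      have le: "2 * (b - a) / \<epsilon> \<le> sqrt (real n)" using n(2) by (rule real_le_rsqrt)
      have "2 * (x / S) \<le> e" if "2 * x / e \<le> S" "e > 0" "S > 0" for x S e :: real
        using that by (simp add: field_simps)
      from this[OF le \<epsilon>] show ?thesis unfolding s using n(1) by simp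
    qed
    finally show "norm_L2 (primitive_aefun a b w) \<le> \<epsilon> * norm_L2 g"
      using norm_L2_nonneg[of g] by (simp add: mult_right_mono)
  qed
qed

text \<open>Increments C / 2 ^ n sum to tails of at most 2 * C / 2 ^ n, and the squares of both
  bounds are what \<open>L2_on_complete\<close> asks for.\<close>

lemma complete_carrier_L2:
  "complete_carrier (sobolev 0 a b :: ('a::{real_normed_field,euclidean_space}, 'a aefun) normed_space)"
proof -
  let ?S = "sobolev 0 a b :: ('a, 'a aefun) normed_space"
  interpret S: normed_carrier ?S by (rule normed_carrier_sobolev)
  show ?thesis
    unfolding complete_carrier_def
  proof (intro allI impI, elim conjE)
    fix u :: "nat \<Rightarrow> 'a aefun" and C
    assume u: "\<forall>n. u n \<in> carr ?S" and d: "\<forall>n. nrm ?S (u (Suc n) - u n) \<le> C / 2 ^ n"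
    have L: "in_L2 a b (u n)" for n using u unfolding sobolev_0 by blast
    have nn: "nrm ?S (u m - u n) = norm_L2 (u m - u n)" for m n
      by (rule nrm_sobolev_0[OF in_L2_diff[OF L L]])
    have C: "0 \<le> C" using d[rule_format, of 0] S.nrm_ge_0[of "u (Suc 0) - u 0"] by simp
    have tail: "norm_L2 (u (n + j) - u n) \<le> 2 * C / 2 ^ n - 2 * C / 2 ^ (n + j)" for n j
    proof (induction j)
      case 0
      then show ?case by (simp add: norm_L2_zero)
    next
      case (Suc j)
      have "norm_L2 (u (n + Suc j) - u n) \<le> norm_L2 (u (Suc (n + j)) - u (n + j)) + norm_L2 (u (n + j) - u n)"
        using S.nrm_diff_triangle[of "u (Suc (n + j))" "u (n + j)" "u n"] u by (simp only: nn add_Suc_right)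
      also have "\<dots> \<le> C / 2 ^ (n + j) + (2 * C / 2 ^ n - 2 * C / 2 ^ (n + j))"
        using Suc d[rule_format, of "n + j"] by (simp only: nn)
      also have "\<dots> = 2 * C / 2 ^ n - 2 * C / 2 ^ (n + Suc j)" by simp
      finally show ?case .
    qed
    define D where "D n = (2 * C / 2 ^ n)\<^sup>2" for n :: nat
    have "(norm_L2 (u m - u n))\<^sup>2 \<le> D n" if "n \<le> m" for m n
    proof -
      have "norm_L2 (u m - u n) \<le> 2 * C / 2 ^ n - 2 * C / 2 ^ m" using tail[of n "m - n"] that by simp
      also have "\<dots> \<le> 2 * C / 2 ^ n" using C by simp
      finally show ?thesis unfolding D_def by (intro power_mono norm_L2_nonneg)
    qed
    then have 2: "\<forall>m n. n \<le> m \<longrightarrow> (norm_L2 (u m - u n))\<^sup>2 \<le> D n" by blast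
    have 1: "\<forall>n. (norm_L2 (u (Suc n) - u n))\<^sup>2 \<le> C\<^sup>2 / 4 ^ n"
    proof
      fix n
      have "(norm_L2 (u (Suc n) - u n))\<^sup>2 \<le> (C / 2 ^ n)\<^sup>2"
        using d nn by (intro power_mono norm_L2_nonneg) auto
      also have "\<dots> = C\<^sup>2 / 4 ^ n"
      proof -
        have "((2::real) ^ n)\<^sup>2 = (2\<^sup>2) ^ n" by (simp only: power_mult[symmetric] mult.commute)
        then show ?thesis by (simp add: power_divide)
      qed
      finally show "(norm_L2 (u (Suc n) - u n))\<^sup>2 \<le> C\<^sup>2 / 4 ^ n" .
    qed
    have "D \<longlonglongrightarrow> (2 * C * 0)\<^sup>2"
    proof -
      have "(\<lambda>n. (2 * C * (1 / 2) ^ n)\<^sup>2) \<longlonglongrightarrow> (2 * C * 0)\<^sup>2"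
        by (intro tendsto_power tendsto_mult tendsto_const LIMSEQ_power_zero) simp
      moreover have "D = (\<lambda>n. (2 * C * (1 / 2) ^ n)\<^sup>2)"
        by (rule ext) (simp add: D_def power_one_over)
      ultimately show ?thesis by simp
    qed
    then have D: "D \<longlonglongrightarrow> 0" by simp
    have allL: "\<forall>n. in_L2 a b (u n)" using L by blast
    have "\<exists>g. in_L2 a b g \<and> (\<lambda>n. (norm_L2 (u n - g))\<^sup>2) \<longlonglongrightarrow> 0"
      using allL 1 2 D
    proof (transfer fixing: C D)
      fix a b and u :: "nat \<Rightarrow> real \<Rightarrow> 'a"
      assume L: "\<forall>n. L2_on a b (u n)"
        and 1: "\<forall>n. (sqrt (LINT x|lebesgue. (norm (u (Suc n) x - u n x))\<^sup>2))\<^sup>2 \<le> C\<^sup>2 / 4 ^ n"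
        and 2: "\<forall>m n. n \<le> m \<longrightarrow> (sqrt (LINT x|lebesgue. (norm (u m x - u n x))\<^sup>2))\<^sup>2 \<le> D n"
        and D: "D \<longlonglongrightarrow> 0"
      obtain g where "L2_on a b g" "(\<lambda>n. LINT x|lebesgue. (norm (u n x - g x))\<^sup>2) \<longlonglongrightarrow> 0"
      proof (rule L2_on_complete[of a b u "C\<^sup>2" D])
        show "L2_on a b (u n)" for n using L by blast
        show "(LINT x|lebesgue. (norm (u (Suc n) x - u n x))\<^sup>2) \<le> C\<^sup>2 / 4 ^ n" for n
          using 1[rule_format, of n] by simp
        show "(LINT x|lebesgue. (norm (u m x - u n x))\<^sup>2) \<le> D n" if "n \<le> m" for m n
          using 2[rule_format, OF that] by simp
      qed (use D that in auto)
      then show "\<exists>g. L2_on a b g \<and> (\<lambda>n. (sqrt (LINT x|lebesgue. (norm (u n x - g x))\<^sup>2))\<^sup>2) \<longlonglongrightarrow> 0"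
        by auto
    qed
    then obtain g where g: "in_L2 a b g" "(\<lambda>n. (norm_L2 (u n - g))\<^sup>2) \<longlonglongrightarrow> 0" by blast
    have "(\<lambda>n. sqrt ((norm_L2 (u n - g))\<^sup>2)) \<longlonglongrightarrow> sqrt 0" by (intro tendsto_real_sqrt g(2))
    then have "(\<lambda>n. nrm ?S (u n - g)) \<longlonglongrightarrow> 0"
      by (simp add: norm_L2_nonneg nrm_sobolev_0[OF in_L2_diff[OF L g(1)]])
    then show "\<exists>x\<in>carr ?S. (\<lambda>n. nrm ?S (u n - x)) \<longlonglongrightarrow> 0" using g(1) sobolev_0 by blast
  qed
qed

section \<open>The difference operator\<close>

interpretation aefun: vector_space scale_aefun
  by (rule vector_space_scale_aefun)

lemma restrict_zero: "restrict_aefun c d 0 = 0"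
  by transfer simp

lemma shift_zero: "shift_aefun h 0 = 0"
  by transfer simp

lemma restrict_sum:
  fixes f :: "'i \<Rightarrow> 'a::field aefun"
  shows "restrict_aefun c d (\<Sum>i\<in>I. f i) = (\<Sum>i\<in>I. restrict_aefun c d (f i))"
  by (induction I rule: infinite_finite_induct) (auto simp: restrict_zero restrict_add)

lemma shift_sum:
  fixes f :: "'i \<Rightarrow> 'a::field aefun"
  shows "shift_aefun h (\<Sum>i\<in>I. f i) = (\<Sum>i\<in>I. shift_aefun h (f i))"
  by (induction I rule: infinite_finite_induct) (auto simp: shift_zero shift_add)

section \<open>Pieces over unit intervals\<close>

lemma shift_shift: "shift_aefun h (shift_aefun h' f) = shift_aefun (h + h') f"
  by transfer (simp add: add.assoc)

lemma restrict_shift_restrict: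
  assumes "c \<le> h" "h + 1 \<le> d"
  shows "restrict_aefun 0 1 (shift_aefun h (restrict_aefun c d f)) = restrict_aefun 0 1 (shift_aefun h f)"
  using assms by transfer auto

lemma restrict_shift_restrict_disjoint:
  assumes "h + 1 \<le> c \<or> d \<le> h"
  shows "restrict_aefun 0 1 (shift_aefun h (restrict_aefun c d f)) = 0"
  using assms by transfer auto

lemma restrict_disjoint:
  assumes "in_L2 c d f" "b \<le> c \<or> d \<le> a"
  shows "restrict_aefun a b f = 0"
  using assms by transfer (auto simp: L2_on_def elim!: eventually_mono)

text \<open>The part over (l, l + 1), moved to (0, 1): pieces over different cells become elements
  of one space, on which matrices with scalar entries act.\<close>

definition unit_piece :: "int \<Rightarrow> 'a::zero aefun \<Rightarrow> 'a aefun" where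
  "unit_piece l f = restrict_aefun 0 1 (shift_aefun (of_int l) f)"

lemma unit_piece_sum:
  fixes f :: "'i \<Rightarrow> 'a::field aefun"
  shows "unit_piece l (\<Sum>i\<in>I. f i) = (\<Sum>i\<in>I. unit_piece l (f i))"
  by (simp add: unit_piece_def shift_sum restrict_sum)

lemma unit_piece_scale: "unit_piece l (scale_aefun s f) = scale_aefun s (unit_piece l f)"
  by (simp add: unit_piece_def shift_scale restrict_scale)

lemma unit_piece_diff:
  fixes f g :: "'a::field aefun"
  shows "unit_piece l (f - g) = unit_piece l f - unit_piece l g"
  unfolding unit_piece_def by transfer auto

lemma unit_piece_outside:
  assumes f: "in_L2 0 (real N + 1) f" and l: "l \<notin> {0..int N}"
  shows "unit_piece l f = 0"
proof -
  have "l + 1 \<le> 0 \<or> int N + 1 \<le> l" using l by auto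
  then have "(of_int (l + 1) :: real) \<le> of_int 0 \<or> (of_int (int N + 1) :: real) \<le> of_int l"
    unfolding of_int_le_iff .
  then have "1 \<le> 0 - real_of_int l \<or> real N + 1 - real_of_int l \<le> 0" by auto
  then show ?thesis
    unfolding unit_piece_def using in_L2_shift[OF f, of "of_int l"] by (intro restrict_disjoint)
qed

text \<open>The cells cover the interval up to finitely many integer points, which form a null
  set.\<close>

lemma eq_0_if_unit_pieces:
  assumes f: "in_L2 0 (real N + 1) f" and p: "\<And>i. i \<le> N \<Longrightarrow> unit_piece (int i) f = 0"
  shows "f = 0"
proof -
  have p': "\<forall>i\<in>{..N}. unit_piece (int i) f = 0" using p by simp
  show ?thesis
    using f p' unfolding unit_piece_def
  proof (transfer fixing: N)
    fix f :: "real \<Rightarrow> 'a"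
    assume f: "L2_on 0 (real N + 1) f"
      and p: "\<forall>i\<in>{..N}. AE x in lebesgue. (if 0 < x \<and> x < 1 then f (x + real_of_int (int i)) else 0) = 0"
    have "AE x in lebesgue. real i < x \<and> x < real i + 1 \<longrightarrow> f x = 0" if "i \<le> N" for i
    proof -
      have "AE x in lebesgue. (if 0 < x \<and> x < 1 then f (x + real_of_int (int i)) else 0) = 0" using p that by simp
      then have "AE x in lebesgue. (if 0 < x + (- real i) \<and> x + (- real i) < 1 then f (x + (- real i) + real_of_int (int i)) else 0) = 0"
        by (rule AE_lebesgue_shift)
      then show ?thesis by eventually_elim auto
    qed
    then have "AE x in lebesgue. \<forall>i\<in>{..N}. real i < x \<and> x < real i + 1 \<longrightarrow> f x = 0"
      by (intro AE_finite_allI) auto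
    moreover have "AE x in lebesgue. \<forall>i\<in>{..N}. x \<noteq> real i"
      by (intro AE_finite_allI AE_lebesgue_lborel AE_lborel_singleton) auto
    moreover have "AE x in lebesgue. x \<notin> {0<..<real N + 1} \<longrightarrow> f x = 0" using f by (simp add: L2_on_def)
    ultimately show "AE x in lebesgue. f x = 0"
    proof eventually_elim
      case (elim x)
      show ?case
      proof (cases "x \<in> {0<..<real N + 1}")
        case True
        define i where "i = nat \<lfloor>x\<rfloor>"
        have i: "real i \<le> x" "x < real i + 1" using True unfolding i_def by (auto; linarith)+
        then have "i \<le> N" using True by auto
        then show ?thesis using elim i by (metis atMost_iff order_le_less)
      qed (use elim in simp)
    qed
  qed
qed

section \<open>Mapping properties of the difference operator\<close>

lemma P_QR_alt:
  "P_QR N b y = (\<Sum>j = - int N..int N.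
     scale_aefun (of_real (b j)) (restrict_aefun 0 (real N + 1) (shift_aefun (of_int j) y)))"
  by (simp add: P_QR_def restrict_sum restrict_scale)

lemma P_QR_add: "P_QR N b (y + z) = P_QR N b y + P_QR N b z"
  by (simp add: P_QR_alt shift_add restrict_add aefun.scale_right_distrib sum.distrib)

lemma P_QR_zero: "P_QR N b 0 = 0"
  using P_QR_add[of N b 0 0] by simp

text \<open>Each shift moves the large interval onto one that still contains (0, N+1), so the
  subsequent restriction to (0, N+1) preserves weak derivatives.\<close>

lemma shift_interval_bounds:
  "j \<in> {- int N..int N} \<Longrightarrow> - real N - of_int j \<le> 0 \<and> real N + 1 \<le> 2 * real N + 1 - of_int j"
proof -
  assume "j \<in> {- int N..int N}"
  then have "(of_int (- int N) :: real) \<le> of_int j" "(of_int j :: real) \<le> of_int (int N)"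
    unfolding of_int_le_iff by auto
  then show ?thesis by auto
qed

lemma bounded_operator_P_QR:
  "bounded_operator (sobolev k (- real N) (2 * real N + 1)) (sobolev k 0 (real N + 1))
    (P_QR N b :: 'a::{real_normed_field,euclidean_space} aefun \<Rightarrow> 'a aefun)"
proof -
  have "bounded_operator (sobolev k (- real N) (2 * real N + 1)) (sobolev k 0 (real N + 1))
    (\<lambda>y :: 'a aefun. \<Sum>j = - int N..int N. scal (sobolev k 0 (real N + 1)) (of_real (b j))
      (restrict_aefun 0 (real N + 1) (shift_aefun (of_int j) y)))"
  proof (intro bounded_operator_sum bounded_operator_scale normed_carrier_sobolev)
    fix j assume "j \<in> {- int N..int N}"
    then show "bounded_operator (sobolev k (- real N) (2 * real N + 1)) (sobolev k 0 (real N + 1))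
        (\<lambda>y :: 'a aefun. restrict_aefun 0 (real N + 1) (shift_aefun (of_int j) y))"
      using shift_interval_bounds[of j N]
      by (intro bounded_operator_compose[OF bounded_operator_shift bounded_operator_restrict normed_carrier_sobolev]) auto
  qed
  then show ?thesis by (simp add: P_QR_alt[abs_def])
qed

text \<open>Differentiation commutes with translation, with restriction to a subinterval and with
  constant coefficients.\<close>

lemma wderiv_P_QR:
  assumes y: "y \<in> carr (sobolev k (- real N) (2 * real N + 1))" and i: "i \<le> k"
  shows "wderiv 0 (real N + 1) i (P_QR N b y) = P_QR N b (wderiv (- real N) (2 * real N + 1) i y)"
proof -
  let ?S = "sobolev k 0 (real N + 1) :: ('a, 'a aefun) normed_space"
  interpret S: normed_carrier ?S by (rule normed_carrier_sobolev)
  define z where "z j = restrict_aefun 0 (real N + 1) (shift_aefun (of_int j) y)" for j :: int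
  have z: "z j \<in> carr ?S"
    and Dz: "wderiv 0 (real N + 1) i (z j)
      = restrict_aefun 0 (real N + 1) (shift_aefun (of_int j) (wderiv (- real N) (2 * real N + 1) i y))"
    if "j \<in> {- int N..int N}" for j
  proof -
    note bd = shift_interval_bounds[OF that]
    have s: "shift_aefun (of_int j) y \<in> carr (sobolev k (- real N - of_int j) (2 * real N + 1 - of_int j))"
      by (rule bounded_operatorD(1)[OF bounded_operator_shift y])
    show "z j \<in> carr ?S" unfolding z_def
      using bounded_operatorD(1)[OF bounded_operator_restrict s] bd by blast
    show "wderiv 0 (real N + 1) i (z j)
      = restrict_aefun 0 (real N + 1) (shift_aefun (of_int j) (wderiv (- real N) (2 * real N + 1) i y))"
      unfolding z_def using wderiv_restrict[OF s i] wderiv_shift[OF y i] bd by simp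
  qed
  have W: "bounded_operator ?S (sobolev (k - i) 0 (real N + 1)) (wderiv 0 (real N + 1) i)"
    using bounded_operator_wderiv[of i "k - i" 0 "real N + 1", where 'a = 'a] i by simp
  have sz: "scale_aefun (of_real (b j)) (z j) \<in> carr ?S" if "j \<in> {- int N..int N}" for j
    using S.carr_scal[OF z[OF that], of "of_real (b j)"] unfolding sobolev_simps(2) .
  have "wderiv 0 (real N + 1) i (P_QR N b y) = (\<Sum>j = - int N..int N. wderiv 0 (real N + 1) i (scale_aefun (of_real (b j)) (z j)))"
    unfolding P_QR_alt z_def[symmetric]
    by (rule bounded_operator_linear(4)[OF W normed_carrier_sobolev normed_carrier_sobolev sz])
  also have "\<dots> = P_QR N b (wderiv (- real N) (2 * real N + 1) i y)"
    unfolding P_QR_alt by (intro sum.cong refl) (simp only: wderiv_scale[OF z i] Dz)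
  finally show ?thesis .
qed

text \<open>For \<open>B\<close> inverse to the matrix \<open>R1\<close> this inverts
  \<open>P_QR\<close> on functions living on (0, N+1): the shift by k - i brings the k-th piece over
  the i-th cell, where it is weighted with \<open>B i k\<close>.\<close>

definition Q_inv :: "nat \<Rightarrow> (nat \<Rightarrow> nat \<Rightarrow> real) \<Rightarrow>
    'a::{real_normed_field,euclidean_space} aefun \<Rightarrow> 'a aefun" where
  "Q_inv N B v = (\<Sum>i\<le>N. \<Sum>k\<le>N. scale_aefun (of_real (B i k))
     (restrict_aefun (real i) (real i + 1) (shift_aefun (of_int (int k - int i)) v)))"

lemma bounded_operator_Q_inv:
  "bounded_operator (sobolev 0 0 (real N + 1)) (sobolev 0 0 (real N + 1))
    (Q_inv N B :: 'a::{real_normed_field,euclidean_space} aefun \<Rightarrow> 'a aefun)"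
proof -
  let ?S = "sobolev 0 0 (real N + 1) :: ('a, 'a aefun) normed_space"
  have "bounded_operator ?S ?S (\<lambda>v. \<Sum>i\<le>N. \<Sum>k\<le>N. scal ?S (of_real (B i k))
     (restrict_aefun (real i) (real i + 1) (shift_aefun (of_int (int k - int i)) v)))"
  proof (intro bounded_operator_sum bounded_operator_scale normed_carrier_sobolev)
    fix i k assume ik: "i \<in> {..N}" "k \<in> {..N}"
    have 1: "bounded_operator ?S (sobolev 0 (real i) (real i + 1))
        (\<lambda>v. restrict_aefun (real i) (real i + 1) (shift_aefun (of_int (int k - int i)) v))"
      using ik
      by (intro bounded_operator_compose[OF bounded_operator_shift bounded_operator_restrict normed_carrier_sobolev]) auto
    show "bounded_operator ?S ?S
        (\<lambda>v. restrict_aefun (real i) (real i + 1) (shift_aefun (of_int (int k - int i)) v))"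
      using ik by (intro bounded_operator_compose[OF 1 bounded_operator_L2_extension normed_carrier_sobolev]) auto
  qed
  then show ?thesis by (simp add: Q_inv_def[abs_def])
qed

text \<open>Over cell i, the shift by j shows the piece of cell i + j, so with k = i + j the
  coefficient is the entry b (k - i) of \<open>R1\<close>. Since \<open>u\<close> lives on (0, N+1),
  only 0 \<le> k \<le> N survive; all of these occur among the shifts |j| \<le> N.\<close>

lemma unit_piece_P_QR:
  fixes u :: "'a::{real_normed_field,euclidean_space} aefun"
  assumes u: "in_L2 0 (real N + 1) u" and i: "i \<le> N"
  shows "unit_piece (int i) (P_QR N b u) = (\<Sum>k\<le>N. scale_aefun (of_real (b (int k - int i))) (unit_piece (int k) u))"
proof -
  have "unit_piece (int i) (P_QR N b u) = (\<Sum>j = - int N..int N. scale_aefun (of_real (b j)) (unit_piece (int i + j) u))"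
    unfolding P_QR_alt unit_piece_sum unit_piece_scale
  proof (intro sum.cong refl arg_cong2[where f = scale_aefun])
    fix j
    have "restrict_aefun 0 1 (shift_aefun (of_int (int i)) (restrict_aefun 0 (real N + 1) (shift_aefun (of_int j) u)))
        = restrict_aefun 0 1 (shift_aefun (of_int (int i)) (shift_aefun (of_int j) u))"
      using i by (intro restrict_shift_restrict) auto
    then show "unit_piece (int i) (restrict_aefun 0 (real N + 1) (shift_aefun (of_int j) u)) = unit_piece (int i + j) u"
      by (simp add: unit_piece_def shift_shift)
  qed
  also have "\<dots> = (\<Sum>l = int i - int N..int i + int N. scale_aefun (of_real (b (l - int i))) (unit_piece l u))"
    by (rule sum.reindex_bij_witness[where i = "\<lambda>l. l - int i" and j = "\<lambda>j. int i + j"]) auto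
  also have "\<dots> = (\<Sum>l = 0..int N. scale_aefun (of_real (b (l - int i))) (unit_piece l u))"
    using i by (intro sum.mono_neutral_right) (auto simp: unit_piece_outside[OF u])
  also have "\<dots> = (\<Sum>k\<le>N. scale_aefun (of_real (b (int k - int i))) (unit_piece (int k) u))"
    by (rule sum.reindex_bij_witness[where i = int and j = nat]) auto
  finally show ?thesis .
qed

lemma unit_piece_Q_inv:
  fixes v :: "'a::{real_normed_field,euclidean_space} aefun"
  assumes i: "i \<le> N"
  shows "unit_piece (int i) (Q_inv N B v) = (\<Sum>k\<le>N. scale_aefun (of_real (B i k)) (unit_piece (int k) v))"
proof -
  have piece: "unit_piece (int i) (restrict_aefun (real j) (real j + 1) (shift_aefun (of_int (int k - int j)) v))
      = (if j = i then unit_piece (int k) v else 0)" for j k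
  proof (cases "j = i")
    case True
    have "restrict_aefun 0 1 (shift_aefun (real i) (restrict_aefun (real i) (real i + 1) (shift_aefun (of_int (int k - int i)) v)))
        = restrict_aefun 0 1 (shift_aefun (real i) (shift_aefun (of_int (int k - int i)) v))"
      by (rule restrict_shift_restrict) auto
    then show ?thesis using True by (simp add: unit_piece_def shift_shift)
  next
    case False
    then have "i + 1 \<le> j \<or> j + 1 \<le> i" by auto
    then have "real (i + 1) \<le> real j \<or> real (j + 1) \<le> real i" unfolding of_nat_le_iff .
    then have "real i + 1 \<le> real j \<or> real j + 1 \<le> real i" by linarith
    then show ?thesis using False restrict_shift_restrict_disjoint by (auto simp: unit_piece_def)
  qed
  have "unit_piece (int i) (Q_inv N B v)
      = (\<Sum>j\<le>N. \<Sum>k\<le>N. scale_aefun (of_real (B j k)) (if j = i then unit_piece (int k) v else 0))"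
    unfolding Q_inv_def unit_piece_sum unit_piece_scale piece ..
  also have "\<dots> = (\<Sum>j\<le>N. if j = i then (\<Sum>k\<le>N. scale_aefun (of_real (B i k)) (unit_piece (int k) v)) else 0)"
    by (intro sum.cong refl) auto
  also have "\<dots> = (\<Sum>k\<le>N. scale_aefun (of_real (B i k)) (unit_piece (int k) v))"
    using i by simp
  finally show ?thesis .
qed

lemma scale_matrix_mult:
  fixes x :: "nat \<Rightarrow> 'a::{real_normed_field,euclidean_space} aefun"
  assumes AB: "\<And>j. j \<le> N \<Longrightarrow> (\<Sum>k\<le>N. A i k * B k j) = (if i = j then 1 else 0)" and i: "i \<le> N"
  shows "(\<Sum>k\<le>N. scale_aefun (of_real (A i k)) (\<Sum>j\<le>N. scale_aefun (of_real (B k j)) (x j))) = x i"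
proof -
  have "(\<Sum>k\<le>N. scale_aefun (of_real (A i k)) (\<Sum>j\<le>N. scale_aefun (of_real (B k j)) (x j)))
      = (\<Sum>j\<le>N. \<Sum>k\<le>N. scale_aefun (of_real (A i k * B k j)) (x j))"
    unfolding aefun.scale_sum_right aefun.scale_scale of_real_mult by (rule sum.swap)
  also have "\<dots> = (\<Sum>j\<le>N. scale_aefun (of_real (\<Sum>k\<le>N. A i k * B k j)) (x j))"
    by (simp add: aefun.scale_sum_left)
  also have "\<dots> = (\<Sum>j\<le>N. if j = i then x i else 0)"
    using AB by (intro sum.cong refl) auto
  finally show ?thesis using i by simp
qed

text \<open>The adjugate divided by the determinant is a two-sided inverse, spelled out entrywise to
  fit the sums over pieces.\<close>

lemma R1_inverse:
  assumes "Determinant.det (R1 N b) \<noteq> 0"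
  obtains B :: "nat \<Rightarrow> nat \<Rightarrow> real" where
    "\<And>i j. i \<le> N \<Longrightarrow> j \<le> N \<Longrightarrow> (\<Sum>k\<le>N. b (int k - int i) * B k j) = (if i = j then 1 else 0)"
    "\<And>i j. i \<le> N \<Longrightarrow> j \<le> N \<Longrightarrow> (\<Sum>k\<le>N. B i k * b (int j - int k)) = (if i = j then 1 else 0)"
proof -
  let ?d = "Determinant.det (R1 N b)"
  have R: "R1 N b \<in> carrier_mat (N + 1) (N + 1)" by (simp add: R1_def)
  note adj = adj_mat[OF R]
  define B where "B i j = adj_mat (R1 N b) $$ (i, j) / ?d" for i j
  have entry: "R1 N b $$ (i, j) = b (int j - int i)" if "i \<le> N" "j \<le> N" for i j
    using that by (simp add: R1_def)
  have prod: "(A * C) $$ (i, j) = (\<Sum>k\<le>N. A $$ (i, k) * C $$ (k, j))"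
    if "A \<in> carrier_mat (N + 1) (N + 1)" "C \<in> carrier_mat (N + 1) (N + 1)" "i \<le> N" "j \<le> N"
    for A C :: "real mat" and i j
  proof -
    have "(A * C) $$ (i, j) = (\<Sum>k = 0..<N + 1. A $$ (i, k) * C $$ (k, j))"
      using that by (auto simp: times_mat_def scalar_prod_def)
    also have "{0..<N + 1} = {..N}" by auto
    finally show ?thesis .
  qed
  show thesis
  proof (rule that[of B])
    fix i j assume ij: "i \<le> N" "j \<le> N"
    have "(\<Sum>k\<le>N. b (int k - int i) * B k j) = (R1 N b * adj_mat (R1 N b)) $$ (i, j) / ?d"
      unfolding prod[OF R adj(1) ij] sum_divide_distrib
      by (intro sum.cong refl) (use ij in \<open>simp add: entry B_def\<close>)
    also have "\<dots> = (if i = j then 1 else 0)" unfolding adj(2) using assms ij by simp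
    finally show "(\<Sum>k\<le>N. b (int k - int i) * B k j) = (if i = j then 1 else 0)" .
    have "(\<Sum>k\<le>N. B i k * b (int j - int k)) = (adj_mat (R1 N b) * R1 N b) $$ (i, j) / ?d"
      unfolding prod[OF adj(1) R ij] sum_divide_distrib
      by (intro sum.cong refl) (use ij in \<open>simp add: entry B_def\<close>)
    also have "\<dots> = (if i = j then 1 else 0)" unfolding adj(3) using assms ij by simp
    finally show "(\<Sum>k\<le>N. B i k * b (int j - int k)) = (if i = j then 1 else 0)" .
  qed
qed

text \<open>Two functions living on (0, N+1) agree if their unit pieces do, and on pieces each claim
  is one of the two matrix identities.\<close>

lemma P_QR_inverse:
  assumes "Determinant.det (R1 N b) \<noteq> 0"
  obtains Q :: "'a::{real_normed_field,euclidean_space} aefun \<Rightarrow> 'a aefun" where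
    "bounded_operator (sobolev 0 0 (real N + 1)) (sobolev 0 0 (real N + 1)) Q"
    "\<And>v. in_L2 0 (real N + 1) v \<Longrightarrow> P_QR N b (Q v) = v"
    "\<And>v. in_L2 0 (real N + 1) v \<Longrightarrow> Q (P_QR N b v) = v"
proof -
  obtain B :: "nat \<Rightarrow> nat \<Rightarrow> real" where
    B: "\<And>i j. i \<le> N \<Longrightarrow> j \<le> N \<Longrightarrow> (\<Sum>k\<le>N. b (int k - int i) * B k j) = (if i = j then 1 else 0)"
    "\<And>i j. i \<le> N \<Longrightarrow> j \<le> N \<Longrightarrow> (\<Sum>k\<le>N. B i k * b (int j - int k)) = (if i = j then 1 else 0)"
    by (rule R1_inverse[OF assms]) (rule that)
  let ?S = "sobolev 0 0 (real N + 1) :: ('a, 'a aefun) normed_space"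
  let ?Q = "Q_inv N B :: 'a aefun \<Rightarrow> 'a aefun"
  have Q: "in_L2 0 (real N + 1) (?Q v)" if "in_L2 0 (real N + 1) v" for v
    using bounded_operatorD(1)[OF bounded_operator_Q_inv] that unfolding sobolev_0 by blast
  \<comment> \<open>\<open>P_QR\<close> acts on functions over the large interval; the extension by
    zero makes \<open>v\<close> one of them.\<close>
  have P: "in_L2 0 (real N + 1) (P_QR N b v)" if "in_L2 0 (real N + 1) v" for v :: "'a aefun"
  proof -
    have "in_L2 (- real N) (2 * real N + 1) v" using that by (rule in_L2_mono) auto
    then show ?thesis using bounded_operatorD(1)[OF bounded_operator_P_QR[of 0 N b], of v] unfolding sobolev_0 by blast
  qed
  show thesis
  proof (rule that[of ?Q])
    show "bounded_operator ?S ?S ?Q" by (rule bounded_operator_Q_inv)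
    fix v :: "'a aefun" assume v: "in_L2 0 (real N + 1) v"
    have "P_QR N b (?Q v) - v = 0"
    proof (rule eq_0_if_unit_pieces)
      show "in_L2 0 (real N + 1) (P_QR N b (?Q v) - v)" by (intro in_L2_diff P Q v)
      fix i assume i: "i \<le> N"
      have "unit_piece (int i) (P_QR N b (?Q v))
          = (\<Sum>k\<le>N. scale_aefun (of_real (b (int k - int i))) (\<Sum>j\<le>N. scale_aefun (of_real (B k j)) (unit_piece (int j) v)))"
        unfolding unit_piece_P_QR[OF Q[OF v] i] by (intro sum.cong refl) (simp add: unit_piece_Q_inv)
      also have "\<dots> = unit_piece (int i) v"
        using scale_matrix_mult[of N "\<lambda>i k. b (int k - int i)" i B "\<lambda>j. unit_piece (int j) v"] B(1) i by simp
      finally show "unit_piece (int i) (P_QR N b (?Q v) - v) = 0" by (simp add: unit_piece_diff)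
    qed
    then show "P_QR N b (?Q v) = v" by simp
    have "?Q (P_QR N b v) - v = 0"
    proof (rule eq_0_if_unit_pieces)
      show "in_L2 0 (real N + 1) (?Q (P_QR N b v) - v)" by (intro in_L2_diff P Q v)
      fix i assume i: "i \<le> N"
      have "unit_piece (int i) (?Q (P_QR N b v))
          = (\<Sum>k\<le>N. scale_aefun (of_real (B i k)) (\<Sum>j\<le>N. scale_aefun (of_real (b (int j - int k))) (unit_piece (int j) v)))"
        unfolding unit_piece_Q_inv[OF i] by (intro sum.cong refl) (simp add: unit_piece_P_QR[OF v])
      also have "\<dots> = unit_piece (int i) v"
        using scale_matrix_mult[of N B i "\<lambda>k j. b (int j - int k)" "\<lambda>j. unit_piece (int j) v"] B(2) i by simp
      finally show "unit_piece (int i) (?Q (P_QR N b v) - v) = 0" by (simp add: unit_piece_diff)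
    qed
    then show "?Q (P_QR N b v) = v" by simp
  qed
qed

section \<open>The index of the boundary value problem\<close>

lemma bounded_operator_top_wderiv:
  "bounded_operator (sobolev m a b) (sobolev 0 a b) (wderiv a b m)"
  using bounded_operator_wderiv[of m 0 a b] by simp

lemma wderiv_zero: "wderiv a b m 0 = 0"
  by (rule wderiv_eqI[OF in_L2_zero weak_deriv_zero])

lemma mean_coord_zero: "a < b \<Longrightarrow> mean_coord a b i 0 = 0"
  unfolding mean_coord_def wderiv_zero
  by (rule bounded_operator_linear(1)[OF bounded_operator_interval_mean normed_carrier_sobolev normed_carrier_scalars])

lemma restrict_split:
  assumes g: "in_L2 (- real N) (2 * real N + 1) g"
  shows "restrict_aefun (- real N) 0 g + restrict_aefun (real N + 1) (2 * real N + 1) g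
    + restrict_aefun 0 (real N + 1) g = g"
  using assms
proof (transfer fixing: N)
  fix g :: "real \<Rightarrow> 'a"
  assume "L2_on (- real N) (2 * real N + 1) g"
  then have "AE x in lebesgue. x \<notin> {- real N<..<2 * real N + 1} \<longrightarrow> g x = 0" by (simp add: L2_on_def)
  moreover have "AE x in lebesgue. x \<noteq> 0" "AE x in lebesgue. x \<noteq> real N + 1"
    by (intro AE_lebesgue_lborel AE_lborel_singleton)+
  ultimately show "AE x in lebesgue. (if - real N < x \<and> x < 0 then g x else 0)
      + (if real N + 1 < x \<and> x < 2 * real N + 1 then g x else 0)
      + (if 0 < x \<and> x < real N + 1 then g x else 0) = g x"
    by eventually_elim auto
qed

theorem theorem7:
  fixes N k :: nat and b :: "int \<Rightarrow> real"
    and A1 :: "'a::{real_normed_field,euclidean_space} aefun \<Rightarrow> 'a aefun"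
  assumes "N \<ge> 1"
    and "Determinant.det (R1 N b) \<noteq> 0"
    and "Determinant.det (R2 N b) = 0"
    and "bounded_operator (sobolev 1 (- real N) (2 * real N + 1)) (sobolev 0 0 (real N + 1)) A1"
    and "bounded_operator (sobolev (k + 1) (- real N) (2 * real N + 1)) (sobolev k 0 (real N + 1)) A1"
  shows "fredholm (sobolev (k + 2) (- real N) (2 * real N + 1)) (W_target N k) (L_B N b A1) \<and>
    fredholm_index (sobolev (k + 2) (- real N) (2 * real N + 1)) (W_target N k) (L_B N b A1)
      = - 2 * (int k + 1)"
proof -
  define \<alpha> \<beta> \<gamma> where "\<alpha> = - real N" and "\<beta> = 2 * real N + 1" and "\<gamma> = real N + 1"
  \<comment> \<open>The outer intervals have length N, so \<open>N \<ge> 1\<close> makes them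
    nondegenerate, as interval means require.\<close>
  have ord: "\<alpha> < 0" "0 < \<gamma>" "\<gamma> < \<beta>" "\<alpha> < \<beta>" using assms(1) by (auto simp: \<alpha>_def \<beta>_def \<gamma>_def)
  define m where "m = k + 2"
  let ?P = "P_QR N b :: 'a aefun \<Rightarrow> 'a aefun"
  define X where "X = (sobolev m \<alpha> \<beta> :: ('a, 'a aefun) normed_space)"
  define H where "H = (sobolev 0 \<alpha> \<beta> :: ('a, 'a aefun) normed_space)"
  define F where "F = (sobolev k 0 \<gamma> :: ('a, 'a aefun) normed_space)"
  define L where "L = (sobolev m \<alpha> 0 :: ('a, 'a aefun) normed_space)"
  define G where "G = (sobolev m \<gamma> \<beta> :: ('a, 'a aefun) normed_space)"
  define Y where "Y = prod_space F (prod_space L G)"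
  note sob = X_def H_def F_def L_def G_def
  have nX: "normed_carrier X" and nH: "normed_carrier H" and nF: "normed_carrier F"
    and nL: "normed_carrier L" and nG: "normed_carrier G"
    unfolding sob by (rule normed_carrier_sobolev)+
  have nLG: "normed_carrier (prod_space L G)" by (rule normed_carrier_prod_space[OF nL nG])
  have nY: "normed_carrier Y" unfolding Y_def by (rule normed_carrier_prod_space[OF nF nLG])
  have nS: "normed_carrier (sobolev j x y :: ('a, 'a aefun) normed_space)" for j x y
    by (rule normed_carrier_sobolev)
  have A: "bounded_operator (sobolev (k + 1) \<alpha> \<beta>) F A1"
    unfolding F_def \<alpha>_def \<beta>_def \<gamma>_def by (rule assms(5))
  have AX: "bounded_operator X F A1"
    unfolding X_def by (rule bounded_operator_compose[OF bounded_operator_inclusion A nS]) (simp add: m_def)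
  have P: "bounded_operator (sobolev j \<alpha> \<beta>) (sobolev j 0 \<gamma>) ?P" for j
    unfolding \<alpha>_def \<beta>_def \<gamma>_def by (rule bounded_operator_P_QR)
  have carrH: "f \<in> carr H \<longleftrightarrow> in_L2 \<alpha> \<beta> f" for f unfolding H_def by (rule sobolev_0)
  \<comment> \<open>The inverse on functions living on (0, N+1); this is where the determinant of
    \<open>R1\<close> enters.\<close>
  obtain Q :: "'a aefun \<Rightarrow> 'a aefun" where Q0: "bounded_operator (sobolev 0 0 \<gamma>) (sobolev 0 0 \<gamma>) Q"
    and PQ: "\<And>v. in_L2 0 \<gamma> v \<Longrightarrow> ?P (Q v) = v" and QP: "\<And>v. in_L2 0 \<gamma> v \<Longrightarrow> Q (?P v) = v"
    by (rule P_QR_inverse[OF assms(2), folded \<gamma>_def]) (rule that)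
  note ext = bounded_operator_L2_extension[where a = \<alpha> and b = \<beta>]
  have Q: "bounded_operator (sobolev 0 0 \<gamma>) H Q"
    unfolding H_def using ord by (intro bounded_operator_compose[OF Q0 ext nS]) auto
  have inQ: "in_L2 0 \<gamma> (Q v)" if "in_L2 0 \<gamma> v" for v
    using bounded_operatorD(1)[OF Q0, of v] that unfolding sobolev_0 by blast
  have inP: "in_L2 0 \<gamma> (?P v)" if "in_L2 \<alpha> \<beta> v" for v
    using bounded_operatorD(1)[OF P[of 0], of v] that unfolding sobolev_0 by blast
  note Qlin = bounded_operator_linear[OF Q0 nS nS, unfolded sobolev_0]

  \<comment> \<open>Boundedness of the operator\<close>
  define T where "T = (L_B N b A1 :: 'a aefun \<Rightarrow> _)"
  have T_eq: "T y = (- wderiv 0 \<gamma> 2 (?P y) + A1 y, restrict_aefun \<alpha> 0 y, restrict_aefun \<gamma> \<beta> y)" for y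
    by (simp add: T_def L_B_def \<alpha>_def \<beta>_def \<gamma>_def)
  have D2: "bounded_operator (sobolev m 0 \<gamma>) F (wderiv 0 \<gamma> 2)"
    using bounded_operator_wderiv[of 2 k 0 \<gamma>, where 'a = 'a] unfolding F_def m_def by (simp only: add.commute)
  have T: "bounded_operator X Y T"
    unfolding T_eq[abs_def] Y_def
  proof (intro bounded_operator_Pair nX nF nL nG nLG bounded_operator_add bounded_operator_uminus AX)
    show "bounded_operator X F (\<lambda>y. wderiv 0 \<gamma> 2 (?P y))"
      unfolding X_def by (rule bounded_operator_compose[OF P D2 nS])
    show "bounded_operator X L (restrict_aefun \<alpha> 0)" "bounded_operator X G (restrict_aefun \<gamma> \<beta>)"
      unfolding sob using ord by (intro bounded_operator_restrict; simp)+
  qed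

  \<comment> \<open>Recovering the top derivative from the data\<close>
  define l0 where "l0 y = wderiv \<alpha> 0 m (fst (snd y))" for y :: "'a aefun \<times> 'a aefun \<times> 'a aefun"
  define r0 where "r0 y = wderiv \<gamma> \<beta> m (snd (snd y))" for y :: "'a aefun \<times> 'a aefun \<times> 'a aefun"
  define f0 where "f0 y = wderiv 0 \<gamma> k (fst y)" for y :: "'a aefun \<times> 'a aefun \<times> 'a aefun"
  \<comment> \<open>\<open>E y\<close> is the g with outer parts \<open>l0 y\<close> and
    \<open>r0 y\<close> whose inner part u solves P u = - f0 - P (l0 + r0), so that - P g equals
    \<open>f0 y\<close>: the inverse of the leading part.\<close>
  define E where "E y = l0 y + r0 y + Q (- f0 y - ?P (l0 y + r0 y))" for y
  have bF: "bounded_operator Y F fst" unfolding Y_def by (rule bounded_operator_fst)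
  have bLG: "bounded_operator Y (prod_space L G) snd" unfolding Y_def by (rule bounded_operator_snd)
  have bL: "bounded_operator Y L (\<lambda>y. fst (snd y))" by (rule bounded_operator_compose[OF bLG bounded_operator_fst nLG])
  have bG: "bounded_operator Y G (\<lambda>y. snd (snd y))" by (rule bounded_operator_compose[OF bLG bounded_operator_snd nLG])
  have l0': "bounded_operator Y (sobolev 0 \<alpha> 0) l0"
    unfolding l0_def[abs_def] using bounded_operator_compose[OF bL[unfolded L_def] bounded_operator_top_wderiv nS] .
  have r0': "bounded_operator Y (sobolev 0 \<gamma> \<beta>) r0"
    unfolding r0_def[abs_def] using bounded_operator_compose[OF bG[unfolded G_def] bounded_operator_top_wderiv nS] .
  have f0': "bounded_operator Y (sobolev 0 0 \<gamma>) f0"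
    unfolding f0_def[abs_def] using bounded_operator_compose[OF bF[unfolded F_def] bounded_operator_top_wderiv nS] .
  have l0: "bounded_operator Y H l0" and r0: "bounded_operator Y H r0"
    unfolding H_def using ord
    by (intro bounded_operator_compose[OF l0' ext nS] bounded_operator_compose[OF r0' ext nS]; simp)+
  have inl: "in_L2 \<alpha> 0 (l0 y)" and inr: "in_L2 \<gamma> \<beta> (r0 y)" and inf: "in_L2 0 \<gamma> (f0 y)" if "y \<in> carr Y" for y
    using bounded_operatorD(1)[OF l0' that] bounded_operatorD(1)[OF r0' that] bounded_operatorD(1)[OF f0' that]
    unfolding sobolev_0 by auto
  have E: "bounded_operator Y H E"
    unfolding E_def[abs_def]
    by (intro bounded_operator_add l0 r0 nH bounded_operator_compose[OF _ Q nS] bounded_operator_diff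
        bounded_operator_uminus f0' nS bounded_operator_compose[OF _ P[of 0, folded H_def] nH])

  \<comment> \<open>Right inverses and the perturbation\<close>
  let ?J = "mean_zero_primitive :: real \<Rightarrow> real \<Rightarrow> 'a aefun \<Rightarrow> 'a aefun"
  define D where "D = (wderiv \<alpha> \<beta> m :: 'a aefun \<Rightarrow> 'a aefun)"
  define V where "V = ?J \<alpha> \<beta> ^^ m"
  \<comment> \<open>This is \<open>E\<close> applied to (A1 x, 0, 0), the contribution of the
    lower-order term; the minus sign is that of \<open>- f0 y\<close>.\<close>
  define K where "K x = - Q (wderiv 0 \<gamma> k (A1 x))" for x
  \<comment> \<open>The leading part is applied to g, and each component is then integrated up to
    its own order, k or m, with vanishing mean coordinates.\<close>
  define W where "W g = ((?J 0 \<gamma> ^^ k) (- ?P g), (?J \<alpha> 0 ^^ m) (restrict_aefun \<alpha> 0 g),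
    (?J \<gamma> \<beta> ^^ m) (restrict_aefun \<gamma> \<beta> g))" for g
  have D: "bounded_operator X H D" unfolding D_def X_def H_def by (rule bounded_operator_top_wderiv)
  have V: "bounded_operator H X V"
    unfolding V_def X_def H_def by (rule bounded_operator_funpow_mean_zero_primitive[OF ord(4)])
  \<comment> \<open>The perturbation is bounded already on order k + 1, one less than the order m of
    the domain; this spare derivative pays for its smallness.\<close>
  have K1: "bounded_operator (sobolev (k + 1) \<alpha> \<beta>) H K"
    unfolding K_def[abs_def]
    by (intro bounded_operator_uminus nH bounded_operator_compose[OF _ Q nS]
        bounded_operator_compose[OF A[unfolded F_def] bounded_operator_top_wderiv nS])
  have K: "bounded_operator X H K"
    unfolding X_def by (rule bounded_operator_compose[OF bounded_operator_inclusion K1 nS]) (simp add: m_def)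
  have W: "bounded_operator H Y W"
    unfolding W_def[abs_def] Y_def
  proof (intro bounded_operator_Pair nH nF nL nG nLG)
    show "bounded_operator H F (\<lambda>g. (?J 0 \<gamma> ^^ k) (- ?P g))"
      unfolding F_def
      by (intro bounded_operator_compose[OF _ bounded_operator_funpow_mean_zero_primitive[OF ord(2)] nS]
          bounded_operator_uminus P[of 0, folded H_def] nS)
    show "bounded_operator H L (\<lambda>g. (?J \<alpha> 0 ^^ m) (restrict_aefun \<alpha> 0 g))"
      unfolding L_def H_def using ord
      by (intro bounded_operator_compose[OF bounded_operator_restrict
            bounded_operator_funpow_mean_zero_primitive[OF ord(1)] nS]) auto
    show "bounded_operator H G (\<lambda>g. (?J \<gamma> \<beta> ^^ m) (restrict_aefun \<gamma> \<beta> g))"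
      unfolding G_def H_def using ord
      by (intro bounded_operator_compose[OF bounded_operator_restrict
            bounded_operator_funpow_mean_zero_primitive[OF ord(3)] nS]) auto
  qed
  have split: "restrict_aefun \<alpha> 0 g + restrict_aefun \<gamma> \<beta> g + restrict_aefun 0 \<gamma> g = g" if "in_L2 \<alpha> \<beta> g" for g :: "'a aefun"
    using restrict_split[of N g] that unfolding \<alpha>_def \<beta>_def \<gamma>_def by simp
  \<comment> \<open>With u the inner part of g, \<open>?P g - ?P h\<close> is \<open>?P u\<close>,
    and \<open>Q\<close> returns u. Taking for w the negative k-th derivative of
    \<open>A1 x\<close>, or 0, gives \<open>ET\<close> and \<open>EW\<close>.\<close>
  have solve: "h + Q (?P g + w - ?P h) = g + Q w"
    if "in_L2 \<alpha> \<beta> g" "in_L2 0 \<gamma> w" "h = restrict_aefun \<alpha> 0 g + restrict_aefun \<gamma> \<beta> g" for g h w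
  proof -
    define u where "u = restrict_aefun 0 \<gamma> g"
    have u: "in_L2 0 \<gamma> u" unfolding u_def by (rule in_L2_restrict[OF that(1)])
    have g: "g = h + u" using split[OF that(1)] that(3) by (simp add: u_def)
    have Pu: "in_L2 0 \<gamma> (?P u)" using ord by (intro inP in_L2_mono[OF u]) auto
    have eq: "?P g + w - ?P h = ?P u - (- w)" unfolding g P_QR_add by simp
    have "Q (?P g + w - ?P h) = u + Q w"
      unfolding eq using Qlin(3)[OF Pu in_L2_uminus[OF that(2)]] Qlin(2)[OF that(2)] QP[OF u] by simp
    then show ?thesis using g by simp
  qed
  have ET: "E (T x) = D x + K x" if x: "x \<in> carr X" for x
  proof -
    have x': "x \<in> carr (sobolev m \<alpha> \<beta>)" using x unfolding X_def .
    have g: "in_L2 \<alpha> \<beta> (D x)" unfolding D_def by (rule sobolev_wderiv(1)[OF x' order_refl])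
    have lr: "l0 (T x) = restrict_aefun \<alpha> 0 (D x)" "r0 (T x) = restrict_aefun \<gamma> \<beta> (D x)"
      unfolding l0_def r0_def T_eq D_def using ord by (simp_all add: wderiv_restrict[OF x'])
    have Ax: "A1 x \<in> carr F" by (rule bounded_operatorD(1)[OF AX x])
    then have DAx: "in_L2 0 \<gamma> (wderiv 0 \<gamma> k (A1 x))" unfolding F_def by (rule sobolev_wderiv(1)) simp
    have Px: "?P x \<in> carr (sobolev m 0 \<gamma>)" by (rule bounded_operatorD(1)[OF P x'])
    then have PxF: "wderiv 0 \<gamma> 2 (?P x) \<in> carr F" by (rule bounded_operatorD(1)[OF D2])
    have Dk: "bounded_operator F (sobolev 0 0 \<gamma>) (wderiv 0 \<gamma> k)"
      unfolding F_def by (rule bounded_operator_top_wderiv)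
    have "wderiv 0 \<gamma> k (wderiv 0 \<gamma> 2 (?P x)) = wderiv 0 \<gamma> m (?P x)"
      using wderiv_wderiv(1)[of "?P x" 2 k 0 \<gamma> k] Px unfolding m_def by (simp only: add.commute order_refl)
    also have "\<dots> = ?P (D x)"
      using wderiv_P_QR[OF x'[unfolded \<alpha>_def \<beta>_def] order_refl] unfolding D_def \<alpha>_def \<beta>_def \<gamma>_def .
    finally have f: "f0 (T x) = wderiv 0 \<gamma> k (A1 x) - ?P (D x)"
      unfolding f0_def T_eq
      using bounded_operator_linear(3)[OF Dk nF nS Ax PxF] by (simp add: add.commute)
    have "E (T x) = (l0 (T x) + r0 (T x)) + Q (?P (D x) + (- wderiv 0 \<gamma> k (A1 x)) - ?P (l0 (T x) + r0 (T x)))"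
      unfolding E_def f by simp
    also have "\<dots> = D x + Q (- wderiv 0 \<gamma> k (A1 x))"
      by (rule solve[OF g in_L2_uminus[OF DAx]]) (simp add: lr)
    also have "\<dots> = D x + K x" unfolding K_def using Qlin(2)[OF DAx] by simp
    finally show ?thesis .
  qed
  have EW: "E (W g) = g" if g: "g \<in> carr H" for g
  proof -
    have g': "in_L2 \<alpha> \<beta> g" using g carrH by simp
    note w = wderiv_funpow_mean_zero_primitive[where j = 0, simplified]
    have lr: "l0 (W g) = restrict_aefun \<alpha> 0 g" "r0 (W g) = restrict_aefun \<gamma> \<beta> g"
      unfolding l0_def r0_def W_def using ord by (simp_all add: w in_L2_restrict[OF g'])
    have "f0 (W g) = - ?P g"
      unfolding f0_def W_def using ord by (simp add: w in_L2_uminus[OF inP[OF g']])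
    then have "E (W g) = (l0 (W g) + r0 (W g)) + Q (?P g + 0 - ?P (l0 (W g) + r0 (W g)))" unfolding E_def by simp
    also have "\<dots> = g + Q 0" by (rule solve[OF g' in_L2_zero]) (simp add: lr)
    finally show ?thesis using Qlin(1) by simp
  qed

  \<comment> \<open>Coordinates of the target\<close>
  define q where "q = case_sum (\<lambda>i y :: 'a aefun \<times> 'a aefun \<times> 'a aefun. mean_coord 0 \<gamma> i (fst y))
    (case_sum (\<lambda>i y :: 'a aefun \<times> 'a aefun \<times> 'a aefun. mean_coord \<alpha> 0 i (fst (snd y))) (\<lambda>i y :: 'a aefun \<times> 'a aefun \<times> 'a aefun. mean_coord \<gamma> \<beta> i (snd (snd y))))"
  define f where "f = case_sum (\<lambda>i. (mean_basis 0 \<gamma> i :: 'a aefun, 0 :: 'a aefun, 0 :: 'a aefun))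
    (case_sum (\<lambda>i. (0, mean_basis \<alpha> 0 i, 0)) (\<lambda>i. (0, 0, mean_basis \<gamma> \<beta> i)))"
  define I where "I = {..<k} <+> ({..<m} <+> {..<m})"
  note mc0 = mean_coord_zero[OF ord(1)] mean_coord_zero[OF ord(2)] mean_coord_zero[OF ord(3)]
  have mcF: "bounded_operator F scalars (mean_coord 0 \<gamma> i)" if "i < k" for i
    unfolding F_def using that by (intro bounded_operator_mean_coord[OF ord(2)]) simp
  have mcL: "bounded_operator L scalars (mean_coord \<alpha> 0 i)" if "i < m" for i
    unfolding L_def using that by (intro bounded_operator_mean_coord[OF ord(1)]) simp
  have mcG: "bounded_operator G scalars (mean_coord \<gamma> \<beta> i)" if "i < m" for i
    unfolding G_def using that by (intro bounded_operator_mean_coord[OF ord(3)]) simp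
  have q: "bounded_operator Y scalars (q i)" if "i \<in> I" for i
    using that unfolding I_def
    by (auto simp: q_def intro!: bounded_operator_compose[OF bF mcF nF] bounded_operator_compose[OF bL mcL nL]
        bounded_operator_compose[OF bG mcG nG])
  have f: "f i \<in> carr Y" if "i \<in> I" for i
    using that mean_basis_in_sobolev[OF ord(1), of _ m] mean_basis_in_sobolev[OF ord(2), of _ k]
      mean_basis_in_sobolev[OF ord(3), of _ m] normed_carrier.carr_zero[OF nF]
      normed_carrier.carr_zero[OF nL] normed_carrier.carr_zero[OF nG]
    unfolding I_def Y_def f_def sob by (auto simp del: sobolev_simps)
  have qf: "q i (f j) = (if i = j then 1 else 0)" if "i \<in> I" "j \<in> I" for i j
    using that unfolding I_def
    by (auto simp: q_def f_def mc0 mean_coord_basis[OF ord(1)] mean_coord_basis[OF ord(2)]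
        mean_coord_basis[OF ord(3)] split: if_splits)
  have qW: "q i (W g) = 0" if "i \<in> I" "g \<in> carr H" for i g
  proof -
    have g: "in_L2 \<alpha> \<beta> g" using that(2) carrH by simp
    show ?thesis
      using that(1) unfolding I_def
      by (auto simp: q_def W_def mean_coord_funpow[OF ord(1)] mean_coord_funpow[OF ord(2)]
          mean_coord_funpow[OF ord(3)] in_L2_restrict[OF g] in_L2_uminus[OF inP[OF g]])
  qed
  have Ef: "E (f i) = 0" if "i \<in> I" for i
  proof -
    have "l0 (f i) = 0 \<and> r0 (f i) = 0 \<and> f0 (f i) = 0"
      using that ord unfolding I_def l0_def r0_def f0_def f_def mean_basis_def
      by (auto simp: wderiv_zero wderiv_funpow_unit)
    then show ?thesis unfolding E_def using Qlin(1) by (simp add: P_QR_zero)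
  qed
  have Eq: "y = 0" if y: "y \<in> carr Y" "E y = 0" "\<And>i. i \<in> I \<Longrightarrow> q i y = 0" for y
  proof -
    obtain y1 y2 y3 where yy: "y = (y1, y2, y3)" by (cases y)
    define v where "v = - f0 y - ?P (l0 y + r0 y)"
    have lr: "in_L2 \<alpha> \<beta> (l0 y)" "in_L2 \<alpha> \<beta> (r0 y)"
      using in_L2_mono[OF inl[OF y(1)]] in_L2_mono[OF inr[OF y(1)]] ord by auto
    have v: "in_L2 0 \<gamma> v"
      unfolding v_def by (intro in_L2_diff in_L2_uminus inf[OF y(1)] inP in_L2_add lr)
    have sum0: "l0 y + r0 y + Q v = 0" using y(2) unfolding E_def v_def .
    \<comment> \<open>The three summands live on disjoint intervals, so restricting the sum isolates
      each outer one; once these vanish, \<open>Q v = 0\<close> forces v and hence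
      \<open>f0 y\<close> to vanish.\<close>
    have "restrict_aefun \<alpha> 0 (l0 y + r0 y + Q v) = l0 y"
      unfolding restrict_add using ord
      by (simp add: restrict_id[OF inl[OF y(1)]] restrict_disjoint[OF inr[OF y(1)]] restrict_disjoint[OF inQ[OF v]])
    then have l: "l0 y = 0" unfolding sum0 by (simp add: restrict_zero)
    have "restrict_aefun \<gamma> \<beta> (l0 y + r0 y + Q v) = r0 y"
      unfolding restrict_add using ord
      by (simp add: restrict_id[OF inr[OF y(1)]] restrict_disjoint[OF inl[OF y(1)]] restrict_disjoint[OF inQ[OF v]])
    then have r: "r0 y = 0" unfolding sum0 by (simp add: restrict_zero)
    have "Q v = 0" using sum0 l r by simp
    then have "v = 0" using PQ[OF v] by (simp add: P_QR_zero)
    then have f: "f0 y = 0" unfolding v_def l r by (simp add: P_QR_zero)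
    have c: "y1 \<in> carr F" "y2 \<in> carr L" "y3 \<in> carr G" using y(1) unfolding Y_def yy by auto
    have "mean_coord 0 \<gamma> i y1 = 0" if "i < k" for i
      using y(3)[of "Inl i"] that unfolding I_def q_def yy by auto
    then have "y1 = 0"
      using sobolev_eq_0_if_coords[OF ord(2) c(1)[unfolded F_def]] f unfolding f0_def yy by simp
    moreover have "mean_coord \<alpha> 0 i y2 = 0" if "i < m" for i
      using y(3)[of "Inr (Inl i)"] that unfolding I_def q_def yy by auto
    then have "y2 = 0"
      using sobolev_eq_0_if_coords[OF ord(1) c(2)[unfolded L_def]] l unfolding l0_def yy by simp
    moreover have "mean_coord \<gamma> \<beta> i y3 = 0" if "i < m" for i
      using y(3)[of "Inr (Inr i)"] that unfolding I_def q_def yy by auto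
    then have "y3 = 0"
      using sobolev_eq_0_if_coords[OF ord(3) c(3)[unfolded G_def]] r unfolding r0_def yy by simp
    ultimately show ?thesis unfolding yy by (simp add: zero_prod_def)
  qed

  \<comment> \<open>Smallness after removal of the cell means\<close>
  obtain C1 where C1: "0 \<le> C1" "\<And>x. x \<in> carr (sobolev (k + 1) \<alpha> \<beta>) \<Longrightarrow> nrm H (K x) \<le> C1 * nrm (sobolev (k + 1) \<alpha> \<beta>) x"
    by (rule bounded_operator_bound[OF K1 nS]) (rule that)
  have V1: "bounded_operator H (sobolev (k + 1) \<alpha> \<beta>) (?J \<alpha> \<beta> ^^ (k + 1))"
    unfolding H_def by (rule bounded_operator_funpow_mean_zero_primitive[OF ord(4)])
  obtain C2 where C2: "0 \<le> C2" "\<And>g. g \<in> carr H \<Longrightarrow> nrm (sobolev (k + 1) \<alpha> \<beta>) ((?J \<alpha> \<beta> ^^ (k + 1)) g) \<le> C2 * nrm H g"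
    by (rule bounded_operator_bound[OF V1 nH]) (rule that)
  obtain C3 where C3: "0 \<le> C3" "\<And>h :: 'a aefun. h \<in> carr H \<Longrightarrow>
      nrm H (h - scale_aefun (interval_mean \<alpha> \<beta> h) (unit_aefun \<alpha> \<beta>)) \<le> C3 * nrm H h"
    by (rule bounded_operator_bound[OF bounded_operator_subtract_mean[OF ord(4)] nS, folded H_def]) (rule that)
  \<comment> \<open>The three constants bound the operators through which the primitive passes; the
    summand 1 avoids division by zero, and the factor 2 leaves the 1/2 that the Neumann series
    requires.\<close>
  define \<epsilon> where "\<epsilon> = 1 / (2 * (C1 * (C2 * C3) + 1))"
  have "0 \<le> C1 * (C2 * C3)" using C1(1) C2(1) C3(1) by simp
  then have \<epsilon>: "0 < \<epsilon>" "C1 * (C2 * (C3 * \<epsilon>)) \<le> 1 / 2" by (simp_all add: \<epsilon>_def field_simps)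
  obtain n :: nat and \<mu> :: "nat \<Rightarrow> 'a aefun \<Rightarrow> 'a" and \<xi>
    where \<mu>: "\<And>r. r < n \<Longrightarrow> bounded_operator H scalars (\<mu> r)" and \<xi>: "\<And>r. r < n \<Longrightarrow> \<xi> r \<in> carr H"
      and \<mu>\<xi>: "\<And>r s. r < n \<Longrightarrow> s < n \<Longrightarrow> \<mu> r (\<xi> s) = (if r = s then 1 else 0)"
      and part: "\<And>g. in_L2 \<alpha> \<beta> g \<Longrightarrow>
        norm_L2 (primitive_aefun \<alpha> \<beta> (g - (\<Sum>r<n. scale_aefun (\<mu> r g) (\<xi> r)))) \<le> \<epsilon> * norm_L2 g"
    by (rule partition_means_small[OF ord(4) \<epsilon>(1), where 'a = 'a, folded H_def]) (rule that)
  have small: "nrm H (K (V (g - (\<Sum>r\<in>{..<n}. scal H (\<mu> r g) (\<xi> r))))) \<le> nrm H g / 2" if g: "g \<in> carr H" for g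
  proof -
    define w where "w = g - (\<Sum>r<n. scale_aefun (\<mu> r g) (\<xi> r))"
    have g': "in_L2 \<alpha> \<beta> g" using g carrH by simp
    have w: "in_L2 \<alpha> \<beta> w"
      unfolding w_def using \<xi> carrH by (intro in_L2_diff g' norm_L2_sum_le(1) in_L2_scale) auto
    define h where "h = primitive_aefun \<alpha> \<beta> w"
    have h: "in_L2 \<alpha> \<beta> h" unfolding h_def using ord by (intro in_L2_primitive w) auto
    have Jw: "?J \<alpha> \<beta> w \<in> carr H" using in_L2_mean_zero_primitive[OF _ w] ord carrH by simp
    \<comment> \<open>One of the m = k + 2 primitives is split off and applied first. It gains the
      smallness, while the remaining k + 1 reach the order on which \<open>K1\<close> bounds the
      perturbation.\<close>
    have "nrm H (K (V w)) = nrm H (K ((?J \<alpha> \<beta> ^^ (k + 1)) (?J \<alpha> \<beta> w)))"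
      unfolding V_def m_def by (simp add: funpow_swap1)
    also have "\<dots> \<le> C1 * nrm (sobolev (k + 1) \<alpha> \<beta>) ((?J \<alpha> \<beta> ^^ (k + 1)) (?J \<alpha> \<beta> w))"
      by (rule C1(2)[OF bounded_operatorD(1)[OF V1 Jw]])
    also have "\<dots> \<le> C1 * (C2 * nrm H (?J \<alpha> \<beta> w))"
      by (rule mult_left_mono[OF C2(2)[OF Jw] C1(1)])
    also have "\<dots> \<le> C1 * (C2 * (C3 * nrm H h))"
      using C3(2)[of h] h carrH unfolding mean_zero_primitive_def h_def[symmetric]
      by (intro mult_left_mono C1(1) C2(1)) auto
    also have "\<dots> \<le> C1 * (C2 * (C3 * (\<epsilon> * nrm H g)))"
      using part[OF g'] unfolding w_def[symmetric] h_def[symmetric] H_def nrm_sobolev_0[OF h] nrm_sobolev_0[OF g']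
      by (intro mult_left_mono C1(1) C2(1) C3(1))
    also have "\<dots> = (C1 * (C2 * (C3 * \<epsilon>))) * nrm H g" by simp
    also have "\<dots> \<le> 1 / 2 * nrm H g"
      by (rule mult_right_mono[OF \<epsilon>(2) normed_carrier.nrm_ge_0[OF nH]])
    finally show ?thesis unfolding w_def H_def by simp
  qed

  \<comment> \<open>Coordinates of the domain and conclusion\<close>
  have pb: "bounded_operator X scalars (mean_coord \<alpha> \<beta> i)" if "i \<in> {..<m}" for i
    unfolding X_def using that by (intro bounded_operator_mean_coord[OF ord(4)]) simp
  have eb: "mean_basis \<alpha> \<beta> i \<in> carr X" for i unfolding X_def by (rule mean_basis_in_sobolev[OF ord(4)])
  have pe: "mean_coord \<alpha> \<beta> i (mean_basis \<alpha> \<beta> j) = (if i = j then 1 else (0 :: 'a))" for i j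
    by (rule mean_coord_basis[OF ord(4)])
  have DV: "D (V g) = g" if "g \<in> carr H" for g
    using wderiv_funpow_mean_zero_primitive[of \<alpha> \<beta> g m 0] that ord carrH unfolding D_def V_def by simp
  have pV: "mean_coord \<alpha> \<beta> i (V g) = 0" if "i \<in> {..<m}" "g \<in> carr H" for i g
    using mean_coord_funpow[OF ord(4), of i m g] that carrH unfolding V_def by simp
  have De: "D (mean_basis \<alpha> \<beta> i) = 0" if "i \<in> {..<m}" for i
    using wderiv_funpow_unit[of \<alpha> \<beta> i m, where 'a = 'a] that ord unfolding D_def mean_basis_def by simp
  have Dp: "x = 0" if "x \<in> carr X" "D x = 0" "\<And>i. i \<in> {..<m} \<Longrightarrow> mean_coord \<alpha> \<beta> i x = 0" for x
    using sobolev_eq_0_if_coords[OF ord(4) that(1)[unfolded X_def]] that(2,3) unfolding D_def by simp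
  have cH: "complete_carrier H" unfolding H_def by (rule complete_carrier_L2)
  have finI: "finite I" unfolding I_def by simp
  have lessThan: "\<And>r. r \<in> {..<n} \<Longrightarrow> r < n" by simp
  note main = fredholm_identity_plus_compact[OF nX nY nH cH T D V E W K finite_lessThan[of m] finI finite_lessThan[of n]
      pb eb pe DV pV De Dp q f qf EW qW Ef Eq ET \<mu>[OF lessThan] \<xi>[OF lessThan] \<mu>\<xi>[OF lessThan lessThan] small]
  have XY: "X = sobolev (k + 2) (- real N) (2 * real N + 1)" "Y = W_target N k"
    unfolding Y_def sob W_target_def m_def \<alpha>_def \<beta>_def \<gamma>_def by simp_all
  have card: "int (card {..<m}) - int (card I) = - 2 * (int k + 1)"
    unfolding I_def by (simp add: card_Plus m_def)
  have "fredholm X Y T \<and> fredholm_index X Y T = - 2 * (int k + 1)"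
    by (rule conjI[OF main(1) trans[OF main(2) card]])
  then show ?thesis unfolding XY T_def .
qed

end
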